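(* Let $B>1$, let $p\ge 1$ be an integer, and let $T$ be a random field on $S^2$ as described in the context whose angular power spectrum $\{C_l\}$ satisfies the regularity condition (R) of the context with parameters $\alpha>2$ and $M\in\mathbb{N}$. Assume that $\alpha<4p+2$ and $M\ge 4p+2-\alpha$. Then there exists a constant $C_M>0$ such that, for all scales $j_1,j_2\ge 1$ and all indices $k_1,k_2$, $$\left|\mathrm{Corr}\left(\beta_{j_1k_1;p},\beta_{j_2k_2;p}\right)\right|\le \frac{C_M}{\left(1+B^{\frac{j_1+j_2}{2}-\log_B\left(\frac{j_1+j_2}{2}\right)}\,d\left(\xi_{j_1k_1},\xi_{j_2k_2}\right)\right)^{4p+2-\alpha}} .$$
   Context: Random field. $T$ is a real-valued, zero-mean, finite-variance, mean-square continuous, isotropic random field on the unit sphere $S^2$, with spectral representation (in the mean-square sense) $T(x)=\sum_{l\ge 0}\sum_{m=-l}^{l}a_{lm}Y_{lm}(x)$, $x\in S^2$. Here $\{Y_{lm}\}$ are the standard spherical harmonics (an orthonormal basis of $L^2(S^2)$ with $\Delta_{S^2}Y_{lm}=-l(l+1)Y_{lm}$), and $\{a_{lm}\}$ is a triangular array of zero-mean, orthogonal random variables (complex-valued for $m\neq 0$) with $\mathbb{E}|a_{lm}|^2=C_l$. The sequence $\{C_l\}$ is the angular power spectrum; mean-square continuity entails $\sum_l(2l+1)C_l<\infty$. Regularity condition (R) with parameters $\alpha>2$ and $M\in\mathbb{N}$: for every $B>1$ there exist a sequence of functions $\{g_j\}_{j=1,2,\dots}$ and constants $c_0,c_1,\dots,c_M>0$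 such that $$C_l=l^{-\alpha}g_j\left(\frac{l}{B^j}\right)>0\quad\text{for } B^{j-1}<l<B^{j+1},\ j=1,2,\dots,$$ where $c_0^{-1}\le g_j\le c_0$ for all $j\in\mathbb{N}$, and $\sup_j\sup_{B^{-1}\le u\le B}\left|\frac{d^r}{du^r}g_j(u)\right|\le c_r$ for $r=1,\dots,M$. Mexican needlet coefficients. For each scale $j$, $\{\xi_{jk}\}_k$ is a finite set of points of $S^2$ and $\{\lambda_{jk}\}_k$ are associated positive weights. The Mexican needlet of order $p$ is $$\psi_{jk;p}(x)=\sqrt{\lambda_{jk}}\sum_{l\ge1}\left(\frac{l(l+1)}{B^{2j}}\right)^{p}e^{-l(l+1)/B^{2j}}\sum_{m=-l}^{l}Y_{lm}(\xi_{jk})\overline{Y_{lm}(x)},$$ and the random Mexican needlet coefficients are $$\beta_{jk;p}=\int_{S^2}T(x)\psi_{jk;p}(x)\,dx=\sqrt{\lambda_{jk}}\sum_{l\ge1}\left(\frac{l(l+1)}{B^{2j}}\right)^{p}e^{-l(l+1)/B^{2j}}\sum_{m=-l}^{l}a_{lm}Y_{lm}(\xi_{jk}).$$ The correlation of two such coefficients is $\mathrm{Corr}(\beta,\beta')=\mathbb{E}[\beta\beta']/\sqrt{\mathbb{E}[\beta^2]\,\mathbb{E}[\beta'^2]}$. The distance on the sphere is $d(\xi,\eta)=\arccos\langle\xi,\eta\rangle$. *)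

theory Defs
  imports "HOL-Probability.Probability" "HOL-Computational_Algebra.Polynomial"
begin

abbreviation S2 :: "(real^3) set" where
  "S2 \<equiv> sphere 0 1"

definition sphere_dist :: "real^3 \<Rightarrow> real^3 \<Rightarrow> real" where
  "sphere_dist x y = arccos (x \<bullet> y)"

(* The surface measure sin \<theta> d\<theta> d\<phi>, of total mass 4 pi, as a measure on the subspace S2. *)
definition surface_measure :: "(real^3) measure" where
  "surface_measure =
     distr
       (density (restrict_space lborel ({0..pi} \<times> {0..2*pi})) (\<lambda>(\<theta>, \<phi>). ennreal (sin \<theta>)))
       (restrict_space borel S2)
       (\<lambda>(\<theta>, \<phi>). vector [sin \<theta> * cos \<phi>, sin \<theta> * sin \<phi>, cos \<theta>])"

(* Rodrigues' formula. *)
definition legendre_poly :: "nat \<Rightarrow> real poly" where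
  "legendre_poly l = smult (1 / (2 ^ l * fact l)) ((pderiv ^^ l) ([:-1, 0, 1:] ^ l))"

(* The standard (Condon-Shortley) harmonics
     sqrt ((2l+1)/(4 pi) * (l-m)!/(l+m)!) * P_l^m (cos \<theta>) * exp (i m \<phi>),
     P_l^m t = (-1)^m * (1 - t^2)^(m/2) * (d/dt)^m P_l t,
   in Cartesian coordinates: for x in S2 with spherical coordinates (\<theta>, \<phi>) one has
   cos \<theta> = x$3 and sin^m \<theta> * exp (i m \<phi>) = (x$1 + i x$2)^m.
   Only used for -l \<le> m \<le> l and x in S2. *)
definition sph_harm :: "nat \<Rightarrow> int \<Rightarrow> real^3 \<Rightarrow> complex" where
  "sph_harm l m x =
     (let n = nat \<bar>m\<bar>;
          y = complex_of_real ((-1) ^ n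
                * sqrt ((2 * real l + 1) / (4 * pi) * (fact (l - n) / fact (l + n)))
                * poly ((pderiv ^^ n) (legendre_poly l)) (x $ 3))
              * Complex (x $ 1) (x $ 2) ^ n
      in if m \<ge> 0 then y else (-1) ^ n * cnj y)"

(* Isotropy is invariance of the second-order structure under SO(3); together with the zero
   mean it is implied by invariance of the finite-dimensional laws. Joint measurability is what
   gives a meaning to the integrals of the sample paths over the sphere. *)
definition isotropic_random_field :: "'w measure \<Rightarrow> (real^3 \<Rightarrow> 'w \<Rightarrow> real) \<Rightarrow> bool" where
  "isotropic_random_field P T \<longleftrightarrow>
     prob_space P \<and>
     (\<lambda>(x, \<omega>). T x \<omega>) \<in> borel_measurable (restrict_space borel S2 \<Otimes>\<^sub>M P) \<and>
     (\<forall>x\<in>S2. integrable P (\<lambda>\<omega>. (T x \<omega>)\<^sup>2)) \<and>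
     (\<forall>x\<in>S2. (\<integral>\<omega>. T x \<omega> \<partial>P) = 0) \<and>
     (\<forall>x\<in>S2. ((\<lambda>y. \<integral>\<omega>. (T y \<omega> - T x \<omega>)\<^sup>2 \<partial>P) \<longlongrightarrow> 0) (at x within S2)) \<and>
     (\<forall>A. rotation_matrix A \<longrightarrow>
        (\<forall>x\<in>S2. \<forall>y\<in>S2.
           (\<integral>\<omega>. T (A *v x) \<omega> * T (A *v y) \<omega> \<partial>P) = (\<integral>\<omega>. T x \<omega> * T y \<omega> \<partial>P)))"

definition harmonic_coefficients ::
    "'w measure \<Rightarrow> (nat \<Rightarrow> real) \<Rightarrow> (nat \<Rightarrow> int \<Rightarrow> 'w \<Rightarrow> complex) \<Rightarrow> bool" where
  "harmonic_coefficients P C a \<longleftrightarrow>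
     (\<forall>l. \<forall>m\<in>{-int l..int l}.
        a l m \<in> borel_measurable P \<and>
        integrable P (\<lambda>\<omega>. (cmod (a l m \<omega>))\<^sup>2) \<and>
        (\<integral>\<omega>. a l m \<omega> \<partial>P) = 0 \<and>
        (\<integral>\<omega>. (cmod (a l m \<omega>))\<^sup>2 \<partial>P) = C l) \<and>
     (\<forall>l. AE \<omega> in P. a l 0 \<omega> \<in> \<real>) \<and>
     (\<forall>l l'. \<forall>m\<in>{-int l..int l}. \<forall>m'\<in>{-int l'..int l'}.
        (l, m) \<noteq> (l', m') \<longrightarrow> (\<integral>\<omega>. a l m \<omega> * cnj (a l' m' \<omega>) \<partial>P) = 0)"

(* For each x in S2 the harmonic expansion of T x converges in mean square. *)
definition spectral_representation ::
    "'w measure \<Rightarrow> (real^3 \<Rightarrow> 'w \<Rightarrow> real) \<Rightarrow> (nat \<Rightarrow> int \<Rightarrow> 'w \<Rightarrow> complex) \<Rightarrow> bool" where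
  "spectral_representation P T a \<longleftrightarrow>
     (\<forall>x\<in>S2.
        (\<lambda>L. \<integral>\<omega>. (cmod (complex_of_real (T x \<omega>)
                 - (\<Sum>l\<le>L. \<Sum>m=-int l..int l. a l m \<omega> * sph_harm l m x)))\<^sup>2 \<partial>P)
        \<longlonglongrightarrow> 0)"

(* D j r is the r-th derivative of g_j = D j 0 on the interval [1/B, B], one-sided at the
   endpoints; the constants c r may depend on B but not on j. *)
definition regularity_condition :: "real \<Rightarrow> nat \<Rightarrow> (nat \<Rightarrow> real) \<Rightarrow> bool" where
  "regularity_condition \<alpha> M C \<longleftrightarrow>
     (\<forall>B>1. \<exists>(g :: nat \<Rightarrow> real \<Rightarrow> real) (D :: nat \<Rightarrow> nat \<Rightarrow> real \<Rightarrow> real) (c :: nat \<Rightarrow> real).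
        (\<forall>r\<le>M. c r > 0) \<and>
        (\<forall>j\<ge>1.
           (\<forall>l. B ^ (j - 1) < real l \<and> real l < B ^ (j + 1) \<longrightarrow>
              C l = real l powr (-\<alpha>) * g j (real l / B ^ j) \<and> C l > 0) \<and>
           (\<forall>u\<in>{1/B..B}. 1 / c 0 \<le> g j u \<and> g j u \<le> c 0) \<and>
           D j 0 = g j \<and>
           (\<forall>r<M. \<forall>u\<in>{1/B..B}.
              (D j r has_real_derivative D j (Suc r) u) (at u within {1/B..B})) \<and>
           (\<forall>r\<in>{1..M}. \<forall>u\<in>{1/B..B}. \<bar>D j r u\<bar> \<le> c r)))"

(* The Mexican needlet of order p at scale j, with cubature point \<xi> and cubature weight w. *)
definition mexican_needlet ::
    "real \<Rightarrow> nat \<Rightarrow> nat \<Rightarrow> real \<Rightarrow> real^3 \<Rightarrow> real^3 \<Rightarrow> complex" where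
  "mexican_needlet B p j w \<xi> x =
     complex_of_real (sqrt w) *
     (\<Sum>\<^sub>\<infinity>l\<in>{1..}.
        complex_of_real ((real (l * (l + 1)) / B ^ (2 * j)) ^ p
                         * exp (- (real (l * (l + 1)) / B ^ (2 * j))))
        * (\<Sum>m=-int l..int l. sph_harm l m \<xi> * cnj (sph_harm l m x)))"

(* The integral is a real number, because the inner sum over m in the needlet is real
   (it equals (2l+1)/(4 pi) * P_l (\<xi> \<bullet> x)); Re only changes its type. *)
definition needlet_coeff ::
    "(real^3 \<Rightarrow> 'w \<Rightarrow> real) \<Rightarrow> real \<Rightarrow> nat \<Rightarrow> nat \<Rightarrow> real \<Rightarrow> real^3 \<Rightarrow> 'w \<Rightarrow> real" where
  "needlet_coeff T B p j w \<xi> \<omega> =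
     Re (\<integral>x. complex_of_real (T x \<omega>) * mexican_needlet B p j w \<xi> x \<partial>surface_measure)"

(* Correlation of zero-mean variables. *)
definition corr :: "'w measure \<Rightarrow> ('w \<Rightarrow> real) \<Rightarrow> ('w \<Rightarrow> real) \<Rightarrow> real" where
  "corr P X Y =
     (\<integral>\<omega>. X \<omega> * Y \<omega> \<partial>P) / sqrt ((\<integral>\<omega>. (X \<omega>)\<^sup>2 \<partial>P) * (\<integral>\<omega>. (Y \<omega>)\<^sup>2 \<partial>P))"

end

(*
  By the addition theorem the needlets are zonal, so after normalisation the covariance of two
  coefficients is a Legendre series
    K_t(x) = sum_l (2l+1) (l(l+1))^(2p) exp(-l(l+1)t) C_l P_l(x),   t = B^(-2 j1) + B^(-2 j2),
  at x = cos d, and the variances are the values at x = 1 for equal scales, which are of exact order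
  B^(j s) with s = 4p + 2 - alpha (before the common factor B^(-4pj)).
  Multiplying a Legendre series by 1 - x turns its coefficients into their discrete second-order
  differences, because of the three-term recurrence. Condition (R) bounds M finite differences of
  l^alpha C_l, so m <= M differences yield |K_t(cos d)| <= const d^(-m) t^(-(s-m)/2) as long as
  m < s. Since m = ceil(s) is needed, one writes K_t as K_{t+d^2} minus the integral of its
  t-derivative over [t, t+d^2]; the derivative has s + 2 in place of s. The integral is of order
  d^(-s), with an additional log(1/t), linear in the scales, exactly when s is an integer.
  For different scales the ratio of the normalisations supplies the factor B^(-|j1-j2| s / 2) that
  converts localization at the coarser scale into localization at the scale (j1 + j2) / 2.
*)
theory Submission imports Defs begin

section \<open>Legendre polynomials\<close>

text \<open>Neither rounding of s = 4p + 2 - \<alpha> works on K_t directly. With m < s differences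
  the bound exceeds d^(-s) by a factor (d / sqrt t)^(s - m); with m > s the low multipoles dominate
  and leave d^(-m), too large for small d. The difference of K_t and K_(t+d^2) carries the factor 1
  - exp(-l(l+1) d^2), which suppresses multipoles below 1/d; those stay in K_(t+d^2), for which the
  trivial bound is already of order d^(-s). The shift by log_B((j1+j2)/2) in the statement pays for
  the logarithm: with J = (j1+j2)/2 one has B^(J - log_B J) = B^J / J, and log(1/t) is at most a
  multiple of J. Condition (R) holds for every base, so it is invoked with bases suited to the
  proof, M + 2 for the differences and 2 for the lower bound on C_l, and not with the base B of the
  needlets. All estimates must be uniform in t. Hence the symbol classes carry an explicit constant,
  and the product rules have constants that do not depend on the sequences.\<close>

lemma higher_pderiv_pCons_0:
  "(pderiv ^^ n) (pCons 0 u) = pCons 0 ((pderiv ^^ n) u) + smult (of_nat n) ((pderiv ^^ (n - 1)) u)"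
  for u :: "real poly"
proof (induction n)
  case (Suc n)
  have e: "smult (of_nat n) (pderiv ((pderiv ^^ (n - 1)) u)) = smult (of_nat n) ((pderiv ^^ n) u)"
  proof (cases "n = 0")
    case False
    then have "(pderiv ^^ n) u = pderiv ((pderiv ^^ (n - 1)) u)"
      by (metis Suc_diff_1 bot_nat_0.not_eq_extremum funpow.simps(2) o_apply)
    then show ?thesis by simp
  next
    case True
    then show ?thesis by simp
  qed
  show ?case
    by (simp add: Suc pderiv_add pderiv_pCons pderiv_smult e[unfolded One_nat_def] smult_add_left algebra_simps)
qed simp

abbreviation leg :: "nat \<Rightarrow> nat \<Rightarrow> real \<Rightarrow> real" where
  "leg m l x \<equiv> poly ((pderiv ^^ m) (legendre_poly l)) x"

context
begin

private definition U :: "nat \<Rightarrow> real poly" where "U l = [:-1, 0, 1:] ^ l"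
text \<open>For l >= 1 this is the antiderivative of P_l that vanishes at -1 and 1. It links
  P_(l+1), P_l and P_l' and is eliminated afterwards. At l = 0 truncated subtraction makes it 1, but
  it is then met with a factor l.\<close>

private definition V :: "nat \<Rightarrow> real poly" where
  "V l = smult (1 / (2 ^ l * fact l)) ((pderiv ^^ (l - 1)) (U l))"

private lemma pderiv_U: "pderiv (U (Suc l)) = smult (2 * real (Suc l)) (pCons 0 (U l))"
  unfolding U_def by (simp only: pderiv_power_Suc) (simp add: pderiv_pCons algebra_simps)

private lemma pderiv_V: "l \<ge> 1 \<Longrightarrow> pderiv (V l) = legendre_poly l"
  by (cases l) (auto simp: V_def U_def legendre_poly_def pderiv_smult)

text \<open>Rodrigues' formula for l + 1 with one derivative of (x^2-1)^(l+1) carried out, followed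
  by Leibniz' rule for x (x^2-1)^l, which stops after two terms because x has no second
  derivative.\<close>

private lemma legendre_Suc_V:
  "legendre_poly (Suc l) = pCons 0 (legendre_poly l) + smult (real l) (V l)"
proof -
  have "(pderiv ^^ Suc l) (U (Suc l)) = (pderiv ^^ l) (pderiv (U (Suc l)))"
    by (simp only: funpow_Suc_right o_apply)
  also have "\<dots> = smult (2 * real (Suc l)) ((pderiv ^^ l) (pCons 0 (U l)))"
    by (simp only: pderiv_U higher_pderiv_smult)
  also have "\<dots> = smult (2 * real (Suc l)) (pCons 0 ((pderiv ^^ l) (U l))
       + smult (real l) ((pderiv ^^ (l - 1)) (U l)))"
    by (simp only: higher_pderiv_pCons_0)
  finally have *: "(pderiv ^^ Suc l) (U (Suc l)) = smult (2 * real (Suc l)) (pCons 0 ((pderiv ^^ l) (U l))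
       + smult (real l) ((pderiv ^^ (l - 1)) (U l)))" .
  have "1 / (2 ^ Suc l * fact (Suc l)) * (2 * real (Suc l)) = 1 / (2 ^ l * fact l)"
    by (simp add: divide_simps)
  then show ?thesis
    unfolding legendre_poly_def V_def U_def[symmetric] *
    by (simp only: smult_smult) (simp add: smult_add_right)
qed

text \<open>Legendre's equation integrated once: u = (x^2-1)^l satisfies (x^2-1) u' = 2 l x u, and
  differentiating this l times gives the identity. It trades \<open>V\<close> for P_l'.\<close>

private lemma legendre_pderiv_V:
  "[:-1, 0, 1:] * pderiv (legendre_poly l) = smult (real l * (real l + 1)) (V l)"
proof (cases l)
  case 0
  then show ?thesis by (simp add: legendre_poly_def)
next
  case (Suc k)
  define u where "u = U l"
  have "[:-1, 0, 1:] * pderiv (U (Suc k)) = smult (2 * real (Suc k)) (pCons 0 (U (Suc k)))"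
    by (simp add: pderiv_U) (simp add: U_def)
  hence "pCons 0 (pCons 0 (pderiv u)) - pderiv u = smult (2 * real l) (pCons 0 u)"
    by (simp add: u_def Suc algebra_simps)
  hence "(pderiv ^^ l) (pCons 0 (pCons 0 (pderiv u)) - pderiv u) = (pderiv ^^ l) (smult (2 * real l) (pCons 0 u))"
    by simp
  moreover have "(pderiv ^^ n) (pderiv u) = (pderiv ^^ Suc n) u" for n
    by (simp only: funpow_Suc_right o_apply)
  moreover have "(pderiv ^^ n) (p - q) = (pderiv ^^ n) p - (pderiv ^^ n) q" for n and p q :: "real poly"
    by (induction n) (simp_all add: pderiv_diff)
  moreover define v where "v = (pderiv ^^ (l - 1)) u"
  moreover have "(pderiv ^^ l) u = pderiv v" "(pderiv ^^ Suc l) u = pderiv (pderiv v)"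
    by (simp_all add: v_def Suc)
  moreover have "(pderiv ^^ Suc (l - 1)) u = pderiv v" by (simp add: v_def)
  \<comment> \<open>For l = 1 the truncated index is off by one, but the coefficient l - 1 is then
    0.\<close>
  moreover have "smult (real (l - 1) * real l) ((pderiv ^^ Suc (l - 1 - 1)) u) = smult (real (l - 1) * real l) v"
    by (cases k) (simp_all add: v_def Suc)
  ultimately have *: "pCons 0 (pCons 0 (pderiv (pderiv v)) + smult (real l) (pderiv v)) +
      (smult (real l) (pCons 0 (pderiv v)) + smult (real l * real (l - 1)) v) - pderiv (pderiv v)
      = smult (2 * real l) (pCons 0 (pderiv v) + smult (real l) v)"
    by (simp add: higher_pderiv_pCons_0 higher_pderiv_smult smult_add_right mult.commute)
  have "poly ([:-1, 0, 1:] * pderiv (pderiv v)) x = poly (smult (real l * (real l + 1)) v) x" for x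
    using arg_cong[OF *, of "\<lambda>p. poly p x"] Suc by (simp add: algebra_simps)
  hence "[:-1, 0, 1:] * pderiv ((pderiv ^^ l) u)
      = smult (real l * (real l + 1)) ((pderiv ^^ (l - 1)) u)"
    unfolding \<open>(pderiv ^^ l) u = pderiv v\<close> v_def[symmetric] using poly_eq_poly_eq_iff by blast
  thus ?thesis
    unfolding legendre_poly_def V_def U_def[symmetric] u_def
    by (simp add: pderiv_smult)
qed

lemma legendre_0: "legendre_poly 0 = 1"
  by (simp add: legendre_poly_def)

text \<open>Elimination of \<open>V\<close> between the two preceding identities. In this form P_l -
  P_(l+1) is expressed through P_l', which is how that difference is bounded later.\<close>

lemma legendre_Suc:
  "(real l + 1) * leg 0 (Suc l) x = (real l + 1) * x * leg 0 l x - (1 - x\<^sup>2) * leg (Suc 0) l x"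
proof -
  have "poly ([:-1, 0, 1:] * pderiv (legendre_poly l)) x = real l * (real l + 1) * poly (V l) x"
    unfolding legendre_pderiv_V by simp
  moreover have "poly (legendre_poly (Suc l)) x = x * poly (legendre_poly l) x + real l * poly (V l) x"
    by (simp add: legendre_Suc_V)
  ultimately show ?thesis by (simp add: algebra_simps power2_eq_square)
qed

lemma legendre_deriv_Suc:
  "leg (Suc 0) (Suc l) x = x * leg (Suc 0) l x + (real l + 1) * leg 0 l x"
proof (cases l)
  case 0
  then show ?thesis by (simp add: legendre_Suc_V legendre_0 pderiv_pCons)
next
  case (Suc k)
  then show ?thesis
    unfolding legendre_Suc_V by (simp add: pderiv_add pderiv_smult pderiv_V pderiv_pCons algebra_simps)
qed

text \<open>For m = 0 this is the derivative of the integrated equation, as \<open>V\<close>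
  differentiates to P_l; each further differentiation raises m by one. Stated for derivatives of P_l
  instead of the associated functions, it involves no square roots of 1 - x^2.\<close>

lemma legendre_ode:
  "(1 - x\<^sup>2) * leg (Suc (Suc m)) l x - 2 * (real m + 1) * x * leg (Suc m) l x
     + (real l * (real l + 1) - real m * (real m + 1)) * leg m l x = 0"
proof -
  have base: "[:-1, 0, 1:] * (pderiv (pderiv (legendre_poly l)))
      + [:0, 2:] * pderiv (legendre_poly l) = smult (real l * (real l + 1)) (legendre_poly l)"
  proof (cases l)
    case 0
    then show ?thesis by (simp add: legendre_0)
  next
    case (Suc k)
    have "poly ([:-1, 0, 1:] * (pderiv (pderiv (legendre_poly l))) + [:0, 2:] * pderiv (legendre_poly l)) x
        = poly (smult (real l * (real l + 1)) (legendre_poly l)) x" for x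
      using arg_cong[OF legendre_pderiv_V[of l], of "\<lambda>p. poly (pderiv p) x"] Suc pderiv_V[of l]
      by (simp add: pderiv_mult pderiv_smult pderiv_pCons algebra_simps pderiv_diff pderiv_add)
    then show ?thesis using poly_eq_poly_eq_iff by blast
  qed
  define R where "R m = (pderiv ^^ m) (legendre_poly l)" for m
  have RS: "pderiv (R m) = R (Suc m)" for m by (simp add: R_def)
  have "[:1, 0, -1:] * R (Suc (Suc m)) - smult (2 * (real m + 1)) ([:0, 1:] * R (Suc m))
      + smult (real l * (real l + 1) - real m * (real m + 1)) (R m) = 0"
  proof (induction m)
    case 0
    have "poly ([:1, 0, -1:] * R (Suc (Suc 0)) - smult (2 * (real 0 + 1)) ([:0, 1:] * R (Suc 0))
      + smult (real l * (real l + 1) - real 0 * (real 0 + 1)) (R 0)) x = 0" for x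
      using arg_cong[OF base, of "\<lambda>p. poly p x"] by (simp add: R_def algebra_simps)
    then show ?case using poly_all_0_iff_0 by blast
  next
    case (Suc m)
    have "poly ([:1, 0, -1:] * R (Suc (Suc (Suc m))) - smult (2 * (real (Suc m) + 1)) ([:0, 1:] * R (Suc (Suc m)))
      + smult (real l * (real l + 1) - real (Suc m) * (real (Suc m) + 1)) (R (Suc m))) x = 0" for x
      using arg_cong[OF Suc, of "\<lambda>p. poly (pderiv p) x"]
      by (simp add: pderiv_add pderiv_diff pderiv_smult pderiv_mult pderiv_pCons RS algebra_simps
          del: mult_pCons_left)
    then show ?case using poly_all_0_iff_0 by blast
  qed
  from arg_cong[OF this, of "\<lambda>p. poly p x"] show ?thesis
    by (simp add: R_def algebra_simps power2_eq_square)
qed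

lemma legendre_degree: "degree (legendre_poly l) \<le> l"
proof -
  have "degree ([:-1, 0, 1:] ^ l :: real poly) = 2 * l"
    by (subst degree_power_eq) auto
  then show ?thesis unfolding legendre_poly_def by (simp add: degree_higher_pderiv)
qed

end

lemma leg_eq_0: "m > l \<Longrightarrow> leg m l x = 0"
proof -
  assume "m > l"
  have "degree ((pderiv ^^ l) (legendre_poly l)) = 0"
    using legendre_degree[of l] by (simp add: degree_higher_pderiv)
  hence "pderiv ((pderiv ^^ l) (legendre_poly l)) = 0" by (simp add: pderiv_eq_0_iff)
  hence "(pderiv ^^ Suc l) (legendre_poly l) = 0" by simp
  hence "(pderiv ^^ (k + Suc l)) (legendre_poly l) = 0" for k
    by (induction k) (auto simp: )
  from this[of "m - Suc l"] \<open>m > l\<close> show ?thesis by simp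
qed

lemma legendre_deriv_pred:
  "(1 - x\<^sup>2) * leg (Suc 0) (Suc l) x = (real l + 1) * (leg 0 l x - x * leg 0 (Suc l) x)"
  using legendre_Suc[of l x] legendre_deriv_Suc[of l x] by (simp, algebra)

text \<open>Bonnet's recurrence, on which the summations by parts rest. At l = 0 the truncated index
  meets the factor l = 0.\<close>

lemma legendre_recurrence:
  "(2 * real l + 1) * x * leg 0 l x = (real l + 1) * leg 0 (Suc l) x + real l * leg 0 (l - 1) x"
proof (cases l)
  case 0
  then show ?thesis using legendre_Suc[of 0 x] by (simp add: legendre_0)
next
  case (Suc k)
  then show ?thesis using legendre_Suc[of l x] legendre_deriv_pred[of x k] by (simp add: algebra_simps)
qed

lemma legendre_at_1: "leg 0 l 1 = 1"
proof (induction l)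
  case (Suc l)
  then show ?case using legendre_Suc[of l 1] by simp
qed (simp add: legendre_0)

text \<open>At x = 1 the second-order term of \<open>legendre_ode\<close> vanishes, which leaves a
  recursion in m with factor (l-m)(l+m+1) / (2(m+1)).\<close>

lemma leg_at_1: "m \<le> l \<Longrightarrow> leg m l 1 = fact (l + m) / (fact (l - m) * 2 ^ m * fact m)"
proof (induction m)
  case 0
  then show ?case using legendre_at_1[of l] by simp
next
  case (Suc m)
  have "2 * (real m + 1) * leg (Suc m) l 1 = (real l * (real l + 1) - real m * (real m + 1)) * leg m l 1"
    using legendre_ode[of 1 m l] by simp
  also have "real l * (real l + 1) - real m * (real m + 1) = real (l - m) * real (l + m + 1)"
    using Suc by (simp add: of_nat_diff algebra_simps)
  finally have "leg (Suc m) l 1 = real (l - m) * real (l + m + 1) * leg m l 1 / (2 * (real m + 1))"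
    by (simp add: field_simps)
  also have "leg m l 1 = fact (l + m) / (fact (l - m) * 2 ^ m * fact m)" using Suc by simp
  finally have e: "leg (Suc m) l 1 = real (l - m) * real (l + m + 1) * (fact (l + m) / (fact (l - m) * 2 ^ m * fact m)) / (2 * (real m + 1))" .
  have f: "(fact (l - m) :: real) = real (l - m) * fact (l - Suc m)"
    using Suc by (metis Suc_diff_Suc Suc_le_lessD fact_Suc of_nat_fact of_nat_mult)
  have g: "real (l - m) \<noteq> 0" using Suc.prems by simp
  have h: "fact (l + Suc m) = real (l + m + 1) * fact (l + m)" "fact (Suc m) = (real m + 1) * fact m" by simp_all
  show ?case unfolding e f h using g by (simp add: divide_simps del: of_nat_diff)
qed

section \<open>The addition theorem\<close>

lemma poly_Taylor:
  fixes p :: "real poly"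
  assumes "degree p \<le> n"
  shows "poly p (y + h) = (\<Sum>k\<le>n. poly ((pderiv ^^ k) p) y / fact k * h ^ k)"
proof -
  define D where "D = (\<lambda>k h. poly ((pderiv ^^ k) p) (y + h))"
  have "degree ((pderiv ^^ n) p) = 0" using assms by (simp add: degree_higher_pderiv)
  then have 0: "(pderiv ^^ Suc n) p = 0" by (simp add: pderiv_eq_0_iff)
  have "\<exists>t. \<bar>t\<bar> \<le> \<bar>h\<bar> \<and> D 0 h = (\<Sum>m<Suc n. D m 0 / fact m * h ^ m) + D (Suc n) t / fact (Suc n) * h ^ Suc n"
  proof (rule Maclaurin_all_le)
    show "\<forall>m x. (D m has_real_derivative D (Suc m) x) (at x)"
      unfolding D_def by (auto intro!: derivative_eq_intros DERIV_chain2[OF poly_DERIV])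
  qed simp
  then show ?thesis using 0 unfolding D_def by (auto simp: lessThan_Suc_atMost)
qed

lemma poly_eq_0_higher_pderiv_at:
  fixes q :: "real poly"
  assumes "\<And>k. poly ((pderiv ^^ k) q) c = 0"
  shows "q = 0"
proof -
  have "poly q (c + h) = 0" for h
    using poly_Taylor[of q "degree q" c h] by (simp add: assms)
  then have "poly q x = 0" for x by (metis add.commute diff_add_cancel)
  then show ?thesis using poly_all_0_iff_0 by blast
qed

text \<open>A polynomial solution of Legendre's equation of order \<open>m\<close> is determined by its value at the
  singular point 1, because the equation and its derivatives recover all derivatives there.\<close>

lemma legendre_ode_unique:
  fixes q :: "real poly" and lam :: real
  assumes ode: "\<And>x. (1 - x\<^sup>2) * poly (pderiv (pderiv q)) x
      - 2 * (real m + 1) * x * poly (pderiv q) x + lam * poly q x = 0"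
    and "poly q 1 = 0"
  shows "q = 0"
proof (rule poly_eq_0_higher_pderiv_at)
  fix k
  \<comment> \<open>The equation differentiated k times keeps its shape, with m + k in place of m
    and a smaller constant. At x = 1 the leading term drops out and the factor 2(m+k+1) is positive,
    so derivative k determines derivative k + 1.\<close>
  have *: "(1 - x\<^sup>2) * poly ((pderiv ^^ Suc (Suc k)) q) x
      - 2 * (real m + real k + 1) * x * poly ((pderiv ^^ Suc k) q) x
      + (lam - real k * (2 * real m + real k + 1)) * poly ((pderiv ^^ k) q) x = 0" for k x
  proof (induction k arbitrary: x)
    case 0
    then show ?case using ode by simp
  next
    case (Suc k)
    let ?r = "(pderiv ^^ k) q"
    have "((\<lambda>x. (1 - x\<^sup>2) * poly ((pderiv ^^ Suc (Suc k)) q) x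
      - 2 * (real m + real k + 1) * x * poly ((pderiv ^^ Suc k) q) x
      + (lam - real k * (2 * real m + real k + 1)) * poly ((pderiv ^^ k) q) x)
      has_real_derivative
      (- 2 * x) * poly ((pderiv ^^ Suc (Suc k)) q) x + (1 - x\<^sup>2) * poly ((pderiv ^^ Suc (Suc (Suc k))) q) x
      - 2 * (real m + real k + 1) * (poly ((pderiv ^^ Suc k) q) x + x * poly ((pderiv ^^ Suc (Suc k)) q) x)
      + (lam - real k * (2 * real m + real k + 1)) * poly ((pderiv ^^ Suc k) q) x) (at x)"
      by (auto intro!: derivative_eq_intros poly_DERIV simp: algebra_simps)
    moreover have "((\<lambda>x. (1 - x\<^sup>2) * poly ((pderiv ^^ Suc (Suc k)) q) x
      - 2 * (real m + real k + 1) * x * poly ((pderiv ^^ Suc k) q) x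
      + (lam - real k * (2 * real m + real k + 1)) * poly ((pderiv ^^ k) q) x) has_real_derivative 0) (at x)"
      unfolding Suc by simp
    ultimately have "(- 2 * x) * poly ((pderiv ^^ Suc (Suc k)) q) x + (1 - x\<^sup>2) * poly ((pderiv ^^ Suc (Suc (Suc k))) q) x
      - 2 * (real m + real k + 1) * (poly ((pderiv ^^ Suc k) q) x + x * poly ((pderiv ^^ Suc (Suc k)) q) x)
      + (lam - real k * (2 * real m + real k + 1)) * poly ((pderiv ^^ Suc k) q) x = 0"
      by (rule DERIV_unique)
    then show ?case
      by (simp add: algebra_simps)
  qed
  show "poly ((pderiv ^^ k) q) 1 = 0"
  proof (induction k)
    case 0
    then show ?case using assms(2) by simp
  next
    case (Suc k)
    have "2 * (real m + real k + 1) * poly ((pderiv ^^ Suc k) q) 1 = 0"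
      using *[of 1 k] Suc by simp
    moreover have "real m + real k + 1 \<noteq> 0" by linarith
    ultimately show ?case by simp
  qed
qed

context
  fixes m l :: nat and s :: real
begin

text \<open>By Taylor's formula the coefficient of exp(i m phi) in P_l(t s + sqrt((1-t^2)(1-s^2))
  cos phi) is a combination of these functions of t. Once the common factor of order m is split off,
  the square root occurs in even powers only, hence polynomials.\<close>

private definition W :: "nat \<Rightarrow> real poly" where
  "W i = [:1, 0, -1:] ^ i * pcompose ((pderiv ^^ (m + 2 * i)) (legendre_poly l)) [:0, s:]"

private lemma poly_W: "poly (W i) t = (1 - t\<^sup>2) ^ i * leg (m + 2 * i) l (t * s)"
  by (simp add: W_def poly_pcompose poly_power power2_eq_square mult.commute)

text \<open>The Legendre operator of order m leaves only two terms, because the equation for the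
  derivative of order m + 2i at the point t s absorbs the first-order ones. The second term for i
  has the same shape as the first term for i + 1, which prepares a telescoping sum.\<close>

private lemma W_ode:
  "(1 - t\<^sup>2) * poly (pderiv (pderiv (W i))) t - 2 * (real m + 1) * t * poly (pderiv (W i)) t
     + (real l * (real l + 1) - real m * (real m + 1)) * poly (W i) t
   = 4 * real i * real (m + i) * (1 - t\<^sup>2) ^ (i - 1) * leg (m + 2 * i) l (t * s)
     - (1 - s\<^sup>2) * (1 - t\<^sup>2) ^ i * leg (m + 2 * i + 2) l (t * s)"
proof -
  define k where "k = m + 2 * i"
  define r0 r1 r2 where "r0 = leg k l (t * s)" and "r1 = leg (Suc k) l (t * s)"
    and "r2 = leg (Suc (Suc k)) l (t * s)"
  define R where "R j = pcompose ((pderiv ^^ j) (legendre_poly l)) [:0, s:]" for j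
  have R': "pderiv (R j) = smult s (R (Suc j))" for j
    by (simp add: R_def pderiv_pcompose pderiv_pCons mult.commute)
  have Rv: "poly (R k) t = r0" "poly (R (Suc k)) t = r1" "poly (R (Suc (Suc k))) t = r2"
    unfolding R_def r0_def r1_def r2_def poly_pcompose by (simp_all add: mult.commute)
  have Rv': "leg (m + 2 * i) l (t * s) = r0" "leg (m + 2 * i + 2) l (t * s) = r2"
    by (simp_all add: r0_def r2_def k_def)
  have ode: "(1 - (t * s)\<^sup>2) * r2 - 2 * (real k + 1) * (t * s) * r1
     + (real l * (real l + 1) - real k * (real k + 1)) * r0 = 0"
    unfolding r0_def r1_def r2_def by (rule legendre_ode)
  have W: "W i = [:1, 0, -1:] ^ i * R k" by (simp add: W_def R_def k_def)
  define u where "u = 1 - t\<^sup>2"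
  define a where "a = ([:1, 0, -1:] :: real poly) ^ i"
  define A0 A1 A2 where "A0 = poly a t" and "A1 = poly (pderiv a) t" and "A2 = poly (pderiv (pderiv a)) t"
  have w: "poly (W i) t = A0 * r0" "poly (pderiv (W i)) t = A1 * r0 + A0 * s * r1"
    "poly (pderiv (pderiv (W i))) t = A2 * r0 + 2 * A1 * s * r1 + A0 * s\<^sup>2 * r2"
    unfolding W a_def[symmetric] A0_def A1_def A2_def
    by (simp_all add: pderiv_mult pderiv_add pderiv_smult R' Rv algebra_simps power2_eq_square)
  have A0: "A0 = u ^ i"
    by (simp add: A0_def a_def poly_power u_def power2_eq_square)
  have pu: "poly [:1, 0, -1:] t = u" by (simp add: u_def power2_eq_square)
  have da: "pderiv (([:1, 0, -1:] :: real poly) ^ Suc j) = smult (real (Suc j)) ([:1, 0, -1:] ^ j * [:0, -2:])" for j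
  proof -
    have "pderiv [:1, 0, -1:] = [:0, -2 :: real:]" by (simp add: pderiv_pCons)
    then show ?thesis by (simp only: pderiv_power_Suc mult_smult_left of_nat_id)
  qed
  have dd: "pderiv ([:0, -2:] :: real poly) = [:-2:]" by (simp add: pderiv_pCons)
  have p2: "poly [:0, -2:] t = -2 * t" "poly [:-2:] t = -2" by simp_all
  note rules = pderiv_smult pderiv_mult da dd poly_smult poly_mult poly_add poly_power pu p2
  \<comment> \<open>Two derivatives of (1-t^2)^i produce the exponents i - 1 and i - 2, which are
    truncated for small i; hence the cases. The identities avoid division by 1 - t^2 and so hold at
    t = 1 and t = -1 as well.\<close>
  consider "i = 0" | "i = 1" | j where "i = Suc (Suc j)" by (metis One_nat_def not0_implies_Suc)
  then have A: "u * A1 = - 2 * real i * t * A0"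
    "u * A2 - 2 * (real m + 1) * t * A1 + (real k * (real k + 1) - real m * (real m + 1)) * A0
       = 4 * real i * real (m + i) * u ^ (i - 1)"
  proof (atomize (full), cases)
    case 1
    then show "u * A1 = - 2 * real i * t * A0 \<and>
       u * A2 - 2 * (real m + 1) * t * A1 + (real k * (real k + 1) - real m * (real m + 1)) * A0
       = 4 * real i * real (m + i) * u ^ (i - 1)"
      by (simp add: A0_def A1_def A2_def a_def k_def)
  next
    case 2
    have "a = [:1, 0, -1:] ^ Suc 0" using 2 by (simp add: a_def)
    hence *: "A0 = u" "A1 = - 2 * t" "A2 = -2"
      unfolding A0_def A1_def A2_def by (simp_all only: rules) simp_all
    have k: "real k = real m + 2" "real i = 1" "u ^ (i - 1) = 1" using 2 by (simp_all add: k_def)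
    have t2: "t\<^sup>2 = 1 - u" by (simp add: u_def)
    show "u * A1 = - 2 * real i * t * A0 \<and>
       u * A2 - 2 * (real m + 1) * t * A1 + (real k * (real k + 1) - real m * (real m + 1)) * A0
       = 4 * real i * real (m + i) * u ^ (i - 1)"
      unfolding k * of_nat_add using t2 by algebra
  next
    case (3 j)
    have "a = [:1, 0, -1:] ^ Suc (Suc j)" using 3 by (simp add: a_def)
    hence *: "A0 = u ^ j * u\<^sup>2" "A1 = - 2 * t * real (Suc (Suc j)) * (u ^ j * u)"
      "A2 = -2 * real (Suc (Suc j)) * (u ^ j * u) + 4 * t\<^sup>2 * real (Suc (Suc j)) * real (Suc j) * u ^ j"
      unfolding A0_def A1_def A2_def by (simp_all only: rules) (simp_all add: algebra_simps power2_eq_square)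
    have k: "real k = real m + 2 * real j + 4" "real i = real j + 2" "u ^ (i - 1) = u ^ j * u"
      using 3 by (simp_all add: k_def)
    have t2: "t\<^sup>2 = 1 - u" by (simp add: u_def)
    have alg: "u * (- 2 * t * (1 + (1 + J)) * (v * u)) = - 2 * (J + 2) * t * (v * u\<^sup>2) \<and>
     u * (- 2 * (1 + (1 + J)) * (v * u) + 4 * t\<^sup>2 * (1 + (1 + J)) * (1 + J) * v) -
     2 * (m' + 1) * t * (- 2 * t * (1 + (1 + J)) * (v * u)) +
     ((m' + 2 * J + 4) * (m' + 2 * J + 4 + 1) - m' * (m' + 1)) * (v * u\<^sup>2) =
     4 * (J + 2) * (m' + (J + 2)) * (v * u)" for v J m' :: real
      using t2 by algebra
    show "u * A1 = - 2 * real i * t * A0 \<and>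
       u * A2 - 2 * (real m + 1) * t * A1 + (real k * (real k + 1) - real m * (real m + 1)) * A0
       = 4 * real i * real (m + i) * u ^ (i - 1)"
      unfolding k * of_nat_add of_nat_Suc by (rule alg)
  qed
  have t2: "t\<^sup>2 = 1 - u" and k: "real k = real m + 2 * real i" by (simp_all add: u_def k_def)
  show ?thesis
    unfolding w Rv' u_def[symmetric] A0[symmetric] A(2)[symmetric] mult.assoc[symmetric]
    using t2 k ode A(1) by algebra
qed

text \<open>The Fourier component of order m of the addition theorem. Both sides, as polynomials in
  t, solve Legendre's equation of order m and agree at t = 1, where only i = 0 survives on the
  left.\<close>

lemma leg_product_expansion:
  assumes "m \<le> l"
  shows "(\<Sum>i\<le>l. leg (m + 2 * i) l (t * s) * ((1 - t\<^sup>2) * (1 - s\<^sup>2)) ^ i / (2 ^ (m + 2 * i) * fact i * fact (m + i)))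
       = fact (l - m) / fact (l + m) * leg m l t * leg m l s"
proof -
  define c where "c i = (1 - s\<^sup>2) ^ i / (2 ^ (m + 2 * i) * fact i * fact (m + i))" for i
  define Q where "Q = (\<Sum>i\<le>l. smult (c i) (W i))"
  define R where "R = (pderiv ^^ m) (legendre_poly l)"
  define b where "b = fact (l - m) / fact (l + m) * leg m l s"
  define L where "L q t = (1 - t\<^sup>2) * poly (pderiv (pderiv q)) t - 2 * (real m + 1) * t * poly (pderiv q) t
     + (real l * (real l + 1) - real m * (real m + 1)) * poly q t" for q t
  have L_add: "L (q + r) t = L q t + L r t" for q r t
    by (simp add: L_def pderiv_add algebra_simps)
  have L_diff: "L (q - r) t = L q t - L r t" for q r t
    by (simp add: L_def pderiv_diff algebra_simps)
  have L_smult: "L (smult a q) t = a * L q t" for a q t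
    by (simp add: L_def pderiv_smult algebra_simps)
  \<comment> \<open>Partial sums leave a single boundary term because the weights satisfy
    4(n+1)(m+n+1) c(n+1) = (1-s^2) c(n). For n = l that term contains a derivative of order above l
    and vanishes.\<close>
  have L_sum: "L (\<Sum>i\<le>n. smult (c i) (W i)) t = - c n * (1 - s\<^sup>2) * (1 - t\<^sup>2) ^ n * leg (m + 2 * n + 2) l (t * s)" for n t
  proof (induction n)
    case 0
    have W0: "L (W 0) t = - ((1 - s\<^sup>2) * leg (m + 2) l (t * s))"
      using W_ode[of t 0] by (simp only: L_def) simp
    show ?case
      by (simp add: L_smult W0 mult.assoc)
  next
    case (Suc n)
    have cs: "c (Suc n) * (4 * real (Suc n) * real (m + Suc n)) = c n * (1 - s\<^sup>2)"
      unfolding c_def by (simp add: divide_simps)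
    define X v where "X = leg (m + 2 * Suc n) l (t * s)" and "v = (1 - t\<^sup>2) ^ n"
    have "m + 2 * n + 2 = m + 2 * Suc n" by simp
    then have "L (\<Sum>i\<le>Suc n. smult (c i) (W i)) t = - (c n * (1 - s\<^sup>2)) * v * X
        + c (Suc n) * (4 * real (Suc n) * real (m + Suc n) * v * X
            - (1 - s\<^sup>2) * (1 - t\<^sup>2) ^ Suc n * leg (m + 2 * Suc n + 2) l (t * s))"
      unfolding sum.atMost_Suc L_add Suc L_smult X_def v_def
      by (subst L_def, subst W_ode) (simp only: diff_Suc_1 mult_minus_left)
    also have "\<dots> = - c (Suc n) * (1 - s\<^sup>2) * (1 - t\<^sup>2) ^ Suc n * leg (m + 2 * Suc n + 2) l (t * s)"
    proof -
      have "- (c0 * q) * w * z + c' * (4 * a * b * w * z - q * w' * z') = - c' * q * w' * z'"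
        if "c' * (4 * a * b) = c0 * q" for c0 c' q w z w' z' a b :: real
        using that by algebra
      from this[OF cs] show ?thesis .
    qed
    finally show ?case .
  qed
  have Q0: "L Q t = 0" for t
    unfolding Q_def L_sum by (simp add: leg_eq_0 del: funpow.simps)
  have R0: "L R t = 0" for t
    using legendre_ode[of t m l] by (simp add: L_def R_def)
  have "Q - smult b R = 0"
  proof (rule legendre_ode_unique[where m = m and lam = "real l * (real l + 1) - real m * (real m + 1)"])
    show "(1 - x\<^sup>2) * poly (pderiv (pderiv (Q - smult b R))) x
         - 2 * (real m + 1) * x * poly (pderiv (Q - smult b R)) x +
         (real l * (real l + 1) - real m * (real m + 1)) * poly (Q - smult b R) x = 0" for x
      using L_diff[of Q "smult b R" x] L_smult[of b R x] Q0 R0 by (simp add: L_def)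
    have "poly Q 1 = (\<Sum>i\<le>l. if i = 0 then leg m l s / (2 ^ m * fact m) else 0)"
      unfolding Q_def poly_sum poly_smult poly_W
      by (intro sum.cong) (auto simp: c_def)
    also have "\<dots> = leg m l s / (2 ^ m * fact m)" by (subst sum.delta) auto
    also have "\<dots> = poly (smult b R) 1"
      using leg_at_1[OF assms] by (simp add: b_def R_def)
    finally show "poly (Q - smult b R) 1 = 0" by simp
  qed
  hence "poly Q t = b * leg m l t" by (simp add: R_def)
  moreover have "poly Q t = (\<Sum>i\<le>l. leg (m + 2 * i) l (t * s) * ((1 - t\<^sup>2) * (1 - s\<^sup>2)) ^ i / (2 ^ (m + 2 * i) * fact i * fact (m + i)))"
    unfolding Q_def poly_sum poly_smult poly_W by (intro sum.cong) (auto simp: c_def power_mult_distrib)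
  ultimately show ?thesis by (simp add: b_def)
qed

end

text \<open>Pairs (a, b) are regrouped by the Fourier mode m = a - b and by i = min a b, so that a
  and b are i plus the positive and the negative part of m. The index sets differ only in pairs with
  a + b > l, where f vanishes.\<close>

lemma sum_sum_diagonals:
  fixes f :: "nat \<Rightarrow> nat \<Rightarrow> 'a::comm_monoid_add"
  assumes "\<And>a b. a + b > l \<Longrightarrow> f a b = 0"
  shows "(\<Sum>k\<le>l. \<Sum>b\<le>k. f (k - b) b) =
    (\<Sum>m=-int l..int l. \<Sum>i\<le>l. f (i + nat m) (i + nat (- m)))"
proof -
  have "(\<Sum>k\<le>l. \<Sum>b\<le>k. f (k - b) b) = (\<Sum>(k, b)\<in>(SIGMA k:{..l}. {..k}). f (k - b) b)"
    by (subst sum.Sigma) auto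
  also have "\<dots> = (\<Sum>(m, i)\<in>{-int l..int l} \<times> {..l}. f (i + nat m) (i + nat (- m)))"
    by (rule sum.reindex_bij_witness_not_neutral[where
          S' = "{}" and T' = "{(m, i). nat \<bar>m\<bar> + 2 * i > l} \<inter> ({-int l..int l} \<times> {..l})"
          and i = "\<lambda>(m, i). (nat \<bar>m\<bar> + 2 * i, i + nat (- m))"
          and j = "\<lambda>(k, b). (int k - 2 * int b, min b (k - b))"])
       (auto intro!: assms arg_cong2[of _ _ _ _ f] split: if_splits simp: min_def)
  also have "\<dots> = (\<Sum>m=-int l..int l. \<Sum>i\<le>l. f (i + nat m) (i + nat (- m)))"
    by (subst sum.cartesian_product) auto
  finally show ?thesis .
qed

text \<open>The inner product is t s + Re u, with u the product of the horizontal parts, one of them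
  conjugated. Taylor's formula at t s, the binomial expansion of (u + cnj u)^k and regrouping by
  modes reduce the claim to \<open>leg_product_expansion\<close> for each m. Working with u instead
  of angles keeps the poles from being exceptional.\<close>

theorem sph_harm_addition:
  assumes "\<xi> \<in> S2" "x \<in> S2"
  shows "(\<Sum>m=-int l..int l. sph_harm l m \<xi> * cnj (sph_harm l m x))
       = complex_of_real ((2 * real l + 1) / (4 * pi) * leg 0 l (\<xi> \<bullet> x))"
proof -
  define t s where "t = \<xi> $ 3" and "s = x $ 3"
  define u where "u = Complex (\<xi> $ 1) (\<xi> $ 2) * cnj (Complex (x $ 1) (x $ 2))"
  define N where "N = (2 * real l + 1) / (4 * pi)"
  have n1: "(v $ 1)\<^sup>2 + (v $ 2)\<^sup>2 = 1 - (v $ 3)\<^sup>2" if "v \<in> S2" for v :: "real^3"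
  proof -
    have "v \<bullet> v = 1" using that by (simp add: dot_square_norm)
    then show ?thesis by (simp add: inner_vec_def sum_3 power2_eq_square)
  qed
  have uu: "u * cnj u = complex_of_real ((1 - t\<^sup>2) * (1 - s\<^sup>2))"
  proof -
    have "u * cnj u = (Complex (\<xi> $ 1) (\<xi> $ 2) * cnj (Complex (\<xi> $ 1) (\<xi> $ 2))) *
      (Complex (x $ 1) (x $ 2) * cnj (Complex (x $ 1) (x $ 2)))"
      by (simp add: u_def)
    also have "\<dots> = complex_of_real ((\<xi> $ 1)\<^sup>2 + (\<xi> $ 2)\<^sup>2) * complex_of_real ((x $ 1)\<^sup>2 + (x $ 2)\<^sup>2)"
      by (simp add: complex_mult_cnj del: of_real_add of_real_power)
    finally show ?thesis using n1[OF assms(1)] n1[OF assms(2)] by (simp add: t_def s_def)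
  qed
  have dot: "\<xi> \<bullet> x = t * s + Re u"
    by (simp add: inner_vec_def sum_3 t_def s_def u_def)
  define h where "h m = (let n = nat \<bar>m\<bar> in complex_of_real (fact (l - n) / fact (l + n) * leg n l t * leg n l s)
      * (if m \<ge> 0 then u ^ n else cnj u ^ n))" for m :: int
  have Y: "sph_harm l m \<xi> * cnj (sph_harm l m x) = complex_of_real N * h m" for m
  proof -
    define n where "n = nat \<bar>m\<bar>"
    define c where "c = sqrt (N * (fact (l - n) / fact (l + n)))"
    \<comment> \<open>The Condon-Shortley sign, which enters squared.\<close>
    define e :: real where "e = (-1) ^ n"
    have e: "e * e = 1" by (simp add: e_def flip: power_mult_distrib)
    have c: "c * c = N * (fact (l - n) / fact (l + n))"
      unfolding c_def by (simp add: N_def)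
    have cc: "complex_of_real c * complex_of_real c = complex_of_real (N * (fact (l - n) / fact (l + n)))"
      "complex_of_real e * complex_of_real e = 1"
      unfolding of_real_mult[symmetric] c e by simp_all
    have e1: "(- 1) ^ n = complex_of_real e" by (simp add: e_def)
    have "sph_harm l m \<xi> * cnj (sph_harm l m x) =
       (complex_of_real c * complex_of_real c) * (complex_of_real e * complex_of_real e) *
       complex_of_real (leg n l t * leg n l s) * (if m \<ge> 0 then u ^ n else cnj u ^ n)"
      unfolding sph_harm_def Let_def n_def[symmetric] N_def[symmetric] c_def[symmetric] t_def[symmetric]
        s_def[symmetric] e_def[symmetric] e1 u_def
      using cc(2) by (simp add: power_mult_distrib algebra_simps)
    then show ?thesis unfolding cc by (simp add: h_def Let_def n_def)
  qed
  \<comment> \<open>The term with u^a and cnj(u)^b in the Taylor expansion: the factor 1 / k! with k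
    = a + b, times (k choose b) / 2^k from the power of Re u.\<close>
  define f where "f a b = complex_of_real (leg (a + b) l (t * s) / (2 ^ (a + b) * fact a * fact b)) * u ^ a * cnj u ^ b" for a b
  have hf: "h m = (\<Sum>i\<le>l. f (i + nat m) (i + nat (- m)))" if "m \<in> {-int l..int l}" for m
  proof -
    define n where "n = nat \<bar>m\<bar>"
    have n: "n \<le> l" using that by (auto simp: n_def)
    have "f (i + nat m) (i + nat (- m)) = complex_of_real (leg (n + 2 * i) l (t * s) *
        ((1 - t\<^sup>2) * (1 - s\<^sup>2)) ^ i / (2 ^ (n + 2 * i) * fact i * fact (n + i))) * (if m \<ge> 0 then u ^ n else cnj u ^ n)" for i
    proof -
      have "u ^ i * cnj u ^ i = complex_of_real (((1 - t\<^sup>2) * (1 - s\<^sup>2)) ^ i)"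
        unfolding power_mult_distrib[symmetric] uu by simp
      moreover have "f (i + nat m) (i + nat (- m)) = complex_of_real (leg (n + 2 * i) l (t * s) /
          (2 ^ (n + 2 * i) * fact i * fact (n + i))) * (u ^ i * cnj u ^ i) * (if m \<ge> 0 then u ^ n else cnj u ^ n)"
      proof (cases "m \<ge> 0")
        have idx: "n + i + i = n + 2 * i" "i + (n + i) = n + 2 * i" by simp_all
        case True
        hence "nat m = n" "nat (- m) = 0" by (auto simp: n_def)
        then show ?thesis using True by (simp add: f_def idx mult_ac power_add[of u] add.commute[of i n])
      next
        have idx: "n + i + i = n + 2 * i" "i + (n + i) = n + 2 * i" by simp_all
        case False
        hence "nat m = 0" "nat (- m) = n" by (auto simp: n_def)
        then show ?thesis using False by (simp add: f_def idx mult_ac power_add[of "cnj u"] add.commute[of i n])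
      qed
      ultimately show ?thesis by simp
    qed
    then show ?thesis
      using leg_product_expansion[OF n, of t s]
      by (simp only: sum_distrib_right[symmetric] of_real_sum[symmetric]) (simp add: h_def Let_def n_def)
  qed
  have "(\<Sum>m=-int l..int l. sph_harm l m \<xi> * cnj (sph_harm l m x)) = complex_of_real N * (\<Sum>m=-int l..int l. h m)"
    by (simp add: Y sum_distrib_left)
  also have "(\<Sum>m=-int l..int l. h m) = (\<Sum>m=-int l..int l. \<Sum>i\<le>l. f (i + nat m) (i + nat (- m)))"
    by (intro sum.cong refl hf)
  also have "\<dots> = (\<Sum>k\<le>l. \<Sum>b\<le>k. f (k - b) b)"
    by (rule sum_sum_diagonals[symmetric]) (simp add: f_def leg_eq_0)
  also have "\<dots> = (\<Sum>k\<le>l. complex_of_real (leg k l (t * s) / fact k * Re u ^ k))"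
  proof (intro sum.cong refl)
    fix k
    have "complex_of_real (2 * Re u) = cnj u + u" using complex_add_cnj[of u] by (simp add: add.commute)
    then have "complex_of_real (2 * Re u) ^ k = (\<Sum>b\<le>k. of_nat (k choose b) * cnj u ^ b * u ^ (k - b))"
      by (simp only: binomial_ring)
    then have "complex_of_real (leg k l (t * s) / fact k * Re u ^ k) =
       complex_of_real (leg k l (t * s) / (2 ^ k * fact k)) * (\<Sum>b\<le>k. of_nat (k choose b) * cnj u ^ b * u ^ (k - b))"
      by (simp add: power_mult_distrib flip: \<open>complex_of_real (2 * Re u) ^ k = _\<close>)
    also have "\<dots> = (\<Sum>b\<le>k. f (k - b) b)"
      unfolding sum_distrib_left
    proof (intro sum.cong refl)
      fix b assume "b \<in> {..k}"
      then have b: "b \<le> k" by simp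
      have "(of_nat (k choose b) :: complex) = fact k / (fact b * fact (k - b))"
        using b by (rule binomial_fact)
      then show "complex_of_real (leg k l (t * s) / (2 ^ k * fact k)) * (of_nat (k choose b) * cnj u ^ b * u ^ (k - b)) = f (k - b) b"
        using b by (simp add: f_def mult_ac)
    qed
    finally show "(\<Sum>b\<le>k. f (k - b) b) = complex_of_real (leg k l (t * s) / fact k * Re u ^ k)" ..
  qed
  also have "\<dots> = complex_of_real (leg 0 l (\<xi> \<bullet> x))"
    unfolding dot using poly_Taylor[OF legendre_degree[of l], of "t * s" "Re u"] by simp
  finally show ?thesis by (simp add: N_def)
qed

section \<open>Pointwise bounds for Legendre polynomials\<close>

lemma S2_with_inner:
  assumes "\<bar>t\<bar> \<le> 1"
  obtains \<xi> x :: "real^3" where "\<xi> \<in> S2" "x \<in> S2" "\<xi> \<bullet> x = t" "x $ 3 = t" "(x $ 1)\<^sup>2 + (x $ 2)\<^sup>2 = 1 - t\<^sup>2"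
proof -
  have t: "t\<^sup>2 \<le> 1" using assms abs_square_le_1 by blast
  define \<xi> x :: "real^3" where "\<xi> = vector [0, 0, 1]" and "x = vector [sqrt (1 - t\<^sup>2), 0, t]"
  have "\<xi> \<bullet> \<xi> = 1" "x \<bullet> x = 1" "\<xi> \<bullet> x = t" "x $ 3 = t" "(x $ 1)\<^sup>2 + (x $ 2)\<^sup>2 = 1 - t\<^sup>2"
    using t by (simp_all add: inner_vec_def sum_3 \<xi>_def x_def vector_3 power2_eq_square)
  then show ?thesis using that[of \<xi> x] by (simp add: norm_eq_sqrt_inner)
qed

lemma sum_norm_sph_harm:
  assumes "x \<in> S2"
  shows "(\<Sum>m=-int l..int l. (cmod (sph_harm l m x))\<^sup>2) = (2 * real l + 1) / (4 * pi)"
proof -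
  have "x \<bullet> x = 1" using assms by (simp add: dot_square_norm)
  then have "complex_of_real (\<Sum>m=-int l..int l. (cmod (sph_harm l m x))\<^sup>2) = complex_of_real ((2 * real l + 1) / (4 * pi))"
    using sph_harm_addition[OF assms assms, of l] legendre_at_1[of l]
    by (simp only: of_real_sum complex_norm_square) simp
  then show ?thesis by (simp only: of_real_eq_iff)
qed

text \<open>By the addition theorem (2l+1)/(4 pi) P_l(t) is an inner product of two vectors of
  dimension 2l + 1 whose squared norms both equal (2l+1)/(4 pi). As the norms agree, the inequality
  a b <= (a^2 + b^2)/2 takes the place of Cauchy-Schwarz.\<close>

lemma legendre_abs_le_1:
  assumes "\<bar>t\<bar> \<le> 1"
  shows "\<bar>leg 0 l t\<bar> \<le> 1"
proof -
  obtain \<xi> x :: "real^3" where *: "\<xi> \<in> S2" "x \<in> S2" "\<xi> \<bullet> x = t" using S2_with_inner[OF assms] by metis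
  define N where "N = (2 * real l + 1) / (4 * pi)"
  have N: "N > 0" by (simp add: N_def)
  have "N * \<bar>leg 0 l t\<bar> = cmod (\<Sum>m=-int l..int l. sph_harm l m \<xi> * cnj (sph_harm l m x))"
    using N unfolding sph_harm_addition[OF *(1,2)] *(3) norm_of_real N_def by (simp add: abs_mult)
  also have "\<dots> \<le> (\<Sum>m=-int l..int l. cmod (sph_harm l m \<xi>) * cmod (sph_harm l m x))"
    by (intro order.trans[OF norm_sum]) (simp add: norm_mult)
  also have "\<dots> \<le> (\<Sum>m=-int l..int l. ((cmod (sph_harm l m \<xi>))\<^sup>2 + (cmod (sph_harm l m x))\<^sup>2) / 2)"
  proof (rule sum_mono)
    have "a * b \<le> (a\<^sup>2 + b\<^sup>2) / 2" for a b :: real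
      using sum_squares_bound[of a b] by simp
    then show "cmod (sph_harm l m \<xi>) * cmod (sph_harm l m x) \<le> ((cmod (sph_harm l m \<xi>))\<^sup>2 + (cmod (sph_harm l m x))\<^sup>2) / 2" for m .
  qed
  also have "\<dots> = N"
    unfolding sum_divide_distrib[symmetric] sum.distrib sum_norm_sph_harm[OF *(1)] sum_norm_sph_harm[OF *(2)]
    by (simp add: N_def)
  finally show ?thesis using N by simp
qed

text \<open>The summand m = 1 in the sum of |Y_lm|^2 is at most the total (2l+1)/(4 pi); the factor
  l(l+1) is (l+1)!/(l-1)! from the normalisation.\<close>

lemma legendre_deriv_bound:
  assumes "\<bar>t\<bar> \<le> 1"
  shows "(1 - t\<^sup>2) * (leg (Suc 0) l t)\<^sup>2 \<le> real l * (real l + 1)"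
proof (cases "l = 0")
  case True
  then show ?thesis by (simp add: legendre_0)
next
  case False
  obtain x :: "real^3" where *: "x \<in> S2" "x $ 3 = t" "(x $ 1)\<^sup>2 + (x $ 2)\<^sup>2 = 1 - t\<^sup>2"
    using S2_with_inner[OF assms] by metis
  define N where "N = (2 * real l + 1) / (4 * pi)"
  have N: "N > 0" by (simp add: N_def)
  have f: "(fact (l - Suc 0) / fact (l + Suc 0) :: real) = 1 / (real l * (real l + 1))"
  proof -
    obtain k where "l = Suc k" using False not0_implies_Suc by blast
    then show ?thesis by (simp add: divide_simps)
  qed
  have "(cmod (sph_harm l 1 x))\<^sup>2 \<le> (\<Sum>m=-int l..int l. (cmod (sph_harm l m x))\<^sup>2)"
    using False by (intro member_le_sum) auto
  also have "\<dots> = N" using sum_norm_sph_harm[OF *(1)] by (simp add: N_def)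
  also have "(cmod (sph_harm l 1 x))\<^sup>2 = N / (real l * (real l + 1)) * (leg (Suc 0) l t)\<^sup>2 * (1 - t\<^sup>2)"
    unfolding *(3)[symmetric] sph_harm_def Let_def *(2) N_def
    using f by (simp add: norm_mult power_mult_distrib cmod_power2)
  finally have "N * ((leg (Suc 0) l t)\<^sup>2 * (1 - t\<^sup>2) / (real l * (real l + 1))) \<le> N * 1" by simp
  then have "(leg (Suc 0) l t)\<^sup>2 * (1 - t\<^sup>2) / (real l * (real l + 1)) \<le> 1"
    using N by (simp only: mult_le_cancel_left_pos)
  then show ?thesis using False by (simp add: pos_divide_le_eq mult.commute)
qed

text \<open>Neighbouring Legendre polynomials differ by the order of the angle, uniformly in l. In a
  single summation by parts this recovers half of the factor 1 - t, which serves odd numbers of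
  differences.\<close>

lemma legendre_diff_bound:
  assumes "\<bar>t\<bar> \<le> 1"
  shows "\<bar>leg 0 l t - leg 0 (Suc l) t\<bar> \<le> (1 - t) + sqrt (1 - t\<^sup>2)"
proof -
  define d where "d = leg (Suc 0) l t"
  have t: "1 - t\<^sup>2 \<ge> 0" using assms by (simp add: abs_square_le_1)
  have "(sqrt (1 - t\<^sup>2) * \<bar>d\<bar>)\<^sup>2 = (1 - t\<^sup>2) * d\<^sup>2" using t by (simp add: power_mult_distrib)
  also have "\<dots> \<le> (real l + 1)\<^sup>2"
    using legendre_deriv_bound[OF assms, of l] by (simp add: d_def power2_eq_square algebra_simps)
  finally have 1: "sqrt (1 - t\<^sup>2) * \<bar>d\<bar> \<le> real l + 1" by (rule power2_le_imp_le) simp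
  have "leg 0 l t - leg 0 (Suc l) t = (1 - t) * leg 0 l t + (1 - t\<^sup>2) * d / (real l + 1)"
    using legendre_Suc[of l t] by (simp add: d_def field_simps)
  also have "\<bar>\<dots>\<bar> \<le> (1 - t) + sqrt (1 - t\<^sup>2)"
  proof (intro order.trans[OF abs_triangle_ineq] add_mono)
    show "\<bar>(1 - t) * leg 0 l t\<bar> \<le> 1 - t"
      unfolding abs_mult using legendre_abs_le_1[OF assms, of l] assms by (simp add: mult_left_le)
    have "\<bar>(1 - t\<^sup>2) * d / (real l + 1)\<bar> = sqrt (1 - t\<^sup>2) * (sqrt (1 - t\<^sup>2) * \<bar>d\<bar>) / (real l + 1)"
      using t by (simp add: abs_mult)
    also have "\<dots> \<le> sqrt (1 - t\<^sup>2) * (real l + 1) / (real l + 1)"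
      using t 1 by (intro divide_right_mono mult_left_mono) auto
    finally show "\<bar>(1 - t\<^sup>2) * d / (real l + 1)\<bar> \<le> sqrt (1 - t\<^sup>2)" by simp
  qed
  finally show ?thesis .
qed

section \<open>Orthonormality of the spherical harmonics\<close>

lemma has_integral_sin_cos_comp:
  fixes w W :: "real \<Rightarrow> real"
  assumes "\<And>t. (W has_real_derivative w t) (at t)"
  shows "((\<lambda>\<theta>. sin \<theta> * w (cos \<theta>)) has_integral (W 1 - W (-1))) {0..pi}"
proof -
  have "((\<lambda>\<theta>. sin \<theta> * w (cos \<theta>)) has_integral ((- W (cos pi)) - (- W (cos 0)))) {0..pi}"
  proof (rule fundamental_theorem_of_calculus)
    fix x :: real
    have "((\<lambda>\<theta>. - W (cos \<theta>)) has_real_derivative sin x * w (cos x)) (at x)"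
      by (auto intro!: derivative_eq_intros DERIV_chain2[OF assms])
    then show "((\<lambda>\<theta>. - W (cos \<theta>)) has_vector_derivative sin x * w (cos x)) (at x within {0..pi})"
      using has_field_derivative_at_within has_real_derivative_iff_has_vector_derivative by blast
  qed simp
  then show ?thesis by simp
qed

text \<open>The inner product of two associated Legendre functions of the same order m, in the
  angle; their factors sin^m combine to a power of 1 - cos^2.\<close>

definition legendre_integral :: "nat \<Rightarrow> nat \<Rightarrow> nat \<Rightarrow> real" where
  "legendre_integral m l l' = integral {0..pi} (\<lambda>\<theta>. sin \<theta> * ((1 - (cos \<theta>)\<^sup>2) ^ m * leg m l (cos \<theta>) * leg m l' (cos \<theta>)))"

text \<open>Integration by parts in t = cos \<theta>: the function \<open>W\<close> below vanishes
  at both ends because of its factor (1-t^2)^(m+1), and by Legendre's equation its derivative is the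
  difference of the two integrands.\<close>

lemma legendre_integral_Suc:
  "legendre_integral (Suc m) l l' = (real l * (real l + 1) - real m * (real m + 1)) * legendre_integral m l l'"
proof -
  define lam where "lam = real l * (real l + 1) - real m * (real m + 1)"
  define w where "w t = (1 - t\<^sup>2) ^ Suc m * leg (Suc m) l t * leg (Suc m) l' t - lam * ((1 - t\<^sup>2) ^ m * leg m l t * leg m l' t)" for t
  define W where "W t = (1 - t\<^sup>2) ^ Suc m * leg (Suc m) l t * leg m l' t" for t
  have "(W has_real_derivative w t) (at t)" for t
  proof -
    have "(W has_real_derivative (real (Suc m) * (1 - t\<^sup>2) ^ m * (- 2 * t) * leg (Suc m) l t
        + (1 - t\<^sup>2) ^ Suc m * leg (Suc (Suc m)) l t) * leg m l' t
        + (1 - t\<^sup>2) ^ Suc m * leg (Suc m) l t * leg (Suc m) l' t) (at t)"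
      unfolding W_def
      by (auto intro!: derivative_eq_intros poly_DERIV simp del: power_Suc)
    also have "real (Suc m) * (1 - t\<^sup>2) ^ m * (- 2 * t) * leg (Suc m) l t
        + (1 - t\<^sup>2) ^ Suc m * leg (Suc (Suc m)) l t = (1 - t\<^sup>2) ^ m * ((1 - t\<^sup>2) * leg (Suc (Suc m)) l t
        - 2 * (real m + 1) * t * leg (Suc m) l t)"
      by (simp add: algebra_simps)
    also have "(1 - t\<^sup>2) * leg (Suc (Suc m)) l t - 2 * (real m + 1) * t * leg (Suc m) l t = - lam * leg m l t"
      unfolding lam_def using legendre_ode[of t m l] by algebra
    finally show ?thesis by (simp add: w_def algebra_simps)
  qed
  from has_integral_sin_cos_comp[OF this]
  have "integral {0..pi} (\<lambda>\<theta>. sin \<theta> * w (cos \<theta>)) = 0"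
    by (auto simp: W_def dest!: integral_unique)
  also have "integral {0..pi} (\<lambda>\<theta>. sin \<theta> * w (cos \<theta>)) = integral {0..pi} (\<lambda>\<theta>.
      sin \<theta> * ((1 - (cos \<theta>)\<^sup>2) ^ Suc m * leg (Suc m) l (cos \<theta>) * leg (Suc m) l' (cos \<theta>))
      - lam * (sin \<theta> * ((1 - (cos \<theta>)\<^sup>2) ^ m * leg m l (cos \<theta>) * leg m l' (cos \<theta>))))"
    by (simp only: w_def right_diff_distrib mult.left_commute[of "sin _" lam])
  also have "\<dots> = legendre_integral (Suc m) l l' - lam * legendre_integral m l l'"
    unfolding legendre_integral_def
    by (subst integral_diff) (auto intro!: integrable_continuous_real continuous_intros)
  finally show ?thesis by (simp add: lam_def)
qed

lemma legendre_integral_commute: "legendre_integral m l l' = legendre_integral m l' l"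
  by (simp add: legendre_integral_def mult_ac)

text \<open>The integral of order 1 is symmetric in the two degrees, while integration by parts
  yields the eigenvalue of either one; distinct degrees have distinct eigenvalues.\<close>

lemma legendre_integral_0_neq:
  assumes "l \<noteq> l'"
  shows "legendre_integral 0 l l' = 0"
proof -
  have "(real l * (real l + 1) - real l' * (real l' + 1)) * legendre_integral 0 l l' = 0"
    using legendre_integral_Suc[of 0 l l'] legendre_integral_Suc[of 0 l' l] legendre_integral_commute
    by (simp add: algebra_simps)
  moreover have "real l * (real l + 1) - real l' * (real l' + 1) = (real l - real l') * (real l + real l' + 1)"
    by (simp add: algebra_simps)
  moreover have "(real l - real l') * (real l + real l' + 1) \<noteq> 0" using assms by simp
  ultimately show ?thesis by simp
qed

lemma legendre_integral_0_same: "legendre_integral 0 l l = 2 / (2 * real l + 1)"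
proof (induction l)
  case 0
  have "((\<lambda>\<theta>. sin \<theta> * 1) has_integral (1 - (-1))) {0..pi}"
    by (rule has_integral_sin_cos_comp[of "\<lambda>t. t" "\<lambda>t. 1"]) (auto intro!: derivative_eq_intros)
  then show ?case by (auto simp: legendre_integral_def legendre_0 dest: integral_unique)
next
  case (Suc l)
  \<comment> \<open>The integral of t P_l P_(l+1) is evaluated by the recurrence at l and again at l
    + 1. Orthogonality leaves one term each time, which relates consecutive norms.\<close>
  define X where "X = integral {0..pi} (\<lambda>\<theta>. sin \<theta> * (cos \<theta> * leg 0 l (cos \<theta>) * leg 0 (Suc l) (cos \<theta>)))"
  have lin: "integral {0..pi} (\<lambda>\<theta>. a * (sin \<theta> * (leg 0 i (cos \<theta>) * leg 0 j (cos \<theta>)))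
      + b * (sin \<theta> * (leg 0 i' (cos \<theta>) * leg 0 j' (cos \<theta>)))) = a * legendre_integral 0 i j + b * legendre_integral 0 i' j'"
    for a b i j i' j'
    unfolding legendre_integral_def
    by (subst integral_add) (auto intro!: integrable_continuous_real continuous_intros)
  have "(2 * real l + 1) * X = integral {0..pi} (\<lambda>\<theta>. (2 * real l + 1) * (sin \<theta> * (cos \<theta> * leg 0 l (cos \<theta>) * leg 0 (Suc l) (cos \<theta>))))"
    by (simp add: X_def)
  also have "\<dots> = integral {0..pi} (\<lambda>\<theta>. (real l + 1) * (sin \<theta> * (leg 0 (Suc l) (cos \<theta>) * leg 0 (Suc l) (cos \<theta>)))
      + real l * (sin \<theta> * (leg 0 (l - 1) (cos \<theta>) * leg 0 (Suc l) (cos \<theta>))))"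
  proof (intro arg_cong[of _ _ "integral {0..pi}"] ext)
    fix \<theta>
    show "(2 * real l + 1) * (sin \<theta> * (cos \<theta> * leg 0 l (cos \<theta>) * leg 0 (Suc l) (cos \<theta>))) =
       (real l + 1) * (sin \<theta> * (leg 0 (Suc l) (cos \<theta>) * leg 0 (Suc l) (cos \<theta>)))
      + real l * (sin \<theta> * (leg 0 (l - 1) (cos \<theta>) * leg 0 (Suc l) (cos \<theta>)))"
      using legendre_recurrence[of l "cos \<theta>"] by algebra
  qed
  also have "\<dots> = (real l + 1) * legendre_integral 0 (Suc l) (Suc l)"
    unfolding lin by (simp add: legendre_integral_0_neq)
  finally have 1: "(2 * real l + 1) * X = (real l + 1) * legendre_integral 0 (Suc l) (Suc l)" .
  have "(2 * real l + 3) * X = integral {0..pi} (\<lambda>\<theta>. (2 * real l + 3) * (sin \<theta> * (cos \<theta> * leg 0 l (cos \<theta>) * leg 0 (Suc l) (cos \<theta>))))"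
    by (simp add: X_def)
  also have "\<dots> = integral {0..pi} (\<lambda>\<theta>. (real l + 2) * (sin \<theta> * (leg 0 (Suc (Suc l)) (cos \<theta>) * leg 0 l (cos \<theta>)))
      + (real l + 1) * (sin \<theta> * (leg 0 l (cos \<theta>) * leg 0 l (cos \<theta>))))"
  proof (intro arg_cong[of _ _ "integral {0..pi}"] ext)
    fix \<theta>
    have "(2 * real l + 3) * cos \<theta> * leg 0 (Suc l) (cos \<theta>) = (real l + 2) * leg 0 (Suc (Suc l)) (cos \<theta>) + (real l + 1) * leg 0 l (cos \<theta>)"
      using legendre_recurrence[of "Suc l" "cos \<theta>"] by (simp add: algebra_simps)
    then show "(2 * real l + 3) * (sin \<theta> * (cos \<theta> * leg 0 l (cos \<theta>) * leg 0 (Suc l) (cos \<theta>))) =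
       (real l + 2) * (sin \<theta> * (leg 0 (Suc (Suc l)) (cos \<theta>) * leg 0 l (cos \<theta>)))
      + (real l + 1) * (sin \<theta> * (leg 0 l (cos \<theta>) * leg 0 l (cos \<theta>)))"
      by algebra
  qed
  also have "\<dots> = (real l + 1) * legendre_integral 0 l l"
    unfolding lin by (simp add: legendre_integral_0_neq)
  finally have "(2 * real l + 3) * X = (real l + 1) * (2 / (2 * real l + 1))" unfolding Suc .
  then have "(2 * real l + 1) * X = (real l + 1) * (2 / (2 * real l + 3))"
    by (simp add: field_simps)
  then have "(real l + 1) * legendre_integral 0 (Suc l) (Suc l) = (real l + 1) * (2 / (2 * real l + 3))"
    unfolding 1 .
  moreover have "real l + 1 \<noteq> 0" by linarith
  ultimately have "legendre_integral 0 (Suc l) (Suc l) = 2 / (2 * real l + 3)"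
    by (meson mult_left_cancel)
  then show ?case by (simp add: add.commute)
qed

lemma legendre_orthogonality:
  assumes "m \<le> l"
  shows "legendre_integral m l l' = (if l = l' then 2 / (2 * real l + 1) * (fact (l + m) / fact (l - m)) else 0)"
  using assms
proof (induction m)
  case 0
  then show ?case by (simp add: legendre_integral_0_neq legendre_integral_0_same)
next
  case (Suc m)
  have "(fact (l - m) :: real) = real (l - m) * fact (l - Suc m)"
    using Suc by (metis Suc_diff_Suc Suc_le_lessD fact_Suc of_nat_fact of_nat_mult)
  moreover have "fact (l + Suc m) = real (l + m + 1) * fact (l + m)" by simp
  moreover have "real l * (real l + 1) - real m * (real m + 1) = real (l - m) * real (l + m + 1)"
    using Suc by (simp add: of_nat_diff algebra_simps)
  moreover have "legendre_integral m l l' = (if l = l' then 2 / (2 * real l + 1) * (fact (l + m) / fact (l - m)) else 0)"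
    using Suc by simp
  moreover have "real (l - m) \<noteq> 0" using Suc.prems by simp
  moreover have "a * b * (q * (F / (a * G))) = q * (b * F / G)" if "a \<noteq> 0" for a b q F G :: real
    using that by simp
  ultimately show ?case
    unfolding legendre_integral_Suc by (cases "l = l'") (simp_all only: if_True if_False mult_zero_right refl)
qed

section \<open>The surface measure in polar coordinates and orthonormality\<close>

definition sphere_point :: "real \<times> real \<Rightarrow> real^3" where
  "sphere_point = (\<lambda>(\<theta>, \<phi>). vector [sin \<theta> * cos \<phi>, sin \<theta> * sin \<phi>, cos \<theta>])"

lemma sphere_point_in: "sphere_point z \<in> S2"
proof -
  obtain \<theta> \<phi> where z: "z = (\<theta>, \<phi>)" by (cases z)
  have "(sin \<theta> * cos \<phi>)\<^sup>2 + (sin \<theta> * sin \<phi>)\<^sup>2 + (cos \<theta>)\<^sup>2 = (sin \<theta>)\<^sup>2 * ((sin \<phi>)\<^sup>2 + (cos \<phi>)\<^sup>2) + (cos \<theta>)\<^sup>2"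
    by algebra
  then have "sphere_point z \<bullet> sphere_point z = 1"
    by (simp add: z sphere_point_def inner_vec_def sum_3 vector_3 flip: power2_eq_square)
  then show ?thesis by (simp add: norm_eq_sqrt_inner)
qed

lemma continuous_sphere_point: "continuous_on A sphere_point"
proof -
  have e: "sphere_point = (\<lambda>z. \<chi> i. if i = 1 then sin (fst z) * cos (snd z) else if i = 2 then sin (fst z) * sin (snd z) else cos (fst z))"
    unfolding sphere_point_def by (auto simp: fun_eq_iff vec_eq_iff forall_3)
  moreover have "continuous_on A (\<lambda>z. if i = (1::3) then sin (fst z) * cos (snd z) else if i = 2 then sin (fst z) * sin (snd z) else cos (fst z :: real))" for i
    by (cases "i = 1"; cases "i = 2") (auto intro!: continuous_intros)
  ultimately show ?thesis unfolding e by (intro continuous_on_vec_lambda)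
qed

abbreviation polar_box :: "(real \<times> real) set" where
  "polar_box \<equiv> {0..pi} \<times> {0..2*pi}"

lemma sphere_point_measurable:
  "sphere_point \<in> restrict_space lborel polar_box \<rightarrow>\<^sub>M restrict_space borel S2"
proof (rule measurable_restrict_space2)
  show "sphere_point \<in> space (restrict_space lborel polar_box) \<rightarrow> S2"
    using sphere_point_in by auto
  have "sphere_point \<in> borel_measurable borel"
    by (intro borel_measurable_continuous_onI continuous_sphere_point)
  then show "sphere_point \<in> borel_measurable (restrict_space lborel polar_box)"
    by (intro measurable_restrict_space1) simp
qed

lemma surface_measure_eq:
  "surface_measure = distr (density (restrict_space lborel polar_box) (\<lambda>z. ennreal (sin (fst z)))) (restrict_space borel S2) sphere_point"
  unfolding surface_measure_def sphere_point_def by (simp add: case_prod_beta')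

lemma sets_surface_measure [simp, measurable_cong]: "sets surface_measure = sets (restrict_space borel S2)"
  by (simp add: surface_measure_eq)

lemma space_surface_measure [simp]: "space surface_measure = S2"
  by (simp add: surface_measure_eq space_restrict_space)

lemma polar_box_measurable: "polar_box \<in> sets lborel"
  by (simp add: borel_closed closed_Times)

lemma sin_measurable: "(\<lambda>z. sin (fst z :: real)) \<in> borel_measurable (restrict_space lborel polar_box)"
  by (intro measurable_restrict_space1) (auto intro!: borel_measurable_continuous_onI continuous_intros)

lemma finite_surface_measure: "finite_measure surface_measure"
proof
  have "emeasure surface_measure (space surface_measure) = emeasure (density (restrict_space lborel polar_box) (\<lambda>z. ennreal (sin (fst z)))) polar_box"
    unfolding space_surface_measure unfolding surface_measure_eq
  proof (subst emeasure_distr)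
    show "sphere_point \<in> density (restrict_space lborel polar_box) (\<lambda>z. ennreal (sin (fst z))) \<rightarrow>\<^sub>M restrict_space borel S2"
      using sphere_point_measurable by simp
    have "sphere_point -` S2 = UNIV" using sphere_point_in by auto
    then show "emeasure (density (restrict_space lborel polar_box) (\<lambda>z. ennreal (sin (fst z)))) (sphere_point -` S2 \<inter> space (density (restrict_space lborel polar_box) (\<lambda>z. ennreal (sin (fst z))))) =
      emeasure (density (restrict_space lborel polar_box) (\<lambda>z. ennreal (sin (fst z)))) polar_box"
      by (simp add: space_restrict_space)
    show "S2 \<in> sets (restrict_space borel S2)"
      using sets.top[of "restrict_space borel S2"] by (simp add: space_restrict_space)
  qed
  also have "\<dots> = (\<integral>\<^sup>+z. ennreal (sin (fst z)) * indicator polar_box z \<partial>restrict_space lborel polar_box)"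
    using sin_measurable polar_box_measurable by (intro emeasure_density) (auto simp: sets_restrict_space)
  also have "\<dots> \<le> (\<integral>\<^sup>+z. 1 \<partial>restrict_space lborel polar_box)"
    by (intro nn_integral_mono) (auto simp: indicator_def ennreal_le_1)
  also have "\<dots> = emeasure lborel polar_box"
    using polar_box_measurable by (simp add: space_restrict_space emeasure_restrict_space)
  also have "\<dots> < \<infinity>"
    by (rule emeasure_bounded_finite) (auto intro!: bounded_Times)
  finally show "emeasure surface_measure (space surface_measure) \<noteq> \<infinity>" by simp
qed

interpretation surface: finite_measure surface_measure by (rule finite_surface_measure)

lemma integral_surface_measure_product:
  fixes f :: "real^3 \<Rightarrow> complex" and g :: "real \<Rightarrow> real" and h :: "real \<Rightarrow> complex"
  assumes "f \<in> borel_measurable borel"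
    and f: "\<And>\<theta> \<phi>. f (sphere_point (\<theta>, \<phi>)) = complex_of_real (g \<theta>) * h \<phi>"
    and g: "continuous_on UNIV g" and h: "continuous_on UNIV h"
  shows "integral\<^sup>L surface_measure f = complex_of_real (integral {0..pi} (\<lambda>\<theta>. sin \<theta> * g \<theta>)) * integral {0..2*pi} h"
proof -
  let ?R = "restrict_space lborel polar_box"
  have fm: "f \<in> borel_measurable (restrict_space borel S2)"
    using assms(1) by (rule measurable_restrict_space1)
  have fs: "(\<lambda>z. f (sphere_point z)) \<in> borel_measurable ?R"
    using measurable_comp[OF sphere_point_measurable fm] by (simp add: o_def)
  have "integral\<^sup>L surface_measure f = (\<integral>z. f (sphere_point z) \<partial>density ?R (\<lambda>z. ennreal (sin (fst z))))"
    unfolding surface_measure_eq using fm sphere_point_measurable by (intro integral_distr) auto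
  also have "\<dots> = (\<integral>z. sin (fst z) *\<^sub>R f (sphere_point z) \<partial>?R)"
    using fs sin_measurable
    by (intro integral_density) (auto intro!: AE_I2 sin_ge_zero simp: space_restrict_space)
  also have "\<dots> = (\<integral>z. indicator polar_box z *\<^sub>R (sin (fst z) *\<^sub>R f (sphere_point z)) \<partial>lborel)"
    by (rule integral_restrict_space) (simp add: borel_closed closed_Times)
  also have "\<dots> = (\<integral>z. indicator polar_box z *\<^sub>R (complex_of_real (sin (fst z) * g (fst z)) * h (snd z)) \<partial>(lborel \<Otimes>\<^sub>M lborel))"
    unfolding lborel_prod by (intro Bochner_Integration.integral_cong refl) (auto simp: f scaleR_conv_of_real)
  also have "\<dots> = (\<integral>\<theta>. \<integral>\<phi>. indicator polar_box (\<theta>, \<phi>) *\<^sub>R (complex_of_real (sin \<theta> * g \<theta>) * h \<phi>) \<partial>lborel \<partial>lborel)"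
  proof (subst lborel_pair.integral_fst'[symmetric])
    have "continuous_on polar_box (\<lambda>z. complex_of_real (sin (fst z) * g (fst z)) * h (snd z))"
      by (intro continuous_intros continuous_on_compose2[OF g] continuous_on_compose2[OF h]) auto
    then have "integrable lborel (\<lambda>z. indicator polar_box z *\<^sub>R (complex_of_real (sin (fst z) * g (fst z)) * h (snd z)))"
      by (intro borel_integrable_compact compact_Times) auto
    then show "integrable (lborel \<Otimes>\<^sub>M lborel) (\<lambda>z. indicator polar_box z *\<^sub>R (complex_of_real (sin (fst z) * g (fst z)) * h (snd z)))"
      by (simp add: lborel_prod)
  qed simp
  also have "\<dots> = (\<integral>\<theta>. complex_of_real (indicator {0..pi} \<theta> *\<^sub>R (sin \<theta> * g \<theta>)) * (\<integral>\<phi>. indicator {0..2*pi} \<phi> *\<^sub>R h \<phi> \<partial>lborel) \<partial>lborel)"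
    by (intro Bochner_Integration.integral_cong refl)
       (auto simp: indicator_times scaleR_conv_of_real mult_ac simp flip: integral_mult_right_zero)
  also have "\<dots> = complex_of_real (\<integral>\<theta>. indicator {0..pi} \<theta> *\<^sub>R (sin \<theta> * g \<theta>) \<partial>lborel) * (\<integral>\<phi>. indicator {0..2*pi} \<phi> *\<^sub>R h \<phi> \<partial>lborel)"
    by (simp only: integral_mult_left_zero integral_complex_of_real)
  also have "(\<integral>\<theta>. indicator {0..pi} \<theta> *\<^sub>R (sin \<theta> * g \<theta>) \<partial>lborel) = integral {0..pi} (\<lambda>\<theta>. sin \<theta> * g \<theta>)"
    using g by (intro set_borel_integral_eq_integral(2)[unfolded set_lebesgue_integral_def] borel_integrable_atLeastAtMost'[unfolded set_integrable_def])
      (auto intro!: continuous_intros borel_integrable_atLeastAtMost' intro: continuous_on_subset)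
  also have "(\<integral>\<phi>. indicator {0..2*pi} \<phi> *\<^sub>R h \<phi> \<partial>lborel) = integral {0..2*pi} h"
    using h by (intro set_borel_integral_eq_integral(2)[unfolded set_lebesgue_integral_def])
      (auto intro!: continuous_intros borel_integrable_atLeastAtMost' intro: continuous_on_subset)
  finally show ?thesis .
qed

lemma integral_cis:
  fixes k :: int
  shows "integral {0..2*pi} (\<lambda>\<phi>. cis (of_int k * \<phi>)) = (if k = 0 then 2 * pi else 0)"
proof (cases "k = 0")
  case True
  then show ?thesis by (simp add: scaleR_conv_of_real)
next
  case False
  define F where "F \<phi> = cis (of_int k * \<phi>) / (\<i> * of_int k)" for \<phi> :: real
  have "((\<lambda>\<phi>. cis (of_int k * \<phi>)) has_integral F (2 * pi) - F 0) {0..2*pi}"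
  proof (rule fundamental_theorem_of_calculus)
    fix x :: real
    have "((\<lambda>z. exp (\<i> * of_int k * z) / (\<i> * of_int k)) has_field_derivative exp (\<i> * of_int k * complex_of_real x))
        (at (complex_of_real x))"
      using False by (auto intro!: derivative_eq_intros)
    then have "((\<lambda>x. exp (\<i> * of_int k * complex_of_real x) / (\<i> * of_int k)) has_vector_derivative exp (\<i> * of_int k * complex_of_real x)) (at x within {0..2*pi})"
      by (rule has_vector_derivative_real_field)
    then show "(F has_vector_derivative cis (of_int k * x)) (at x within {0..2*pi})"
      by (simp add: F_def[abs_def] cis_conv_exp mult.assoc)
  qed simp
  moreover have "cis (of_int k * (2 * pi)) = 1"
    using cis_multiple_2pi[of "of_int k"] by (simp add: mult_ac)
  ultimately show ?thesis using False by (auto simp: F_def dest!: integral_unique)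
qed

text \<open>The real prefactor of Y_lm in polar form. For m >= 0 it carries the sign (-1)^m; for m <
  0 the two signs in \<open>sph_harm\<close> cancel.\<close>

definition sph_norm :: "nat \<Rightarrow> int \<Rightarrow> real" where
  "sph_norm l m = (if m \<ge> 0 then (-1) ^ nat \<bar>m\<bar> else 1) *
     sqrt ((2 * real l + 1) / (4 * pi) * (fact (l - nat \<bar>m\<bar>) / fact (l + nat \<bar>m\<bar>)))"

lemma sph_norm_square:
  "sph_norm l m * sph_norm l m = (2 * real l + 1) / (4 * pi) * (fact (l - nat \<bar>m\<bar>) / fact (l + nat \<bar>m\<bar>))"
proof -
  have "(if m \<ge> 0 then (-1) ^ nat \<bar>m\<bar> else 1) * (if m \<ge> 0 then (-1) ^ nat \<bar>m\<bar> else 1) = (1 :: real)"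
    by (simp flip: power_mult_distrib)
  then show ?thesis unfolding sph_norm_def
    by (simp only: mult.assoc mult.left_commute[of "sqrt _"] real_sqrt_mult_self) simp
qed

lemma sph_harm_polar:
  "sph_harm l m (sphere_point (\<theta>, \<phi>)) =
     complex_of_real (sph_norm l m * (sin \<theta> ^ nat \<bar>m\<bar> * leg (nat \<bar>m\<bar>) l (cos \<theta>))) * cis (of_int m * \<phi>)"
proof -
  define n where "n = nat \<bar>m\<bar>"
  have "Complex (sphere_point (\<theta>, \<phi>) $ 1) (sphere_point (\<theta>, \<phi>) $ 2) = complex_of_real (sin \<theta>) * cis \<phi>"
    by (simp add: sphere_point_def vector_3 complex_eq_iff)
  then have p: "Complex (sphere_point (\<theta>, \<phi>) $ 1) (sphere_point (\<theta>, \<phi>) $ 2) ^ n = complex_of_real (sin \<theta> ^ n) * cis (real n * \<phi>)"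
    by (simp add: power_mult_distrib Complex.DeMoivre)
  have t: "sphere_point (\<theta>, \<phi>) $ 3 = cos \<theta>" by (simp add: sphere_point_def vector_3)
  have e: "(-1) ^ n * (-1) ^ n = (1 :: complex)" by (simp flip: power_mult_distrib)
  show ?thesis
  proof (cases "m \<ge> 0")
    case True
    then have "real_of_int m = real n" by (simp add: n_def)
    then show ?thesis using True
      unfolding sph_harm_def Let_def sph_norm_def n_def[symmetric] p t by (simp add: mult_ac)
  next
    case False
    then have "real_of_int m = - real n" by (simp add: n_def)
    then show ?thesis using False e
      unfolding sph_harm_def Let_def sph_norm_def n_def[symmetric] p t
      by (simp add: mult_ac cis_cnj)
  qed
qed

lemma sph_harm_continuous: "continuous_on A (sph_harm l m)"
  unfolding sph_harm_def Let_def
  by (cases "m \<ge> 0") (auto intro!: continuous_intros simp: Complex_eq)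

lemma sph_harm_measurable:
  "(\<lambda>x. sph_harm l m x * cnj (sph_harm l' m' x)) \<in> borel_measurable borel"
  by (intro borel_measurable_continuous_onI continuous_intros sph_harm_continuous)

lemma sph_harm_bound:
  assumes "x \<in> S2" "m \<in> {-int l..int l}"
  shows "(cmod (sph_harm l m x))\<^sup>2 \<le> (2 * real l + 1) / (4 * pi)"
  unfolding sum_norm_sph_harm[OF assms(1), symmetric]
  using assms(2) by (intro member_le_sum) auto

lemma integrable_surface_bounded:
  fixes f :: "real^3 \<Rightarrow> 'b::{banach, second_countable_topology}"
  assumes "f \<in> borel_measurable (restrict_space borel S2)" "\<And>x. x \<in> S2 \<Longrightarrow> norm (f x) \<le> B"
  shows "integrable surface_measure f"
  using assms by (intro surface.integrable_const_bound[of _ B]) (auto cong: measurable_cong_sets)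

lemma sph_harm_integrable:
  assumes "m \<in> {-int l..int l}" "m' \<in> {-int l'..int l'}"
  shows "integrable surface_measure (\<lambda>x. sph_harm l m x * cnj (sph_harm l' m' x))"
proof (rule integrable_surface_bounded)
  show "(\<lambda>x. sph_harm l m x * cnj (sph_harm l' m' x)) \<in> borel_measurable (restrict_space borel S2)"
    by (intro measurable_restrict_space1 sph_harm_measurable)
  fix x assume x: "x \<in> S2"
  have "cmod (sph_harm l m x) \<le> sqrt ((2 * real l + 1) / (4 * pi))" "cmod (sph_harm l' m' x) \<le> sqrt ((2 * real l' + 1) / (4 * pi))"
    using sph_harm_bound[OF x assms(1)] sph_harm_bound[OF x assms(2)] by (auto intro: real_le_rsqrt)
  then show "cmod (sph_harm l m x * cnj (sph_harm l' m' x)) \<le> sqrt ((2 * real l + 1) / (4 * pi)) * sqrt ((2 * real l' + 1) / (4 * pi))"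
    unfolding norm_mult complex_mod_cnj by (intro mult_mono) auto
qed

text \<open>The azimuthal integral forces m = m'. The polar factors then have the same order, so the
  even power of sin is a polynomial in cos, and the norm from \<open>legendre_orthogonality\<close>
  cancels against the square of \<open>sph_norm\<close>.\<close>

theorem sph_harm_orthonormal:
  assumes "m \<in> {-int l..int l}" "m' \<in> {-int l'..int l'}"
  shows "(\<integral>x. sph_harm l m x * cnj (sph_harm l' m' x) \<partial>surface_measure) = (if (l, m) = (l', m') then 1 else 0)"
proof -
  define n n' where "n = nat \<bar>m\<bar>" and "n' = nat \<bar>m'\<bar>"
  define g where "g \<theta> = sph_norm l m * sph_norm l' m' * (sin \<theta> ^ (n + n') * leg n l (cos \<theta>) * leg n' l' (cos \<theta>))" for \<theta>
  have "(\<integral>x. sph_harm l m x * cnj (sph_harm l' m' x) \<partial>surface_measure)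
    = complex_of_real (integral {0..pi} (\<lambda>\<theta>. sin \<theta> * g \<theta>)) * integral {0..2*pi} (\<lambda>\<phi>. cis (of_int (m - m') * \<phi>))"
  proof (rule integral_surface_measure_product)
    show "(\<lambda>x. sph_harm l m x * cnj (sph_harm l' m' x)) \<in> borel_measurable borel"
      by (rule sph_harm_measurable)
    fix \<theta> \<phi> :: real
    have "cis (of_int m * \<phi>) * cnj (cis (of_int m' * \<phi>)) = cis (of_int (m - m') * \<phi>)"
      by (simp add: cis_cnj cis_mult algebra_simps)
    then show "sph_harm l m (sphere_point (\<theta>, \<phi>)) * cnj (sph_harm l' m' (sphere_point (\<theta>, \<phi>))) =
      complex_of_real (g \<theta>) * cis (of_int (m - m') * \<phi>)"
      unfolding sph_harm_polar g_def n_def[symmetric] n'_def[symmetric] by (simp add: power_add mult_ac)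
  next
    show "continuous_on UNIV g" unfolding g_def by (intro continuous_intros)
    show "continuous_on UNIV (\<lambda>\<phi>. cis (of_int (m - m') * \<phi>))" by (intro continuous_intros)
  qed
  also have "\<dots> = (if (l, m) = (l', m') then 1 else 0)"
  proof (cases "m = m'")
    case True
    then have n: "n' = n" by (simp add: n_def n'_def)
    have nl: "n \<le> l" using assms by (auto simp: n_def)
    have "(sin \<theta>)\<^sup>2 = 1 - (cos \<theta>)\<^sup>2" for \<theta> :: real by (simp add: sin_squared_eq)
    then have "sin \<theta> ^ (n + n') = (1 - (cos \<theta>)\<^sup>2) ^ n" for \<theta> :: real
      unfolding n by (metis mult_2 power_mult)
    then have "sin \<theta> * g \<theta> = sph_norm l m * sph_norm l' m' * (sin \<theta> * ((1 - (cos \<theta>)\<^sup>2) ^ n * leg n l (cos \<theta>) * leg n l' (cos \<theta>)))" for \<theta>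
      unfolding g_def n by simp
    then have "integral {0..pi} (\<lambda>\<theta>. sin \<theta> * g \<theta>) = sph_norm l m * sph_norm l' m' * legendre_integral n l l'"
      by (simp only: legendre_integral_def integral_mult_right)
    also have "\<dots> = (if l = l' then 1 / (2 * pi) else 0)"
    proof (cases "l = l'")
      case l: True
      have "a / (4 * pi) * (F / G) * (2 / a * (G / F)) = 1 / (2 * pi)" if "a \<noteq> 0" "F \<noteq> 0" "G \<noteq> 0" for a F G :: real
        using that by (simp add: field_simps)
      moreover have "2 * real l + 1 \<noteq> 0" by linarith
      ultimately show ?thesis using l True
        unfolding l[symmetric] True[symmetric] sph_norm_square legendre_orthogonality[OF nl] n_def[symmetric]
        by (simp only: if_True refl) simp
    qed (simp add: legendre_orthogonality[OF nl])
    finally show ?thesis using True by (auto simp: integral_cis scaleR_conv_of_real)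
  qed (simp add: integral_cis del: of_int_diff)
  finally show ?thesis .
qed

section \<open>Zonal kernels, the reproducing kernels of the harmonics of fixed degree\<close>

definition zonal :: "nat \<Rightarrow> real^3 \<Rightarrow> real^3 \<Rightarrow> real" where
  "zonal l x y = (2 * real l + 1) / (4 * pi) * leg 0 l (x \<bullet> y)"

lemma zonal_commute: "zonal l x y = zonal l y x"
  by (simp add: zonal_def inner_commute)

lemma zonal_measurable [measurable]: "zonal l x \<in> borel_measurable borel"
  unfolding zonal_def by (intro borel_measurable_continuous_onI) (auto intro!: continuous_intros)

lemma zonal_bound:
  assumes "x \<in> S2" "y \<in> S2"
  shows "\<bar>zonal l x y\<bar> \<le> 2 * real l + 1"
proof -
  have "\<bar>x \<bullet> y\<bar> \<le> 1" using Cauchy_Schwarz_ineq2[of x y] assms by simp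
  then have "\<bar>zonal l x y\<bar> \<le> (2 * real l + 1) / (4 * pi) * 1"
    unfolding zonal_def abs_mult using legendre_abs_le_1 by (intro mult_mono) auto
  also have "\<dots> \<le> (2 * real l + 1) / 1"
    unfolding mult_1_right using pi_gt3 by (intro divide_left_mono) auto
  finally show ?thesis by simp
qed

lemma zonal_sph_harm:
  assumes "x \<in> S2" "y \<in> S2"
  shows "complex_of_real (zonal l x y) = (\<Sum>m=-int l..int l. sph_harm l m x * cnj (sph_harm l m y))"
  unfolding zonal_def sph_harm_addition[OF assms] ..

text \<open>Both kernels are expanded by the addition theorem, one of them with its arguments
  exchanged, so that the variable of integration occurs in products Y cnj(Y) and orthonormality can
  be read off.\<close>

lemma zonal_reproducing:
  assumes "x \<in> S2" "y \<in> S2"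
  shows "(\<integral>z. zonal l x z * zonal l' y z \<partial>surface_measure) = (if l = l' then zonal l x y else 0)"
proof -
  define A where "A l = {-int l..int l}" for l :: nat
  have "complex_of_real (\<integral>z. zonal l x z * zonal l' y z \<partial>surface_measure)
    = (\<integral>z. complex_of_real (zonal l' z y) * complex_of_real (zonal l x z) \<partial>surface_measure)"
    by (simp add: zonal_commute[of l' y] mult.commute flip: integral_complex_of_real of_real_mult)
  also have "\<dots> = (\<integral>z. (\<Sum>m'\<in>A l'. \<Sum>m\<in>A l. (cnj (sph_harm l' m' y) * sph_harm l m x) * (sph_harm l' m' z * cnj (sph_harm l m z))) \<partial>surface_measure)"
    using assms
    by (intro Bochner_Integration.integral_cong refl)
       (simp add: zonal_sph_harm sum_product A_def mult_ac, rule sum.swap)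
  also have "\<dots> = (\<Sum>m'\<in>A l'. \<Sum>m\<in>A l. (cnj (sph_harm l' m' y) * sph_harm l m x) * (if (l', m') = (l, m) then 1 else 0))"
    using sph_harm_integrable sph_harm_orthonormal
    by (subst Bochner_Integration.integral_sum)
       (auto intro!: sum.cong Bochner_Integration.integrable_sum simp: A_def Bochner_Integration.integral_sum)
  also have "\<dots> = complex_of_real (if l = l' then zonal l x y else 0)"
  proof (cases "l = l'")
    case True
    have "(\<Sum>m'\<in>A l'. \<Sum>m\<in>A l. (cnj (sph_harm l' m' y) * sph_harm l m x) * (if (l', m') = (l, m) then 1 else 0))
      = (\<Sum>m'\<in>A l. \<Sum>m\<in>A l. if m' = m then cnj (sph_harm l m y) * sph_harm l m x else 0)"
      using True by (intro sum.cong) auto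
    also have "\<dots> = (\<Sum>m\<in>A l. cnj (sph_harm l m y) * sph_harm l m x)"
      by (intro sum.cong) (auto simp: A_def sum.delta')
    finally show ?thesis using True zonal_sph_harm[OF assms] by (simp add: A_def mult.commute)
  qed auto
  finally show ?thesis by (simp only: of_real_eq_iff)
qed

section \<open>Second-order fields on the sphere\<close>

lemma abs_mult_le_squares: "\<bar>u * v\<bar> \<le> u\<^sup>2 + v\<^sup>2" for u v :: real
proof -
  have "2 * \<bar>u * v\<bar> \<le> u\<^sup>2 + v\<^sup>2"
    using sum_squares_bound[of "\<bar>u\<bar>" "\<bar>v\<bar>"] by (simp add: abs_mult mult.assoc)
  then show ?thesis using abs_ge_zero[of "u * v"] by linarith
qed

lemma square_le_imp_integrable_mult:
  fixes U V :: "'a \<Rightarrow> real"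
  assumes [measurable]: "U \<in> borel_measurable M" "V \<in> borel_measurable M"
    and "integrable M (\<lambda>x. (U x)\<^sup>2)" "integrable M (\<lambda>x. (V x)\<^sup>2)"
  shows "integrable M (\<lambda>x. U x * V x)"
proof (rule Bochner_Integration.integrable_bound)
  show "integrable M (\<lambda>x. (U x)\<^sup>2 + (V x)\<^sup>2)" using assms by simp
  show "AE x in M. norm (U x * V x) \<le> norm ((U x)\<^sup>2 + (V x)\<^sup>2)" using abs_mult_le_squares by simp
qed simp

lemma Cauchy_Schwarz_integral:
  fixes U V :: "'a \<Rightarrow> real"
  assumes m: "U \<in> borel_measurable M" "V \<in> borel_measurable M"
    and i: "integrable M (\<lambda>x. (U x)\<^sup>2)" "integrable M (\<lambda>x. (V x)\<^sup>2)"
  shows "(\<integral>x. U x * V x \<partial>M)\<^sup>2 \<le> (\<integral>x. (U x)\<^sup>2 \<partial>M) * (\<integral>x. (V x)\<^sup>2 \<partial>M)"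
proof -
  define a b c where "a = (\<integral>x. (U x)\<^sup>2 \<partial>M)" and "b = (\<integral>x. (V x)\<^sup>2 \<partial>M)" and "c = (\<integral>x. U x * V x \<partial>M)"
  have uv: "integrable M (\<lambda>x. U x * V x)" by (rule square_le_imp_integrable_mult[OF m i])
  have q: "0 \<le> a - 2 * t * c + t\<^sup>2 * b" for t
  proof -
    have "0 \<le> (\<integral>x. (U x - t * V x)\<^sup>2 \<partial>M)" by (rule integral_nonneg_AE) simp
    also have "\<dots> = (\<integral>x. (U x)\<^sup>2 - 2 * t * (U x * V x) + t\<^sup>2 * (V x)\<^sup>2 \<partial>M)"
      by (rule Bochner_Integration.integral_cong) (auto simp: power2_diff power_mult_distrib)
    also have "\<dots> = a - 2 * t * c + t\<^sup>2 * b"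
      using uv i by (simp add: a_def b_def c_def)
    finally show ?thesis .
  qed
  have b: "b \<ge> 0" unfolding b_def by (rule integral_nonneg_AE) simp
  have "c\<^sup>2 \<le> a * b"
  proof (cases "b = 0")
    case True
    have "c = 0"
    proof (rule ccontr)
      assume "c \<noteq> 0"
      \<comment> \<open>For b = 0 the quadratic in t is affine, and this t gives it the value
        -1.\<close>
      then show False using q[of "(a + 1) / (2 * c)"] True by simp
    qed
    then show ?thesis using True by simp
  next
    case False
    then have "b > 0" using b by simp
    have "0 \<le> b * (a - 2 * (c / b) * c + (c / b)\<^sup>2 * b)" using q[of "c / b"] b by (intro mult_nonneg_nonneg)
    also have "\<dots> = a * b - c\<^sup>2" using False by (simp add: field_simps power2_eq_square)
    finally show ?thesis by simp
  qed
  then show ?thesis by (simp add: a_def b_def c_def)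
qed

section \<open>Absolutely convergent zonal series\<close>

definition zonal_series :: "(nat \<Rightarrow> real) \<Rightarrow> real^3 \<Rightarrow> real^3 \<Rightarrow> real" where
  "zonal_series b \<xi> x = (\<Sum>l. b l * zonal l \<xi> x)"

lemma zonal_series_summable:
  assumes "summable (\<lambda>l. \<bar>b l\<bar> * (2 * real l + 1))" "\<xi> \<in> S2" "x \<in> S2"
  shows "summable (\<lambda>l. norm (b l * zonal l \<xi> x))"
  using assms(1)
proof (rule summable_comparison_test')
  fix l show "norm (norm (b l * zonal l \<xi> x)) \<le> \<bar>b l\<bar> * (2 * real l + 1)"
    unfolding real_norm_def abs_abs abs_mult using zonal_bound[OF assms(2,3), of l] by (intro mult_left_mono) auto
qed

lemma zonal_series_measurable: "zonal_series b \<xi> \<in> borel_measurable borel"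
  unfolding zonal_series_def by measurable

lemma zonal_series_measurable_surface [measurable]: "zonal_series b \<xi> \<in> borel_measurable surface_measure"
  using measurable_restrict_space1[OF zonal_series_measurable] by (simp cong: measurable_cong_sets)

lemma zonal_measurable_surface [measurable]: "zonal l \<xi> \<in> borel_measurable surface_measure"
  using measurable_restrict_space1[OF zonal_measurable] by (simp cong: measurable_cong_sets)

lemma zonal_series_bound:
  assumes "summable (\<lambda>l. \<bar>b l\<bar> * (2 * real l + 1))" "\<xi> \<in> S2" "x \<in> S2"
  shows "\<bar>zonal_series b \<xi> x\<bar> \<le> (\<Sum>l. \<bar>b l\<bar> * (2 * real l + 1))"
proof -
  have "norm (zonal_series b \<xi> x) \<le> (\<Sum>l. \<bar>b l\<bar> * (2 * real l + 1))" unfolding zonal_series_def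
    using assms(1) by (rule norm_suminf_le[rotated])
      (use zonal_bound[OF assms(2,3)] in \<open>auto simp: abs_mult intro: mult_left_mono\<close>)
  then show ?thesis by simp
qed

lemma integral_zonal_series:
  assumes b: "summable (\<lambda>l. \<bar>b l\<bar> * (2 * real l + 1))" and \<xi>: "\<xi> \<in> S2"
    and h [measurable]: "h \<in> borel_measurable surface_measure" and hK: "\<And>x. x \<in> S2 \<Longrightarrow> \<bar>h x\<bar> \<le> K"
  shows "(\<integral>x. zonal_series b \<xi> x * h x \<partial>surface_measure) = (\<Sum>l. b l * (\<integral>x. zonal l \<xi> x * h x \<partial>surface_measure))"
proof -
  define \<mu> where "\<mu> = measure surface_measure S2"
  have K: "K \<ge> 0" using hK[of "axis 1 1"] by simp
  have bd: "norm (b l * zonal l \<xi> x * h x) \<le> (\<bar>b l\<bar> * (2 * real l + 1)) * K" if "x \<in> S2" for l x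
    unfolding real_norm_def abs_mult using zonal_bound[OF \<xi> that, of l] hK[OF that] by (intro mult_mono mult_nonneg_nonneg) auto
  have int: "integrable surface_measure (\<lambda>x. b l * zonal l \<xi> x * h x)" for l
  proof (rule surface.integrable_const_bound)
    show "AE x in surface_measure. norm (b l * zonal l \<xi> x * h x) \<le> (\<bar>b l\<bar> * (2 * real l + 1)) * K"
      by (intro AE_I2 bd) simp
  qed measurable
  have "(\<integral>x. zonal_series b \<xi> x * h x \<partial>surface_measure) = (\<integral>x. (\<Sum>l. b l * zonal l \<xi> x * h x) \<partial>surface_measure)"
  proof (rule Bochner_Integration.integral_cong[OF refl])
    fix x assume "x \<in> space surface_measure"
    then have "x \<in> S2" by simp
    from suminf_mult2[OF summable_norm_cancel[OF zonal_series_summable[OF b \<xi> this]], of "h x"]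
    show "zonal_series b \<xi> x * h x = (\<Sum>l. b l * zonal l \<xi> x * h x)" by (simp add: zonal_series_def)
  qed
  also have "\<dots> = (\<Sum>l. \<integral>x. b l * zonal l \<xi> x * h x \<partial>surface_measure)"
  proof (rule integral_suminf[OF int])
    show "AE x in surface_measure. summable (\<lambda>l. norm (b l * zonal l \<xi> x * h x))"
    proof (rule AE_I2)
      fix x assume "x \<in> space surface_measure"
      then show "summable (\<lambda>l. norm (b l * zonal l \<xi> x * h x))"
        using summable_mult2[OF zonal_series_summable[OF b \<xi>, of x], of "\<bar>h x\<bar>"] by (simp add: abs_mult)
    qed
    show "summable (\<lambda>l. \<integral>x. norm (b l * zonal l \<xi> x * h x) \<partial>surface_measure)"
    proof (rule summable_comparison_test')
      show "summable (\<lambda>l. (\<bar>b l\<bar> * (2 * real l + 1)) * (K * \<mu>))" by (rule summable_mult2[OF b])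
      fix l
      have "(\<integral>x. norm (b l * zonal l \<xi> x * h x) \<partial>surface_measure) \<le> (\<integral>x. (\<bar>b l\<bar> * (2 * real l + 1)) * K \<partial>surface_measure)"
        using int bd by (intro integral_mono) (auto simp del: real_norm_def)
      also have "\<dots> = (\<bar>b l\<bar> * (2 * real l + 1)) * (K * \<mu>)" by (simp add: \<mu>_def)
      finally show "norm (\<integral>x. norm (b l * zonal l \<xi> x * h x) \<partial>surface_measure) \<le> (\<bar>b l\<bar> * (2 * real l + 1)) * (K * \<mu>)"
        by simp
    qed
  qed
  also have "\<dots> = (\<Sum>l. b l * (\<integral>x. zonal l \<xi> x * h x \<partial>surface_measure))" by (simp add: mult.assoc)
  finally show ?thesis .
qed

text \<open>The reproducing property diagonalises convolution: integrating one series termwise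
  against a single kernel selects one coefficient, and the other series is then integrated termwise
  in turn.\<close>

lemma zonal_series_convolution:
  assumes b: "summable (\<lambda>l. \<bar>b l\<bar> * (2 * real l + 1))" and c: "summable (\<lambda>l. \<bar>c l\<bar> * (2 * real l + 1))"
    and \<xi>: "\<xi> \<in> S2" "\<eta> \<in> S2"
  shows "(\<integral>x. zonal_series b \<xi> x * zonal_series c \<eta> x \<partial>surface_measure) = zonal_series (\<lambda>l. b l * c l) \<xi> \<eta>"
proof -
  have "(\<integral>x. zonal l \<xi> x * zonal_series c \<eta> x \<partial>surface_measure) = c l * zonal l \<xi> \<eta>" for l
  proof -
    have "(\<integral>x. zonal_series c \<eta> x * zonal l \<xi> x \<partial>surface_measure) = (\<Sum>k. c k * (\<integral>x. zonal k \<eta> x * zonal l \<xi> x \<partial>surface_measure))"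
      by (rule integral_zonal_series[OF c \<xi>(2), where K = "2 * real l + 1"]) (use zonal_bound[OF \<xi>(1)] in auto)
    also have "\<dots> = (\<Sum>k. if k = l then c l * zonal l \<xi> \<eta> else 0)"
      unfolding zonal_reproducing[OF \<xi>(2,1)] by (intro suminf_cong) (auto simp: zonal_commute)
    also have "\<dots> = (\<Sum>k\<in>{l}. if k = l then c l * zonal l \<xi> \<eta> else 0)" by (rule suminf_finite) auto
    finally show ?thesis by (simp add: mult.commute)
  qed
  then show ?thesis
    using integral_zonal_series[OF b \<xi>(1) zonal_series_measurable_surface zonal_series_bound[OF c \<xi>(2)]]
    by (simp add: zonal_series_def mult.assoc)
qed

text \<open>Joint measurability and a uniform bound v on the second moments are what Fubini's
  theorem asks for; the covariance structure enters only later.\<close>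

locale second_order_field = prob_space P for P :: "'w measure" +
  fixes T :: "real^3 \<Rightarrow> 'w \<Rightarrow> real" and v :: real
  assumes T_joint [measurable]: "(\<lambda>(x, \<omega>). T x \<omega>) \<in> borel_measurable (surface_measure \<Otimes>\<^sub>M P)"
    and T_square: "\<And>x. x \<in> S2 \<Longrightarrow> integrable P (\<lambda>\<omega>. (T x \<omega>)\<^sup>2)"
    and T_square_le: "\<And>x. x \<in> S2 \<Longrightarrow> (\<integral>\<omega>. (T x \<omega>)\<^sup>2 \<partial>P) \<le> v"
begin

sublocale pair: pair_sigma_finite surface_measure P
  by unfold_locales

text \<open>For a path that is not integrable against \<psi> the integral takes the default value 0;
  for bounded measurable \<psi> this concerns only a null set.\<close>

definition smear :: "(real^3 \<Rightarrow> real) \<Rightarrow> 'w \<Rightarrow> real" where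
  "smear \<psi> \<omega> = (\<integral>x. T x \<omega> * \<psi> x \<partial>surface_measure)"

lemma T_measurable: "x \<in> S2 \<Longrightarrow> T x \<in> borel_measurable P"
  using measurable_Pair2[OF T_joint, of x] by simp

lemma smear_measurable:
  assumes [measurable]: "\<psi> \<in> borel_measurable surface_measure"
  shows "smear \<psi> \<in> borel_measurable P"
proof -
  have "(\<lambda>(\<omega>, x). T x \<omega>) \<in> borel_measurable (P \<Otimes>\<^sub>M surface_measure)"
    using measurable_compose[OF measurable_pair_swap' T_joint] by (simp add: case_prod_beta')
  then have [measurable]: "(\<lambda>z. T (snd z) (fst z)) \<in> borel_measurable (P \<Otimes>\<^sub>M surface_measure)"
    by (simp add: case_prod_beta')
  show ?thesis unfolding smear_def
    by (rule surface.borel_measurable_lebesgue_integral) (simp add: case_prod_beta')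
qed

text \<open>Fubini's theorem, applicable because |T \<psi> X| <= K (T^2 + X^2) has an expectation
  bounded uniformly over the sphere, whose measure is finite.\<close>

lemma smear_inner:
  assumes \<psi> [measurable]: "\<psi> \<in> borel_measurable surface_measure" and \<psi>K: "\<And>x. x \<in> S2 \<Longrightarrow> \<bar>\<psi> x\<bar> \<le> K"
    and X [measurable]: "X \<in> borel_measurable P" and X2: "integrable P (\<lambda>\<omega>. (X \<omega>)\<^sup>2)"
  shows "(\<integral>\<omega>. smear \<psi> \<omega> * X \<omega> \<partial>P) = (\<integral>x. \<psi> x * (\<integral>\<omega>. T x \<omega> * X \<omega> \<partial>P) \<partial>surface_measure)"
proof -
  have K: "K \<ge> 0" using \<psi>K[of "axis 1 1"] by simp
  define f where "f x \<omega> = T x \<omega> * \<psi> x * X \<omega>" for x \<omega>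
  have [measurable]: "(\<lambda>z. T (fst z) (snd z)) \<in> borel_measurable (surface_measure \<Otimes>\<^sub>M P)"
    using T_joint by (simp add: case_prod_beta')
  have fm: "case_prod f \<in> borel_measurable (surface_measure \<Otimes>\<^sub>M P)"
    unfolding f_def case_prod_beta' by measurable
  have fx: "integrable P (f x)" if "x \<in> S2" for x
  proof -
    have "integrable P (\<lambda>\<omega>. T x \<omega> * X \<omega>)"
      by (rule square_le_imp_integrable_mult[OF T_measurable[OF that] X T_square[OF that] X2])
    then have "integrable P (\<lambda>\<omega>. \<psi> x * (T x \<omega> * X \<omega>))" by simp
    then show ?thesis by (simp add: f_def[abs_def] mult_ac)
  qed
  define w where "w = K * (v + (\<integral>\<omega>. (X \<omega>)\<^sup>2 \<partial>P))"
  have fle: "(\<integral>\<omega>. norm (f x \<omega>) \<partial>P) \<le> w" if x: "x \<in> S2" for x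
  proof -
    have "(\<integral>\<omega>. norm (f x \<omega>) \<partial>P) \<le> (\<integral>\<omega>. K * ((T x \<omega>)\<^sup>2 + (X \<omega>)\<^sup>2) \<partial>P)"
    proof (rule integral_mono)
      show "integrable P (\<lambda>\<omega>. norm (f x \<omega>))" using fx[OF x] by (rule integrable_norm)
      show "integrable P (\<lambda>\<omega>. K * ((T x \<omega>)\<^sup>2 + (X \<omega>)\<^sup>2))" using T_square[OF x] X2 by simp
      fix \<omega>
      have "\<bar>\<psi> x\<bar> * \<bar>T x \<omega> * X \<omega>\<bar> \<le> K * ((T x \<omega>)\<^sup>2 + (X \<omega>)\<^sup>2)"
        using \<psi>K[OF x] K abs_mult_le_squares by (intro mult_mono) auto
      then show "norm (f x \<omega>) \<le> K * ((T x \<omega>)\<^sup>2 + (X \<omega>)\<^sup>2)" by (simp add: f_def abs_mult mult_ac)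
    qed
    also have "\<dots> \<le> w" using T_square[OF x] X2 T_square_le[OF x] K by (simp add: w_def mult_left_mono)
    finally show ?thesis .
  qed
  have int: "integrable (surface_measure \<Otimes>\<^sub>M P) (case_prod f)"
  proof (rule pair.Fubini_integrable[OF fm])
    show "integrable surface_measure (\<lambda>x. \<integral>\<omega>. norm (case_prod f (x, \<omega>)) \<partial>P)"
    proof (rule surface.integrable_const_bound)
      show "AE x in surface_measure. norm (\<integral>\<omega>. norm (case_prod f (x, \<omega>)) \<partial>P) \<le> w"
        using fle by (intro AE_I2) simp
      show "(\<lambda>x. \<integral>\<omega>. norm (case_prod f (x, \<omega>)) \<partial>P) \<in> borel_measurable surface_measure"
        using fm by measurable
    qed
    show "AE x in surface_measure. integrable P (\<lambda>\<omega>. case_prod f (x, \<omega>))" using fx by (intro AE_I2) simp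
  qed
  have "(\<integral>\<omega>. smear \<psi> \<omega> * X \<omega> \<partial>P) = (\<integral>\<omega>. \<integral>x. f x \<omega> \<partial>surface_measure \<partial>P)"
    by (simp add: smear_def f_def)
  also have "\<dots> = (\<integral>x. \<integral>\<omega>. f x \<omega> \<partial>P \<partial>surface_measure)" by (rule pair.Fubini_integral[OF int])
  also have "\<dots> = (\<integral>x. \<integral>\<omega>. \<psi> x * (T x \<omega> * X \<omega>) \<partial>P \<partial>surface_measure)" by (simp add: f_def mult_ac)
  finally show ?thesis by simp
qed

lemma smear_square_integrable:
  assumes \<psi> [measurable]: "\<psi> \<in> borel_measurable surface_measure" and \<psi>K: "\<And>x. x \<in> S2 \<Longrightarrow> \<bar>\<psi> x\<bar> \<le> K"
  shows "integrable P (\<lambda>\<omega>. (smear \<psi> \<omega>)\<^sup>2)"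
proof -
  have K: "K \<ge> 0" using \<psi>K[of "axis 1 1"] by simp
  have Tm [measurable]: "(\<lambda>z. T (fst z) (snd z)) \<in> borel_measurable (surface_measure \<Otimes>\<^sub>M P)"
    using T_joint by (simp add: case_prod_beta')
  define g where "g x \<omega> = (T x \<omega>)\<^sup>2" for x \<omega>
  have gm: "case_prod g \<in> borel_measurable (surface_measure \<Otimes>\<^sub>M P)"
    unfolding g_def case_prod_beta' by measurable
  have int: "integrable (surface_measure \<Otimes>\<^sub>M P) (case_prod g)"
  proof (rule pair.Fubini_integrable[OF gm])
    show "integrable surface_measure (\<lambda>x. \<integral>\<omega>. norm (case_prod g (x, \<omega>)) \<partial>P)"
    proof (rule surface.integrable_const_bound)
      show "AE x in surface_measure. norm (\<integral>\<omega>. norm (case_prod g (x, \<omega>)) \<partial>P) \<le> v"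
        using T_square_le by (intro AE_I2) (simp add: g_def)
      show "(\<lambda>x. \<integral>\<omega>. norm (case_prod g (x, \<omega>)) \<partial>P) \<in> borel_measurable surface_measure"
        using gm by measurable
    qed
    show "AE x in surface_measure. integrable P (\<lambda>\<omega>. case_prod g (x, \<omega>))" using T_square by (intro AE_I2) (simp add: g_def)
  qed
  define \<mu> where "\<mu> = measure surface_measure S2"
  show ?thesis
  proof (rule Bochner_Integration.integrable_bound)
    show "integrable P (\<lambda>\<omega>. K\<^sup>2 * (\<integral>x. g x \<omega> \<partial>surface_measure) * \<mu>)"
      using pair.integrable_snd[OF int] by simp
    show "(\<lambda>\<omega>. (smear \<psi> \<omega>)\<^sup>2) \<in> borel_measurable P" using smear_measurable[OF \<psi>] by measurable
    have "AE \<omega> in P. integrable surface_measure (\<lambda>x. g x \<omega>)" by (rule pair.AE_integrable_snd[OF int])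
    moreover have "AE \<omega> in P. \<omega> \<in> space P" by simp
    ultimately show "AE \<omega> in P. norm ((smear \<psi> \<omega>)\<^sup>2) \<le> norm (K\<^sup>2 * (\<integral>x. g x \<omega> \<partial>surface_measure) * \<mu>)"
    proof eventually_elim
      case (elim \<omega>)
      have m: "(\<lambda>x. T x \<omega>) \<in> borel_measurable surface_measure"
        using measurable_Pair1[OF T_joint, of \<omega>] elim by simp
      have le: "(T x \<omega> * \<psi> x)\<^sup>2 \<le> K\<^sup>2 * g x \<omega>" if "x \<in> S2" for x
      proof -
        have "(\<psi> x)\<^sup>2 \<le> K\<^sup>2" using \<psi>K[OF that] K abs_le_square_iff[of "\<psi> x" K] by simp
        from mult_right_mono[OF this zero_le_power2[of "T x \<omega>"]] show ?thesis
          by (simp add: g_def power_mult_distrib mult.commute)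
      qed
      have i: "integrable surface_measure (\<lambda>x. (T x \<omega> * \<psi> x)\<^sup>2)"
      proof (rule Bochner_Integration.integrable_bound)
        show "integrable surface_measure (\<lambda>x. K\<^sup>2 * g x \<omega>)" using elim by simp
        show "(\<lambda>x. (T x \<omega> * \<psi> x)\<^sup>2) \<in> borel_measurable surface_measure" using m by measurable
        show "AE x in surface_measure. norm ((T x \<omega> * \<psi> x)\<^sup>2) \<le> norm (K\<^sup>2 * g x \<omega>)"
          using le by (intro AE_I2) (simp add: g_def abs_mult)
      qed
      have "(smear \<psi> \<omega>)\<^sup>2 = (\<integral>x. (T x \<omega> * \<psi> x) * 1 \<partial>surface_measure)\<^sup>2" by (simp add: smear_def)
      also have "\<dots> \<le> (\<integral>x. (T x \<omega> * \<psi> x)\<^sup>2 \<partial>surface_measure) * (\<integral>x. 1\<^sup>2 \<partial>surface_measure)"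
        using i m by (intro Cauchy_Schwarz_integral) auto
      also have "\<dots> = (\<integral>x. (T x \<omega> * \<psi> x)\<^sup>2 \<partial>surface_measure) * \<mu>" by (simp add: \<mu>_def)
      also have "\<dots> \<le> (\<integral>x. K\<^sup>2 * g x \<omega> \<partial>surface_measure) * \<mu>"
        using i le elim by (intro mult_right_mono integral_mono) (auto simp: \<mu>_def)
      finally have "(smear \<psi> \<omega>)\<^sup>2 \<le> K\<^sup>2 * (\<integral>x. g x \<omega> \<partial>surface_measure) * \<mu>" by simp
      then show ?case by simp
    qed
  qed
qed

text \<open>Two uses of \<open>smear_inner\<close>: with X the other smeared field, and then, for
  fixed x, with X = T x.\<close>

lemma smear_covariance:
  assumes "\<psi> \<in> borel_measurable surface_measure" "\<And>x. x \<in> S2 \<Longrightarrow> \<bar>\<psi> x\<bar> \<le> K"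
    and "\<phi> \<in> borel_measurable surface_measure" "\<And>x. x \<in> S2 \<Longrightarrow> \<bar>\<phi> x\<bar> \<le> K'"
  shows "(\<integral>\<omega>. smear \<psi> \<omega> * smear \<phi> \<omega> \<partial>P)
    = (\<integral>x. \<psi> x * (\<integral>y. \<phi> y * (\<integral>\<omega>. T y \<omega> * T x \<omega> \<partial>P) \<partial>surface_measure) \<partial>surface_measure)"
proof -
  have "(\<integral>\<omega>. smear \<psi> \<omega> * smear \<phi> \<omega> \<partial>P) = (\<integral>x. \<psi> x * (\<integral>\<omega>. T x \<omega> * smear \<phi> \<omega> \<partial>P) \<partial>surface_measure)"
    using smear_measurable[OF assms(3)] smear_square_integrable[OF assms(3,4)] assms(1,2)
    by (intro smear_inner) auto
  also have "\<dots> = (\<integral>x. \<psi> x * (\<integral>y. \<phi> y * (\<integral>\<omega>. T y \<omega> * T x \<omega> \<partial>P) \<partial>surface_measure) \<partial>surface_measure)"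
  proof (rule Bochner_Integration.integral_cong[OF refl])
    fix x assume "x \<in> space surface_measure"
    then have x: "x \<in> S2" by simp
    have "(\<integral>\<omega>. smear \<phi> \<omega> * T x \<omega> \<partial>P) = (\<integral>y. \<phi> y * (\<integral>\<omega>. T y \<omega> * T x \<omega> \<partial>P) \<partial>surface_measure)"
      by (rule smear_inner[OF assms(3,4) T_measurable[OF x] T_square[OF x]])
    then show "\<psi> x * (\<integral>\<omega>. T x \<omega> * smear \<phi> \<omega> \<partial>P) = \<psi> x * (\<integral>y. \<phi> y * (\<integral>\<omega>. T y \<omega> * T x \<omega> \<partial>P) \<partial>surface_measure)"
      by (simp add: mult.commute)
  qed
  finally show ?thesis .
qed

end


section \<open>The covariance function from the spectral representation\<close>

lemma integrable_mult_cnj: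
  fixes f g :: "'a \<Rightarrow> complex"
  assumes [measurable]: "f \<in> borel_measurable M" "g \<in> borel_measurable M"
    and "integrable M (\<lambda>x. (cmod (f x))\<^sup>2)" "integrable M (\<lambda>x. (cmod (g x))\<^sup>2)"
  shows "integrable M (\<lambda>x. f x * cnj (g x))"
proof (rule Bochner_Integration.integrable_bound)
  show "integrable M (\<lambda>x. (cmod (f x))\<^sup>2 + (cmod (g x))\<^sup>2)" using assms by simp
  have [measurable]: "cnj \<in> borel_measurable borel"
    by (intro borel_measurable_continuous_onI continuous_intros)
  show "(\<lambda>x. f x * cnj (g x)) \<in> borel_measurable M" by measurable
  show "AE x in M. norm (f x * cnj (g x)) \<le> norm ((cmod (f x))\<^sup>2 + (cmod (g x))\<^sup>2)"
    using abs_mult_le_squares[of "cmod (f _)" "cmod (g _)"] by (simp add: norm_mult)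
qed

lemma norm_integral_mult_cnj_le:
  fixes f g :: "'a \<Rightarrow> complex"
  assumes [measurable]: "f \<in> borel_measurable M" "g \<in> borel_measurable M"
    and i: "integrable M (\<lambda>x. (cmod (f x))\<^sup>2)" "integrable M (\<lambda>x. (cmod (g x))\<^sup>2)"
  shows "cmod (\<integral>x. f x * cnj (g x) \<partial>M) \<le> sqrt ((\<integral>x. (cmod (f x))\<^sup>2 \<partial>M) * (\<integral>x. (cmod (g x))\<^sup>2 \<partial>M))"
proof (rule real_le_rsqrt)
  have "cmod (\<integral>x. f x * cnj (g x) \<partial>M) \<le> (\<integral>x. cmod (f x) * cmod (g x) \<partial>M)"
    using integral_norm_bound[of M "\<lambda>x. f x * cnj (g x)"] by (simp add: norm_mult)
  then have "(cmod (\<integral>x. f x * cnj (g x) \<partial>M))\<^sup>2 \<le> (\<integral>x. cmod (f x) * cmod (g x) \<partial>M)\<^sup>2"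
    by (intro power_mono) auto
  also have "\<dots> \<le> (\<integral>x. (cmod (f x))\<^sup>2 \<partial>M) * (\<integral>x. (cmod (g x))\<^sup>2 \<partial>M)"
    using i by (intro Cauchy_Schwarz_integral) auto
  finally show "(cmod (\<integral>x. f x * cnj (g x) \<partial>M))\<^sup>2 \<le> (\<integral>x. (cmod (f x))\<^sup>2 \<partial>M) * (\<integral>x. (cmod (g x))\<^sup>2 \<partial>M)" .
qed

text \<open>By orthogonality and the addition theorem, the covariances of the truncated expansions
  are the partial sums of the series; mean-square convergence and Cauchy-Schwarz carry this to the
  limit. Convergence is in the order of l; absolute summability of the spectrum follows later from
  the diagonal x = y, where all terms are nonnegative.\<close>

lemma covariance_expansion:
  fixes P :: "'w measure" and T :: "real^3 \<Rightarrow> 'w \<Rightarrow> real"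
  assumes a: "harmonic_coefficients P C a" and rep: "spectral_representation P T a"
    and Tm: "\<And>x. x \<in> S2 \<Longrightarrow> T x \<in> borel_measurable P"
    and T2: "\<And>x. x \<in> S2 \<Longrightarrow> integrable P (\<lambda>\<omega>. (T x \<omega>)\<^sup>2)"
    and x: "x \<in> S2" and y: "y \<in> S2"
  shows "(\<lambda>l. C l * zonal l x y) sums (\<integral>\<omega>. T x \<omega> * T y \<omega> \<partial>P)"
proof -
  define I where "I L = (SIGMA l:{..L}. {-int l..int l})" for L :: nat
  have finI: "finite (I L)" for L by (simp add: I_def)
  define A where "A = (\<lambda>(l, m). a l m)"
  define Y where "Y = (\<lambda>(l, m). sph_harm l m)"
  have Am: "A i \<in> borel_measurable P" and A2: "integrable P (\<lambda>\<omega>. (cmod (A i \<omega>))\<^sup>2)" if "i \<in> I L" for i L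
    using a that by (auto simp: harmonic_coefficients_def A_def I_def split: prod.splits)
  have Aorth: "(\<integral>\<omega>. A i \<omega> * cnj (A j \<omega>) \<partial>P) = (if i = j then complex_of_real (C (fst i)) else 0)"
    if ij: "i \<in> I L" "j \<in> I L" for i j L
  proof (cases "i = j")
    case True
    have "(\<integral>\<omega>. A i \<omega> * cnj (A i \<omega>) \<partial>P) = (\<integral>\<omega>. complex_of_real ((cmod (A i \<omega>))\<^sup>2) \<partial>P)"
      by (simp only: complex_norm_square)
    also have "\<dots> = complex_of_real (\<integral>\<omega>. (cmod (A i \<omega>))\<^sup>2 \<partial>P)" by (rule integral_complex_of_real)
    also have "(\<integral>\<omega>. (cmod (A i \<omega>))\<^sup>2 \<partial>P) = C (fst i)"
      using a ij by (auto simp: harmonic_coefficients_def A_def I_def split: prod.splits)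
    finally show ?thesis using True by simp
  next
    case False
    obtain l m l' m' where lm: "i = (l, m)" "j = (l', m')" by (cases i, cases j) auto
    have "m \<in> {-int l..int l}" "m' \<in> {-int l'..int l'}" "(l, m) \<noteq> (l', m')"
      using ij False by (auto simp: lm I_def)
    then have "(\<integral>\<omega>. a l m \<omega> * cnj (a l' m' \<omega>) \<partial>P) = 0"
      using a unfolding harmonic_coefficients_def by blast
    then show ?thesis unfolding if_not_P[OF False] by (simp add: A_def lm)
  qed
  define S where "S L z \<omega> = (\<Sum>i\<in>I L. A i \<omega> * Y i z)" for L z \<omega>
  have S_eq: "(\<Sum>l\<le>L. \<Sum>m=-int l..int l. a l m \<omega> * sph_harm l m z) = S L z \<omega>" for L z \<omega>
    unfolding S_def I_def A_def Y_def by (subst sum.Sigma) (auto intro!: sum.cong)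
  have Sm: "S L z \<in> borel_measurable P" for L z
    unfolding S_def[abs_def] using Am by (intro borel_measurable_sum borel_measurable_times) auto
  have SS: "S L z \<omega> * cnj (S L z' \<omega>) = (\<Sum>i\<in>I L. \<Sum>j\<in>I L. (Y i z * cnj (Y j z')) * (A i \<omega> * cnj (A j \<omega>)))" for L z z' \<omega>
    unfolding S_def by (simp add: sum_product mult_ac)
  have iAA: "integrable P (\<lambda>\<omega>. A i \<omega> * cnj (A j \<omega>))" if "i \<in> I L" "j \<in> I L" for i j L
    using that by (intro integrable_mult_cnj Am A2)
  have iSS: "integrable P (\<lambda>\<omega>. S L z \<omega> * cnj (S L z' \<omega>))" for L z z'
    unfolding SS using iAA by (intro Bochner_Integration.integrable_sum integrable_mult_right) auto
  have ESS: "(\<integral>\<omega>. S L z \<omega> * cnj (S L z' \<omega>) \<partial>P) = complex_of_real (\<Sum>l\<le>L. C l * zonal l z z')"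
    if z: "z \<in> S2" "z' \<in> S2" for L z z'
  proof -
    have "(\<integral>\<omega>. S L z \<omega> * cnj (S L z' \<omega>) \<partial>P)
        = (\<Sum>i\<in>I L. \<Sum>j\<in>I L. (Y i z * cnj (Y j z')) * (\<integral>\<omega>. A i \<omega> * cnj (A j \<omega>) \<partial>P))"
      unfolding SS using iAA
      by (subst Bochner_Integration.integral_sum)
         (auto intro!: Bochner_Integration.integrable_sum sum.cong simp: Bochner_Integration.integral_sum)
    also have "\<dots> = (\<Sum>i\<in>I L. \<Sum>j\<in>I L. if i = j then Y i z * cnj (Y i z') * complex_of_real (C (fst i)) else 0)"
      using Aorth by (intro sum.cong refl) auto
    also have "\<dots> = (\<Sum>i\<in>I L. Y i z * cnj (Y i z') * complex_of_real (C (fst i)))"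
      using finI by (intro sum.cong refl) (simp add: sum.delta')
    also have "\<dots> = (\<Sum>l\<le>L. \<Sum>m=-int l..int l. sph_harm l m z * cnj (sph_harm l m z') * complex_of_real (C l))"
      unfolding I_def Y_def by (subst sum.Sigma) (auto intro!: sum.cong)
    also have "\<dots> = (\<Sum>l\<le>L. complex_of_real (C l * zonal l z z'))"
      unfolding sum_distrib_right[symmetric] using zonal_sph_harm[OF z] by (intro sum.cong refl) (simp add: mult.commute)
    finally show ?thesis by simp
  qed
  have iS2: "integrable P (\<lambda>\<omega>. (cmod (S L z \<omega>))\<^sup>2)" for L z
  proof -
    have "integrable P (\<lambda>\<omega>. Re (S L z \<omega> * cnj (S L z \<omega>)))" using iSS by (rule integrable_Re)
    then show ?thesis by (simp only: complex_norm_square[symmetric] Re_complex_of_real)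
  qed
  define D where "D L z \<omega> = complex_of_real (T z \<omega>) - S L z \<omega>" for L z \<omega>
  have Dm: "D L z \<in> borel_measurable P" if "z \<in> S2" for L z
    unfolding D_def[abs_def] using Tm[OF that] Sm by measurable
  have sq2: "(cmod (u - w))\<^sup>2 \<le> 2 * (cmod u)\<^sup>2 + 2 * (cmod w)\<^sup>2" for u w
  proof -
    have "(cmod (u - w))\<^sup>2 \<le> (cmod u + cmod w)\<^sup>2" by (intro power_mono norm_triangle_ineq4) auto
    also have "\<dots> \<le> 2 * (cmod u)\<^sup>2 + 2 * (cmod w)\<^sup>2"
      using sum_squares_bound[of "cmod u" "cmod w"] by (simp add: power2_sum)
    finally show ?thesis .
  qed
  have iD2: "integrable P (\<lambda>\<omega>. (cmod (D L z \<omega>))\<^sup>2)" if z: "z \<in> S2" for L z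
  proof (rule Bochner_Integration.integrable_bound)
    show "integrable P (\<lambda>\<omega>. 2 * (T z \<omega>)\<^sup>2 + 2 * (cmod (S L z \<omega>))\<^sup>2)" using T2[OF z] iS2 by simp
    show "(\<lambda>\<omega>. (cmod (D L z \<omega>))\<^sup>2) \<in> borel_measurable P" using Dm[OF z] by measurable
    show "AE \<omega> in P. norm ((cmod (D L z \<omega>))\<^sup>2) \<le> norm (2 * (T z \<omega>)\<^sup>2 + 2 * (cmod (S L z \<omega>))\<^sup>2)"
      using sq2[of "complex_of_real (T z _)" "S L z _"] by (simp add: D_def)
  qed
  define e where "e z L = (\<integral>\<omega>. (cmod (D L z \<omega>))\<^sup>2 \<partial>P)" for z L
  have e0: "e z \<longlonglongrightarrow> 0" if "z \<in> S2" for z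
    using rep that unfolding spectral_representation_def e_def[abs_def] D_def S_eq by auto
  define V where "V z = (\<integral>\<omega>. (T z \<omega>)\<^sup>2 \<partial>P)" for z
  \<comment> \<open>Keeps the second moments of the partial sums bounded in L, so that their product
    with the vanishing error tends to 0.\<close>
  have ES2: "(\<integral>\<omega>. (cmod (S L z \<omega>))\<^sup>2 \<partial>P) \<le> 2 * V z + 2 * e z L" if z: "z \<in> S2" for z L
  proof -
    have "(\<integral>\<omega>. (cmod (S L z \<omega>))\<^sup>2 \<partial>P) \<le> (\<integral>\<omega>. 2 * (T z \<omega>)\<^sup>2 + 2 * (cmod (D L z \<omega>))\<^sup>2 \<partial>P)"
    proof (rule integral_mono[OF iS2])
      show "integrable P (\<lambda>\<omega>. 2 * (T z \<omega>)\<^sup>2 + 2 * (cmod (D L z \<omega>))\<^sup>2)" using T2[OF z] iD2[OF z] by simp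
      fix \<omega>
      show "(cmod (S L z \<omega>))\<^sup>2 \<le> 2 * (T z \<omega>)\<^sup>2 + 2 * (cmod (D L z \<omega>))\<^sup>2"
        using sq2[of "complex_of_real (T z \<omega>)" "D L z \<omega>"] by (simp add: D_def)
    qed
    also have "\<dots> = 2 * V z + 2 * e z L" using T2[OF z] iD2[OF z] by (simp add: V_def e_def)
    finally show ?thesis .
  qed
  have iT: "integrable P (\<lambda>\<omega>. (cmod (complex_of_real (T z \<omega>)))\<^sup>2)" if "z \<in> S2" for z
    using T2[OF that] by simp
  have Tcm: "(\<lambda>\<omega>. complex_of_real (T z \<omega>)) \<in> borel_measurable P" if "z \<in> S2" for z
    using Tm[OF that] by measurable
  define E where "E = (\<integral>\<omega>. T x \<omega> * T y \<omega> \<partial>P)"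
  have bound: "cmod (complex_of_real E - complex_of_real (\<Sum>l\<le>L. C l * zonal l x y))
      \<le> sqrt ((2 * V x + 2 * e x L) * e y L) + sqrt (e x L * V y)" for L
  proof -
    have iTT: "integrable P (\<lambda>\<omega>. complex_of_real (T x \<omega>) * cnj (complex_of_real (T y \<omega>)))"
      by (rule integrable_mult_cnj[OF Tcm[OF x] Tcm[OF y] iT[OF x] iT[OF y]])
    have iSD: "integrable P (\<lambda>\<omega>. S L x \<omega> * cnj (D L y \<omega>))"
      by (rule integrable_mult_cnj[OF Sm Dm[OF y] iS2 iD2[OF y]])
    have iDT: "integrable P (\<lambda>\<omega>. D L x \<omega> * cnj (complex_of_real (T y \<omega>)))"
      by (rule integrable_mult_cnj[OF Dm[OF x] Tcm[OF y] iD2[OF x] iT[OF y]])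
    have "complex_of_real E - complex_of_real (\<Sum>l\<le>L. C l * zonal l x y)
       = (\<integral>\<omega>. complex_of_real (T x \<omega>) * cnj (complex_of_real (T y \<omega>)) \<partial>P) - (\<integral>\<omega>. S L x \<omega> * cnj (S L y \<omega>) \<partial>P)"
      unfolding ESS[OF x y] E_def by (simp flip: integral_complex_of_real)
    also have "\<dots> = (\<integral>\<omega>. complex_of_real (T x \<omega>) * cnj (complex_of_real (T y \<omega>)) - S L x \<omega> * cnj (S L y \<omega>) \<partial>P)"
      by (rule Bochner_Integration.integral_diff[OF iTT iSS, symmetric])
    \<comment> \<open>The difference T T - S cnj(S) is rewritten with one error factor D in each
      term.\<close>
    also have "\<dots> = (\<integral>\<omega>. S L x \<omega> * cnj (D L y \<omega>) + D L x \<omega> * cnj (complex_of_real (T y \<omega>)) \<partial>P)"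
      by (intro Bochner_Integration.integral_cong refl) (simp add: D_def algebra_simps)
    also have "\<dots> = (\<integral>\<omega>. S L x \<omega> * cnj (D L y \<omega>) \<partial>P) + (\<integral>\<omega>. D L x \<omega> * cnj (complex_of_real (T y \<omega>)) \<partial>P)"
      by (rule Bochner_Integration.integral_add[OF iSD iDT])
    finally have "cmod (complex_of_real E - complex_of_real (\<Sum>l\<le>L. C l * zonal l x y))
       \<le> cmod (\<integral>\<omega>. S L x \<omega> * cnj (D L y \<omega>) \<partial>P) + cmod (\<integral>\<omega>. D L x \<omega> * cnj (complex_of_real (T y \<omega>)) \<partial>P)"
      by (simp only: norm_triangle_ineq)
    also have "cmod (\<integral>\<omega>. S L x \<omega> * cnj (D L y \<omega>) \<partial>P) \<le> sqrt ((\<integral>\<omega>. (cmod (S L x \<omega>))\<^sup>2 \<partial>P) * e y L)"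
      unfolding e_def by (rule norm_integral_mult_cnj_le[OF Sm Dm[OF y] iS2 iD2[OF y]])
    also have "\<dots> \<le> sqrt ((2 * V x + 2 * e x L) * e y L)"
      by (intro real_sqrt_le_mono mult_right_mono ES2[OF x]) (auto simp: e_def)
    also have "cmod (\<integral>\<omega>. D L x \<omega> * cnj (complex_of_real (T y \<omega>)) \<partial>P) \<le> sqrt (e x L * V y)"
      using norm_integral_mult_cnj_le[OF Dm[OF x] Tcm[OF y] iD2[OF x] iT[OF y]] by (simp add: e_def V_def)
    finally show ?thesis by simp
  qed
  have "(\<lambda>L. sqrt ((2 * V x + 2 * e x L) * e y L) + sqrt (e x L * V y)) \<longlonglongrightarrow> sqrt ((2 * V x + 2 * 0) * 0) + sqrt (0 * V y)"
    by (intro tendsto_intros e0 x y)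
  then have lim: "(\<lambda>L. sqrt ((2 * V x + 2 * e x L) * e y L) + sqrt (e x L * V y)) \<longlonglongrightarrow> 0" by simp
  have "(\<lambda>L. complex_of_real E - complex_of_real (\<Sum>l\<le>L. C l * zonal l x y)) \<longlonglongrightarrow> 0"
    by (rule Lim_null_comparison[OF always_eventually lim]) (rule allI, rule bound)
  then have "(\<lambda>L. complex_of_real E - (complex_of_real E - complex_of_real (\<Sum>l\<le>L. C l * zonal l x y))) \<longlonglongrightarrow> complex_of_real E - 0"
    by (intro tendsto_diff tendsto_const)
  then have "(\<lambda>L. complex_of_real (\<Sum>l\<le>L. C l * zonal l x y)) \<longlonglongrightarrow> complex_of_real E" by simp
  then have "(\<lambda>L. \<Sum>l\<le>L. C l * zonal l x y) \<longlonglongrightarrow> E" by (simp only: tendsto_of_real_iff)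
  then show ?thesis unfolding E_def sums_def_le .
qed

section \<open>Finite differences and symbol classes\<close>

definition fdiff :: "(nat \<Rightarrow> real) \<Rightarrow> nat \<Rightarrow> real" where
  "fdiff F = (\<lambda>l. F (Suc l) - F l)"

text \<open>The discrete analogue of symbols of order a: each of up to r differences gains one power
  of l + 1. The constant A is a parameter because it depends on the Gaussian scale u and has to be
  followed through every operation. The weight l + 1 stays positive at l = 0.\<close>

definition symb :: "nat \<Rightarrow> real \<Rightarrow> real \<Rightarrow> (nat \<Rightarrow> real) \<Rightarrow> bool" where
  "symb r a A F \<longleftrightarrow> (\<forall>i\<le>r. \<forall>l. \<bar>(fdiff ^^ i) F l\<bar> \<le> A * (real l + 1) powr (a - real i))"

lemma symb_0: "symb 0 a A F \<longleftrightarrow> (\<forall>l. \<bar>F l\<bar> \<le> A * (real l + 1) powr a)"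
  by (simp add: symb_def)

lemma symb_Suc: "symb (Suc r) a A F \<longleftrightarrow> (\<forall>l. \<bar>F l\<bar> \<le> A * (real l + 1) powr a) \<and> symb r (a - 1) A (fdiff F)"
proof -
  have "(\<forall>i\<le>Suc r. Q i) \<longleftrightarrow> Q 0 \<and> (\<forall>i\<le>r. Q (Suc i))" for Q
    by (metis Suc_le_mono le0 not0_implies_Suc)
  then show ?thesis
    unfolding symb_def by (simp add: funpow_Suc_right diff_diff_eq del: funpow.simps)
qed

lemma symb_bound: "symb r a A F \<Longrightarrow> \<bar>F l\<bar> \<le> A * (real l + 1) powr a"
  unfolding symb_def by (metis bot_nat_0.extremum funpow_0 of_nat_0 diff_zero)

lemma symb_const_nonneg: "symb r a A F \<Longrightarrow> A \<ge> 0"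
  using symb_bound[of r a A F 0] by simp

lemma symb_mono:
  assumes "symb r a A F" "A \<le> A'" "r' \<le> r"
  shows "symb r' a A' F"
  unfolding symb_def
proof (intro allI impI)
  fix i l assume "i \<le> r'"
  then have "\<bar>(fdiff ^^ i) F l\<bar> \<le> A * (real l + 1) powr (a - real i)"
    using assms by (auto simp: symb_def)
  also have "\<dots> \<le> A' * (real l + 1) powr (a - real i)" using assms by (intro mult_right_mono) auto
  finally show "\<bar>(fdiff ^^ i) F l\<bar> \<le> A' * (real l + 1) powr (a - real i)" .
qed

lemma symb_fdiff: "symb (Suc r) a A F \<Longrightarrow> symb r (a - 1) A (fdiff F)"
  by (simp add: symb_Suc)

lemma fdiff_add: "fdiff (\<lambda>l. F l + G l) = (\<lambda>l. fdiff F l + fdiff G l)"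
  by (auto simp: fdiff_def)

lemma fdiff_cmult: "fdiff (\<lambda>l. c * F l) = (\<lambda>l. c * fdiff F l)"
  by (auto simp: fdiff_def algebra_simps)

lemma fdiff_mult: "fdiff (\<lambda>l. F l * G l) = (\<lambda>l. fdiff F l * G l + F (Suc l) * fdiff G l)"
  by (auto simp: fdiff_def algebra_simps)

lemma fdiff_shift: "fdiff (\<lambda>l. F (Suc l)) = (\<lambda>l. fdiff F (Suc l))"
  by (auto simp: fdiff_def)

lemma symb_add: "symb r a A F \<Longrightarrow> symb r a B G \<Longrightarrow> symb r a (A + B) (\<lambda>l. F l + G l)"
proof (induction r arbitrary: a F G)
  case 0
  then show ?case unfolding symb_0 distrib_right by (meson abs_triangle_ineq add_mono order_trans)
next
  case (Suc r)
  have "\<bar>F l + G l\<bar> \<le> (A + B) * (real l + 1) powr a" for l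
    using symb_bound[OF Suc.prems(1), of l] symb_bound[OF Suc.prems(2), of l] by (simp add: distrib_right)
  then show ?case using Suc.IH[of "a - 1" "fdiff F" "fdiff G"] Suc.prems
    by (simp add: symb_Suc fdiff_add)
qed

lemma symb_cmult: "symb r a A F \<Longrightarrow> symb r a (\<bar>c\<bar> * A) (\<lambda>l. c * F l)"
proof (induction r arbitrary: a F)
  case 0
  then show ?case unfolding symb_0 abs_mult mult.assoc by (auto intro: mult_left_mono)
next
  case (Suc r)
  then show ?case by (auto simp: symb_Suc fdiff_cmult abs_mult mult.assoc intro!: mult_left_mono)
qed

lemma powr_shift_bound: "(real l + 2) powr a \<le> 2 powr \<bar>a\<bar> * (real l + 1) powr a"
proof (cases "a \<ge> 0")
  case True
  have "(real l + 2) powr a \<le> (2 * (real l + 1)) powr a" using True by (intro powr_mono2) auto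
  also have "\<dots> = 2 powr a * (real l + 1) powr a" by (rule powr_mult)
  finally show ?thesis using True by simp
next
  case False
  have "(real l + 2) powr a \<le> (real l + 1) powr a" using False by (intro powr_mono2') auto
  also have "\<dots> = 1 * (real l + 1) powr a" by simp
  also have "\<dots> \<le> 2 powr \<bar>a\<bar> * (real l + 1) powr a" by (intro mult_right_mono ge_one_powr_ge_zero) auto
  finally show ?thesis .
qed

lemma symb_shift:
  assumes "symb r a A F"
  shows "symb r a (2 powr (\<bar>a\<bar> + real r) * A) (\<lambda>l. F (Suc l))"
  unfolding symb_def
proof (intro allI impI)
  fix i l assume i: "i \<le> r"
  have s: "(fdiff ^^ i) (\<lambda>l. F (Suc l)) = (\<lambda>l. (fdiff ^^ i) F (Suc l))"
    by (induction i) (auto simp: fdiff_shift)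
  have A: "A \<ge> 0" using assms by (rule symb_const_nonneg)
  have "\<bar>(fdiff ^^ i) (\<lambda>l. F (Suc l)) l\<bar> \<le> A * (real (Suc l) + 1) powr (a - real i)"
    unfolding s using assms i by (simp only: symb_def)
  also have "\<dots> = A * (real l + 2) powr (a - real i)" by (simp add: add.commute)
  also have "\<dots> \<le> A * (2 powr \<bar>a - real i\<bar> * (real l + 1) powr (a - real i))"
    using A by (intro mult_left_mono powr_shift_bound)
  also have "\<dots> \<le> A * (2 powr (\<bar>a\<bar> + real r) * (real l + 1) powr (a - real i))"
    using A i by (intro mult_left_mono mult_right_mono powr_mono) auto
  finally show "\<bar>(fdiff ^^ i) (\<lambda>l. F (Suc l)) l\<bar> \<le> 2 powr (\<bar>a\<bar> + real r) * A * (real l + 1) powr (a - real i)"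
    by (simp add: mult_ac)
qed

text \<open>Induction along the discrete Leibniz rule, in which one factor is shifted. The constant
  depends on r, a and b alone, which preserves uniformity in the scale.\<close>

lemma symb_mult:
  "\<exists>c>0. \<forall>F G A B. symb r a A F \<longrightarrow> symb r b B G \<longrightarrow> symb r (a + b) (c * A * B) (\<lambda>l. F l * G l)"
proof (induction r arbitrary: a b)
  have bd: "\<bar>F l * G l\<bar> \<le> A * B * (real l + 1) powr (a + b)"
    if "symb r a A F" "symb r b B G" for r a b A B F G l
  proof -
    have "\<bar>F l * G l\<bar> \<le> (A * (real l + 1) powr a) * (B * (real l + 1) powr b)"
      unfolding abs_mult using symb_bound[OF that(1), of l] symb_bound[OF that(2), of l]
      by (intro mult_mono) auto
    then show ?thesis by (simp add: powr_add mult_ac)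
  qed
  {
    case 0
    show ?case using bd[of 0] by (intro exI[of _ 1]) (simp add: symb_0)
  next
    case (Suc r)
    obtain c1 where c1: "c1 > 0" "\<And>F G A B. symb r (a - 1) A F \<Longrightarrow> symb r b B G \<Longrightarrow> symb r (a - 1 + b) (c1 * A * B) (\<lambda>l. F l * G l)"
      using Suc[of "a - 1" b] by blast
    obtain c2 where c2: "c2 > 0" "\<And>F G A B. symb r a A F \<Longrightarrow> symb r (b - 1) B G \<Longrightarrow> symb r (a + (b - 1)) (c2 * A * B) (\<lambda>l. F l * G l)"
      using Suc[of a "b - 1"] by blast
    define c where "c = 1 + c1 + c2 * 2 powr (\<bar>a\<bar> + real r)"
    have c: "c \<ge> 1" using c1(1) c2(1) by (simp add: c_def)
    show ?case
    proof (intro exI[of _ c] conjI allI impI)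
      show "c > 0" using c by simp
      fix F G A B assume F: "symb (Suc r) a A F" and G: "symb (Suc r) b B G"
      have AB: "A \<ge> 0" "B \<ge> 0" using F G symb_const_nonneg by blast+
      have F': "symb r a A F" and G': "symb r b B G" using F G symb_mono by auto
      have "symb r (a - 1 + b) (c1 * A * B) (\<lambda>l. fdiff F l * G l)"
        by (rule c1(2)[OF symb_fdiff[OF F] G'])
      moreover have "symb r (a + (b - 1)) (c2 * (2 powr (\<bar>a\<bar> + real r) * A) * B) (\<lambda>l. F (Suc l) * fdiff G l)"
        by (rule c2(2)[OF symb_shift[OF F'] symb_fdiff[OF G]])
      ultimately have "symb r (a + b - 1) (c1 * A * B + c2 * (2 powr (\<bar>a\<bar> + real r) * A) * B) (fdiff (\<lambda>l. F l * G l))"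
        unfolding fdiff_mult by (intro symb_add) (simp_all add: algebra_simps)
      moreover have "c1 * A * B + c2 * (2 powr (\<bar>a\<bar> + real r) * A) * B \<le> c * A * B"
        using AB by (simp add: c_def algebra_simps)
      ultimately have "symb r (a + b - 1) (c * A * B) (fdiff (\<lambda>l. F l * G l))" by (rule symb_mono) simp
      moreover have "\<bar>F l * G l\<bar> \<le> c * A * B * (real l + 1) powr (a + b)" for l
      proof -
        have "A * B * (real l + 1) powr (a + b) \<le> c * (A * B * (real l + 1) powr (a + b))"
          using mult_right_mono[OF c, of "A * B * (real l + 1) powr (a + b)"] AB by simp
        then show ?thesis using bd[OF F' G', of l] by (simp add: mult_ac)
      qed
      ultimately show "symb (Suc r) (a + b) (c * A * B) (\<lambda>l. F l * G l)" by (simp add: symb_Suc)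
    qed
  }
qed

lemma fdiff_funpow_bound:
  assumes "\<And>k. k \<le> i \<Longrightarrow> \<bar>F (l + k)\<bar> \<le> A"
  shows "\<bar>(fdiff ^^ i) F l\<bar> \<le> 2 ^ i * A"
  using assms
proof (induction i arbitrary: l)
  case (Suc i)
  have "\<bar>(fdiff ^^ i) F (Suc l)\<bar> \<le> 2 ^ i * A" using Suc.prems[of "Suc _"] by (intro Suc.IH) simp
  moreover have "\<bar>(fdiff ^^ i) F l\<bar> \<le> 2 ^ i * A" using Suc.prems by (intro Suc.IH) simp
  moreover have "(fdiff ^^ Suc i) F l = (fdiff ^^ i) F (Suc l) - (fdiff ^^ i) F l"
    by (simp add: fdiff_def[of "(fdiff ^^ i) F"])
  ultimately show ?case by simp
qed simp

text \<open>For l >= 1 the differences of the shifted sequence are those of F at l - 1. At l = 0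
  truncation repeats the value F 0, and the differences there are bounded crudely by finitely many
  values of F.\<close>

lemma symb_backshift:
  "\<exists>c>0. \<forall>F A. symb r a A F \<longrightarrow> symb r a (c * A) (\<lambda>l. F (l - 1))"
proof -
  define c where "c = 2 ^ r * (real r + 1) powr \<bar>a\<bar> + 2 powr (\<bar>a\<bar> + real r)"
  show ?thesis
  proof (intro exI[of _ c] conjI allI impI)
    show "c > 0" unfolding c_def by (intro add_pos_pos mult_pos_pos) auto
    fix F A assume F: "symb r a A F"
    have A: "A \<ge> 0" using F by (rule symb_const_nonneg)
    show "symb r a (c * A) (\<lambda>l. F (l - 1))"
      unfolding symb_def
    proof (intro allI impI)
      fix i l assume i: "i \<le> r"
      show "\<bar>(fdiff ^^ i) (\<lambda>l. F (l - 1)) l\<bar> \<le> c * A * (real l + 1) powr (a - real i)"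
      proof (cases l)
        case 0
        have "\<bar>F (l + k - 1)\<bar> \<le> A * (real r + 1) powr \<bar>a\<bar>" if "k \<le> i" for k
        proof -
          have "\<bar>F (l + k - 1)\<bar> \<le> A * (real (l + k - 1) + 1) powr a" by (rule symb_bound[OF F])
          also have "\<dots> \<le> A * (real (l + k - 1) + 1) powr \<bar>a\<bar>" using A by (intro mult_left_mono powr_mono) auto
          also have "\<dots> \<le> A * (real r + 1) powr \<bar>a\<bar>" using A 0 that i by (intro mult_left_mono powr_mono2) auto
          finally show ?thesis .
        qed
        then have "\<bar>(fdiff ^^ i) (\<lambda>l. F (l - 1)) l\<bar> \<le> 2 ^ i * (A * (real r + 1) powr \<bar>a\<bar>)"
          by (rule fdiff_funpow_bound)
        also have "\<dots> \<le> 2 ^ r * (A * (real r + 1) powr \<bar>a\<bar>)"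
          using A i by (intro mult_right_mono power_increasing) auto
        also have "\<dots> \<le> c * A" using A by (simp add: c_def algebra_simps)
        finally show ?thesis using 0 by simp
      next
        case (Suc k)
        have s: "(fdiff ^^ i) (\<lambda>l. F (l - 1)) (Suc k) = (fdiff ^^ i) F k" for k
          by (induction i arbitrary: k) (auto simp: fdiff_def)
        have "(real k + 1) powr (a - real i) \<le> 2 powr (\<bar>a\<bar> + real r) * (real k + 2) powr (a - real i)"
        proof -
          have "1 / (real k + 2) powr (a - real i) \<le> 2 powr \<bar>a - real i\<bar> * (1 / (real k + 1) powr (a - real i))"
            using powr_shift_bound[of k "- (a - real i)"] by (simp only: powr_minus_divide abs_minus_cancel)
          then have "(real k + 1) powr (a - real i) \<le> 2 powr \<bar>a - real i\<bar> * (real k + 2) powr (a - real i)"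
            by (simp add: field_simps)
          also have "\<dots> \<le> 2 powr (\<bar>a\<bar> + real r) * (real k + 2) powr (a - real i)"
            using i by (intro mult_right_mono powr_mono) auto
          finally show ?thesis .
        qed
        then have "A * (real k + 1) powr (a - real i) \<le> A * (2 powr (\<bar>a\<bar> + real r) * (real k + 2) powr (a - real i))"
          using A by (rule mult_left_mono)
        also have "\<dots> \<le> A * (c * (real k + 2) powr (a - real i))"
          using A by (intro mult_left_mono mult_right_mono) (auto simp: c_def)
        finally have "A * (real k + 1) powr (a - real i) \<le> c * A * (real l + 1) powr (a - real i)"
          by (simp add: Suc mult_ac add.commute)
        moreover have "\<bar>(fdiff ^^ i) F k\<bar> \<le> A * (real k + 1) powr (a - real i)" using F i by (simp add: symb_def)
        ultimately show ?thesis unfolding Suc s by simp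
      qed
    qed
  qed
qed

text \<open>Finitely many multipoles affect only the constant. That constant depends on F, so the
  lemma serves fixed sequences and not families indexed by the scale.\<close>

lemma symb_eventually:
  assumes "\<And>i l. i \<le> r \<Longrightarrow> l \<ge> l0 \<Longrightarrow> \<bar>(fdiff ^^ i) F l\<bar> \<le> A * (real l + 1) powr (a - real i)"
  shows "\<exists>A'. symb r a A' F"
proof -
  define q where "q i l = \<bar>(fdiff ^^ i) F l\<bar> / (real l + 1) powr (a - real i)" for i l
  define A' where "A' = \<bar>A\<bar> + (\<Sum>i\<le>r. \<Sum>l<l0. q i l)"
  have q0: "q i l \<ge> 0" for i l by (simp add: q_def)
  have "q i l \<le> A'" if "i \<le> r" for i l
  proof (cases "l < l0")
    case True
    have "q i l \<le> (\<Sum>l<l0. q i l)" using True q0 by (intro member_le_sum) auto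
    also have "\<dots> \<le> (\<Sum>i\<le>r. \<Sum>l<l0. q i l)" using that q0 by (intro member_le_sum) (auto intro: sum_nonneg)
    finally show ?thesis by (simp add: A'_def)
  next
    case False
    have "q i l \<le> A" using assms[OF that, of l] False by (simp add: q_def pos_divide_le_eq)
    moreover have "(\<Sum>i\<le>r. \<Sum>l<l0. q i l) \<ge> 0" using q0 by (intro sum_nonneg) auto
    ultimately show ?thesis by (simp add: A'_def)
  qed
  then have "symb r a A' F"
    unfolding symb_def by (simp add: q_def pos_divide_le_eq)
  then show ?thesis ..
qed

lemma symb_Suc_self: "\<exists>A. symb r 1 A (\<lambda>l. real l + c)"
proof (rule symb_eventually)
  fix i l :: nat
  have d: "fdiff (\<lambda>l. real l + c) = (\<lambda>l. 1)" by (auto simp: fdiff_def)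
  have z: "(fdiff ^^ n) (\<lambda>l. 0) = (\<lambda>l. 0)" for n by (induction n) (auto simp: fdiff_def)
  have o: "(fdiff ^^ Suc n) (\<lambda>l. 1) = (\<lambda>l. 0)" for n
    using z[of n] by (simp add: funpow_Suc_right fdiff_def del: funpow.simps)
  consider "i = 0" | "i = 1" | n where "i = Suc (Suc n)" by (metis One_nat_def not0_implies_Suc)
  then show "\<bar>(fdiff ^^ i) (\<lambda>l. real l + c) l\<bar> \<le> (1 + \<bar>c\<bar>) * (real l + 1) powr (1 - real i)"
  proof cases
    case 1
    have "\<bar>c\<bar> * 1 \<le> \<bar>c\<bar> * (real l + 1)" by (intro mult_left_mono) auto
    moreover have "\<bar>real l + c\<bar> \<le> real l + \<bar>c\<bar>" by linarith
    moreover have "(1 + \<bar>c\<bar>) * (real l + 1) = 1 + real l + \<bar>c\<bar> * (real l + 1)" by (simp add: algebra_simps)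
    ultimately have "\<bar>real l + c\<bar> \<le> (1 + \<bar>c\<bar>) * (real l + 1)" by linarith
    then show ?thesis using 1 by simp
  next
    case 2
    then show ?thesis by (simp add: d)
  next
    case 3
    then show ?thesis using o[of n] d by (simp add: funpow_Suc_right del: funpow.simps)
  qed
qed

text \<open>The difference of H(l) = 1/(2l+1) is -2 H(l) H(l+1), so the product rule lifts the claim
  from r to r + 1 differences.\<close>

lemma symb_inverse_odd: "\<exists>A. symb r (-1) A (\<lambda>l. 1 / (2 * real l + 1))"
proof (induction r)
  have bd: "\<bar>1 / (2 * real l + 1)\<bar> \<le> 1 * (real l + 1) powr (-1)" for l
    by (simp add: powr_minus_divide divide_simps)
  {
    case 0
    then show ?case using bd by (auto simp: symb_0 intro!: exI[of _ 1])
  next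
    case (Suc r)
    let ?H = "\<lambda>l. 1 / (2 * real l + 1)"
    obtain A where A: "symb r (-1) A ?H" using Suc by blast
    obtain c where c: "\<And>F G A B. symb r (-1) A F \<Longrightarrow> symb r (-1) B G \<Longrightarrow> symb r (-1 + -1) (c * A * B) (\<lambda>l. F l * G l)"
      using symb_mult[of r "-1" "-1"] by blast
    have "symb r (-2) (c * A * (2 powr (\<bar>-1\<bar> + real r) * A)) (\<lambda>l. ?H l * ?H (Suc l))"
      using c[OF A symb_shift[OF A]] by simp
    from symb_cmult[OF this, of "-2"]
    have "symb r (-2) (\<bar>-2\<bar> * (c * A * (2 powr (\<bar>-1\<bar> + real r) * A))) (\<lambda>l. - 2 * (?H l * ?H (Suc l)))" .
    moreover have "(\<lambda>l. - 2 * (?H l * ?H (Suc l))) = fdiff ?H"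
      by (auto simp: fdiff_def fun_eq_iff divide_simps)
    ultimately obtain A' where A': "symb r (-2) A' (fdiff ?H)" by metis
    have "symb (Suc r) (-1) (max 1 A') ?H"
      unfolding symb_Suc
    proof (intro conjI allI)
      show "symb r (- 1 - 1) (max 1 A') (fdiff ?H)" using symb_mono[OF A', of "max 1 A'" r] by simp
      fix l
      have "1 * (real l + 1) powr (-1) \<le> max 1 A' * (real l + 1) powr (-1)" by (intro mult_right_mono) auto
      then show "\<bar>?H l\<bar> \<le> max 1 A' * (real l + 1) powr (-1)" using bd[of l] by linarith
    qed
    then show ?case ..
  }
qed

text \<open>One difference replaces the family f by its increments over [x, x + 1], whose top
  derivative is bounded by the mean value theorem. Derivatives are taken within the interval, to
  match the one-sided ones of the regularity condition.\<close>

lemma fdiff_mvt: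
  assumes "\<And>i x. i < r \<Longrightarrow> x \<in> {a..b} \<Longrightarrow> (f i has_real_derivative f (Suc i) x) (at x within {a..b})"
    and "\<And>x. x \<in> {a..b} \<Longrightarrow> \<bar>f r x\<bar> \<le> A"
    and "a \<le> real l" "real l + real r \<le> b"
  shows "\<bar>(fdiff ^^ r) (\<lambda>l. f 0 (real l)) l\<bar> \<le> A"
  using assms
proof (induction r arbitrary: f b l)
  case 0
  then show ?case by simp
next
  case (Suc r)
  define g where "g i x = f i (x + 1) - f i x" for i x
  have shift: "(\<lambda>l. g 0 (real l)) = fdiff (\<lambda>l. f 0 (real l))"
    by (auto simp: g_def fdiff_def add.commute)
  have "\<bar>(fdiff ^^ r) (\<lambda>l. g 0 (real l)) l\<bar> \<le> A"
  proof (rule Suc.IH[of "b - 1"])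
    fix i x assume i: "i < r" and x: "x \<in> {a..b-1}"
    have "((\<lambda>x. f i (x + 1)) has_real_derivative f (Suc i) (x + 1)) (at x within {a..b-1})"
    proof -
      have "(f i has_real_derivative f (Suc i) (x + 1)) (at (x + 1) within {a..b})"
        using Suc.prems(1)[of i "x + 1"] i x by auto
      then have "(f i has_real_derivative f (Suc i) (x + 1)) (at (x + 1) within (\<lambda>x. x + 1) ` {a..b-1})"
        by (rule DERIV_subset) auto
      moreover have "((\<lambda>x. x + 1) has_real_derivative 1) (at x within {a..b-1})"
        by (auto intro!: derivative_eq_intros)
      ultimately show ?thesis
        using DERIV_image_chain[of "f i" "f (Suc i) (x + 1)" "\<lambda>x. x + 1" x "{a..b-1}" 1]
        by (simp add: o_def)
    qed
    moreover have "(f i has_real_derivative f (Suc i) x) (at x within {a..b-1})"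
      by (rule DERIV_subset[OF Suc.prems(1)]) (use i x in auto)
    ultimately show "(g i has_real_derivative g (Suc i) x) (at x within {a..b-1})"
      unfolding g_def by (rule DERIV_diff)
  next
    fix x assume x: "x \<in> {a..b-1}"
    have "\<exists>y\<in>{x..x+1}. f r (x + 1) - f r x = f (Suc r) y * (x + 1 - x)"
    proof (rule mvt_very_simple)
      fix y assume "x \<le> y" "y \<le> x + 1"
      then have "(f r has_real_derivative f (Suc r) y) (at y within {x..x+1})"
        using x by (intro DERIV_subset[OF Suc.prems(1)]) auto
      then show "(f r has_derivative (*) (f (Suc r) y)) (at y within {x..x+1})"
        by (simp add: has_field_derivative_def)
    qed simp
    then obtain y where "y \<in> {x..x+1}" "f r (x + 1) - f r x = f (Suc r) y" by auto
    then show "\<bar>g r x\<bar> \<le> A" using Suc.prems(2)[of y] x by (simp add: g_def)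
  next
    show "a \<le> real l" "real l + real r \<le> b - 1" using Suc.prems by auto
  qed
  then show ?case unfolding shift by (simp add: funpow_Suc_right del: funpow.simps)
qed

section \<open>Legendre series\<close>

lemma powr_diff_lower:
  assumes "e \<le> 1" "l \<ge> 1"
  shows "\<bar>e\<bar> * (real l + 1) powr (e - 1) \<le> \<bar>(real l + 1) powr e - real l powr e\<bar>"
proof -
  have "\<exists>z. real l < z \<and> z < real l + 1 \<and> (real l + 1) powr e - real l powr e = (real l + 1 - real l) * (e * z powr (e - 1))"
  proof (rule MVT2)
    fix x assume "real l \<le> x" "x \<le> real l + 1"
    then show "((\<lambda>x. x powr e) has_real_derivative e * x powr (e - 1)) (at x)"
      using assms by (intro has_real_derivative_powr) auto
  qed simp
  then obtain z where z: "real l < z" "z < real l + 1" "(real l + 1) powr e - real l powr e = e * z powr (e - 1)" by auto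
  have "\<bar>e\<bar> * (real l + 1) powr (e - 1) \<le> \<bar>e\<bar> * z powr (e - 1)"
    using z assms by (intro mult_left_mono powr_mono2') auto
  then show ?thesis unfolding z(3) by (simp add: abs_mult)
qed

text \<open>Telescoping against n^b. The factor min 1 b covers both cases: for b < 1 the mean value
  theorem loses a factor b, for b >= 1 nothing is lost.\<close>

lemma powr_sum_head:
  assumes "b > 0"
  shows "(\<Sum>l<n. (real l + 1) powr (b - 1)) \<le> (1 / min 1 b) * real n powr b"
proof (induction n)
  case (Suc n)
  have "min 1 b * (real n + 1) powr (b - 1) \<le> (real n + 1) powr b - real n powr b"
  proof (cases "n = 0")
    case False
    show ?thesis
    proof (cases "b \<ge> 1")
      case True
      have "real n powr b = real n * real n powr (b - 1)" using False by (simp add: powr_mult_base)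
      also have "\<dots> \<le> real n * (real n + 1) powr (b - 1)" using True by (intro mult_left_mono powr_mono2) auto
      finally have "real n powr b \<le> real n * (real n + 1) powr (b - 1)" .
      moreover have "(real n + 1) powr b = (real n + 1) * (real n + 1) powr (b - 1)" by (simp add: powr_mult_base)
      ultimately show ?thesis using True by (simp add: algebra_simps)
    next
      case b: False
      have "real n powr b \<le> (real n + 1) powr b" using assms by (intro powr_mono2) auto
      then show ?thesis using powr_diff_lower[of b n] b False assms by simp
    qed
  qed (use assms in simp)
  then have "(real n + 1) powr (b - 1) \<le> (1 / min 1 b) * ((real n + 1) powr b - real n powr b)"
    using assms by (simp add: field_simps min_def split: if_splits)
  then show ?case using Suc by (simp add: algebra_simps)
qed simp

lemma powr_sum_tail:
  assumes "c > 0" "n \<ge> 1" "n \<le> N"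
  shows "(\<Sum>l=n..<N. (real l + 1) powr (- c - 1)) \<le> (1 / c) * (real n powr (- c) - real N powr (- c))"
  using assms(3)
proof (induction N rule: dec_induct)
  case (step N)
  have "c * (real N + 1) powr (- c - 1) \<le> real N powr (- c) - (real N + 1) powr (- c)"
  proof -
    have "(real N + 1) powr (- c) \<le> real N powr (- c)" using assms step by (intro powr_mono2') auto
    then show ?thesis using powr_diff_lower[of "- c" N] assms step by simp
  qed
  then have "(real N + 1) powr (- c - 1) \<le> (1 / c) * (real N powr (- c) - (real N + 1) powr (- c))"
    using assms by (simp add: field_simps)
  then show ?case using step by (simp add: algebra_simps)
qed simp

text \<open>The sum is cut at l of order u^(-1/2). Below the cut the first bound sums to n^b; above
  it the second, summable because b < 2k, gives u^(-k) n^(b-2k). Both are of order u^(-b/2).\<close>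

lemma weighted_sum_bound:
  fixes k :: nat
  assumes b: "b > 0" and k: "2 * real k > b" and U: "U > 0"
  shows "\<exists>C>0. \<forall>u A H. 0 < u \<longrightarrow> u \<le> U \<longrightarrow> (\<forall>l. \<bar>H l\<bar> \<le> A * (real l + 1) powr (b - 1)) \<longrightarrow>
     (\<forall>l. \<bar>H l\<bar> \<le> A / u ^ k * (real l + 1) powr (b - 1 - 2 * real k)) \<longrightarrow>
     summable (\<lambda>l. \<bar>H l :: real\<bar>) \<and> (\<Sum>l. \<bar>H l\<bar>) \<le> C * A * u powr (- b / 2)"
proof -
  define c where "c = 2 * real k - b"
  have c: "c > 0" using k by (simp add: c_def)
  define C where "C = (1 / min 1 b) * (1 + sqrt U) powr b + 1 / c"
  show ?thesis
  proof (intro exI[of _ C] conjI allI impI)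
    have "1 + sqrt U > 0" using U by (simp add: add_pos_pos)
    then show "C > 0" unfolding C_def using b c by (intro add_pos_pos mult_pos_pos) auto
    fix u A and H :: "nat \<Rightarrow> real"
    assume u: "0 < u" "u \<le> U" and H1: "\<forall>l. \<bar>H l\<bar> \<le> A * (real l + 1) powr (b - 1)"
      and H2: "\<forall>l. \<bar>H l\<bar> \<le> A / u ^ k * (real l + 1) powr (b - 1 - 2 * real k)"
    have A: "A \<ge> 0" using H1[rule_format, of 0] by simp
    define R where "R = 1 / sqrt u"
    define n where "n = nat \<lceil>R\<rceil>"
    have R: "R > 0" using u by (simp add: R_def)
    have n1: "n \<ge> 1" using R by (simp add: n_def le_nat_iff)
    have nR: "R \<le> real n" "real n \<le> R + 1" using R by (auto simp: n_def)
    \<comment> \<open>As u <= U, rounding 1 / sqrt u up to an integer costs only the factor 1 + sqrt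
      U.\<close>
    have "1 \<le> R * sqrt U" using u by (simp add: R_def)
    then have nR': "real n \<le> R * (1 + sqrt U)" using nR by (simp add: distrib_left)
    have R': "R = u powr (- (1 / 2))" using u by (simp add: R_def powr_minus_divide powr_half_sqrt)
    have Rp: "R powr e = u powr (- e / 2)" for e unfolding R' powr_powr by simp
    have "real n powr b \<le> (R * (1 + sqrt U)) powr b" using nR' b by (intro powr_mono2) auto
    also have "\<dots> = u powr (- b / 2) * (1 + sqrt U) powr b" using R U by (simp add: powr_mult Rp)
    finally have h: "real n powr b \<le> u powr (- b / 2) * (1 + sqrt U) powr b" .
    have "real n powr (- c) \<le> R powr (- c)" using nR R c by (intro powr_mono2') auto
    also have "\<dots> = u powr (c / 2)" by (simp add: Rp)
    finally have "1 / u ^ k * real n powr (- c) \<le> 1 / u ^ k * u powr (c / 2)" using u by (intro mult_left_mono) auto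
    also have "c / 2 = real k + - b / 2" by (simp add: c_def field_simps)
    also have "1 / u ^ k * u powr (real k + - b / 2) = u powr (- b / 2)"
      using u unfolding powr_add by (simp add: powr_realpow)
    finally have t: "1 / u ^ k * real n powr (- c) \<le> u powr (- b / 2)" .
    have part: "(\<Sum>l<N. \<bar>H l\<bar>) \<le> C * A * u powr (- b / 2)" for N
    proof -
      have "(\<Sum>l<N. \<bar>H l\<bar>) \<le> (\<Sum>l<n + N. \<bar>H l\<bar>)" by (intro sum_mono2) auto
      also have "\<dots> = (\<Sum>l<n. \<bar>H l\<bar>) + (\<Sum>l=n..<n+N. \<bar>H l\<bar>)"
        by (simp add: lessThan_atLeast0 sum.atLeastLessThan_concat)
      also have "(\<Sum>l<n. \<bar>H l\<bar>) \<le> (\<Sum>l<n. A * (real l + 1) powr (b - 1))" using H1 by (intro sum_mono) auto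
      also have "\<dots> \<le> A * ((1 / min 1 b) * real n powr b)"
        unfolding sum_distrib_left[symmetric] using A powr_sum_head[OF b] by (intro mult_left_mono) auto
      also have "\<dots> \<le> A * ((1 / min 1 b) * (u powr (- b / 2) * (1 + sqrt U) powr b))"
        using A b h by (intro mult_left_mono) auto
      also have "(\<Sum>l=n..<n+N. \<bar>H l\<bar>) \<le> (\<Sum>l=n..<n+N. A / u ^ k * (real l + 1) powr (- c - 1))"
        using H2 by (intro sum_mono) (auto simp: c_def algebra_simps)
      also have "\<dots> \<le> A / u ^ k * ((1 / c) * (real n powr (- c) - real (n + N) powr (- c)))"
        unfolding sum_distrib_left[symmetric] using A u powr_sum_tail[OF c n1, of "n + N"] by (intro mult_left_mono) auto
      also have "\<dots> \<le> A / u ^ k * ((1 / c) * real n powr (- c))"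
        using A u c by (intro mult_left_mono) auto
      also have "\<dots> = A * (1 / c) * (1 / u ^ k * real n powr (- c))" by simp
      also have "\<dots> \<le> A * (1 / c) * u powr (- b / 2)"
        using A c t by (intro mult_left_mono) auto
      finally show ?thesis by (simp add: C_def algebra_simps)
    qed
    show s: "summable (\<lambda>l. \<bar>H l\<bar>)" by (rule summableI_nonneg_bounded[OF _ part]) auto
    show "(\<Sum>l. \<bar>H l\<bar>) \<le> C * A * u powr (- b / 2)" by (rule suminf_le_const[OF s part])
  qed
qed

text \<open>The coefficients of (1 - x) times a Legendre series with weights 2l + 1, as dictated by
  the three-term recurrence. The difference at l - 1 carries the factor l, so truncation at l = 0 is
  harmless.\<close>

definition lap :: "(nat \<Rightarrow> real) \<Rightarrow> nat \<Rightarrow> real" where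
  "lap F = (\<lambda>l. (real l * fdiff F (l - 1) - (real l + 1) * fdiff F l) / (2 * real l + 1))"

text \<open>The defining formula shows first differences with factors of order 0 and suggests a gain
  of one order. Written with a second difference, and a first difference divided by 2l + 1, it gains
  two. The summand 0 matches the pattern of \<open>symb_Suc_self\<close>.\<close>

lemma lap_eq:
  "lap F = (\<lambda>l. - 1 * ((real l + 0) * (1 / (2 * real l + 1)) * fdiff (fdiff F) (l - 1)
                  + 1 / (2 * real l + 1) * fdiff F l))"
proof
  fix l
  show "lap F l = - 1 * ((real l + 0) * (1 / (2 * real l + 1)) * fdiff (fdiff F) (l - 1)
                  + 1 / (2 * real l + 1) * fdiff F l)"
  proof (cases l)
    case 0
    then show ?thesis by (simp add: lap_def)
  next
    case (Suc k)
    have "- 1 * ((real l + 0) * (1 / d) * (y - x) + 1 / d * y) = (real l * x - (real l + 1) * y) / d" for x y d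
      by (simp add: divide_inverse algebra_simps)
    moreover have "fdiff (fdiff F) (l - 1) = fdiff F l - fdiff F (l - 1)" using Suc by (simp add: fdiff_def)
    ultimately show ?thesis by (simp only: lap_def)
  qed
qed

lemma symb_lap: "\<exists>c>0. \<forall>F A. symb (r + 2) a A F \<longrightarrow> symb r (a - 2) (c * A) (lap F)"
proof -
  obtain A1 where A1: "symb r 1 A1 (\<lambda>l. real l + 0)" using symb_Suc_self by blast
  obtain A2 where A2: "symb r (-1) A2 (\<lambda>l. 1 / (2 * real l + 1))" using symb_inverse_odd by blast
  obtain c1 where c1: "c1 > 0" "\<And>F G A B. symb r 1 A F \<Longrightarrow> symb r (-1) B G \<Longrightarrow> symb r (1 + -1) (c1 * A * B) (\<lambda>l. F l * G l)"
    using symb_mult[of r 1 "-1"] by blast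
  obtain c2 where c2: "c2 > 0" "\<And>F G A B. symb r 0 A F \<Longrightarrow> symb r (a - 2) B G \<Longrightarrow> symb r (0 + (a - 2)) (c2 * A * B) (\<lambda>l. F l * G l)"
    using symb_mult[of r 0 "a - 2"] by blast
  obtain c3 where c3: "c3 > 0" "\<And>F A. symb r (a - 2) A F \<Longrightarrow> symb r (a - 2) (c3 * A) (\<lambda>l. F (l - 1))"
    using symb_backshift[of r "a - 2"] by blast
  obtain c4 where c4: "c4 > 0" "\<And>F G A B. symb r (-1) A F \<Longrightarrow> symb r (a - 1) B G \<Longrightarrow> symb r (-1 + (a - 1)) (c4 * A * B) (\<lambda>l. F l * G l)"
    using symb_mult[of r "-1" "a - 1"] by blast
  have A12: "A1 \<ge> 0" "A2 \<ge> 0" using A1 A2 symb_const_nonneg by blast+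
  define c where "c = 1 + (c2 * (c1 * A1 * A2) * c3 + c4 * A2)"
  have "c > 0" unfolding c_def using A12 c1(1) c2(1) c3(1) c4(1) by (intro add_pos_nonneg) auto
  moreover have "symb r (a - 2) (c * A) (lap F)" if F: "symb (r + 2) a A F" for F A
  proof -
    have A: "A \<ge> 0" using F by (rule symb_const_nonneg)
    have F2: "symb (Suc (Suc r)) a A F" using F by (simp add: numeral_2_eq_2)
    have d1: "symb r (a - 1) A (fdiff F)" using symb_mono[OF symb_fdiff[OF F2], of A r] by simp
    have d2: "symb r (a - 2) A (fdiff (fdiff F))" using symb_fdiff[OF symb_fdiff[OF F2]] by simp
    have "symb r (a - 2) (c2 * (c1 * A1 * A2) * (c3 * A))
        (\<lambda>l. (real l + 0) * (1 / (2 * real l + 1)) * fdiff (fdiff F) (l - 1))"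
      using c2(2)[OF c1(2)[OF A1 A2, simplified] c3(2)[OF d2]] by simp
    moreover have "symb r (a - 2) (c4 * A2 * A) (\<lambda>l. 1 / (2 * real l + 1) * fdiff F l)"
      using c4(2)[OF A2 d1] by simp
    ultimately have "symb r (a - 2) (c2 * (c1 * A1 * A2) * (c3 * A) + c4 * A2 * A) (\<lambda>l. (real l + 0) * (1 / (2 * real l + 1)) * fdiff (fdiff F) (l - 1)
         + 1 / (2 * real l + 1) * fdiff F l)" by (rule symb_add)
    from symb_cmult[OF this, of "-1"]
    have "symb r (a - 2) (\<bar>-1\<bar> * (c2 * (c1 * A1 * A2) * (c3 * A) + c4 * A2 * A)) (lap F)" unfolding lap_eq .
    moreover have "\<bar>-1\<bar> * (c2 * (c1 * A1 * A2) * (c3 * A) + c4 * A2 * A) \<le> c * A"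
      using A by (simp add: c_def algebra_simps)
    ultimately show ?thesis by (rule symb_mono) simp
  qed
  ultimately show ?thesis by blast
qed

lemma symb_lap_power: "\<exists>c>0. \<forall>F A. symb (r + 2 * n) a A F \<longrightarrow> symb r (a - 2 * real n) (c * A) ((lap ^^ n) F)"
proof (induction n arbitrary: a)
  case 0
  then show ?case by (intro exI[of _ 1]) simp
next
  case (Suc n)
  obtain c1 where c1: "c1 > 0" "\<And>F A. symb (r + 2 * n) (a - 2) A F \<Longrightarrow> symb r (a - 2 - 2 * real n) (c1 * A) ((lap ^^ n) F)"
    using Suc[of "a - 2"] by blast
  obtain c2 where c2: "c2 > 0" "\<And>F A. symb (r + 2 * n + 2) a A F \<Longrightarrow> symb (r + 2 * n) (a - 2) (c2 * A) (lap F)"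
    using symb_lap[of "r + 2 * n" a] by blast
  show ?case
  proof (intro exI[of _ "c1 * c2"] conjI allI impI)
    show "c1 * c2 > 0" using c1 c2 by simp
    fix F A assume "symb (r + 2 * Suc n) a A F"
    then have "symb (r + 2 * n + 2) a A F" by (simp add: numeral_2_eq_2)
    from c1(2)[OF c2(2)[OF this]]
    show "symb r (a - 2 * real (Suc n)) (c1 * c2 * A) ((lap ^^ Suc n) F)"
      by (simp add: funpow_Suc_right algebra_simps del: funpow.simps)
  qed
qed

definition legsum :: "(nat \<Rightarrow> real) \<Rightarrow> real \<Rightarrow> real" where
  "legsum F x = (\<Sum>l. (2 * real l + 1) * F l * leg 0 l x)"

lemma summable_powr_shift: "e < -1 \<Longrightarrow> summable (\<lambda>l. (real l + 1) powr e)"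
  using summable_Suc_iff[of "\<lambda>n. real n powr e"] by (simp add: summable_real_powr_iff add.commute)

lemma legsum_summable:
  assumes "symb r a A F" "a < -2" "\<bar>x\<bar> \<le> 1"
  shows "summable (\<lambda>l. (2 * real l + 1) * F l * leg 0 l x)"
proof (rule summable_comparison_test)
  show "summable (\<lambda>l. 2 * A * (real l + 1) powr (a + 1))"
    using assms by (intro summable_mult summable_powr_shift) simp
  have "\<bar>(2 * real l + 1) * F l * leg 0 l x\<bar> \<le> 2 * A * (real l + 1) powr (a + 1)" for l
  proof -
    have "\<bar>(2 * real l + 1) * F l * leg 0 l x\<bar> \<le> (2 * (real l + 1)) * (A * (real l + 1) powr a) * 1"
      unfolding abs_mult using symb_bound[OF assms(1), of l] legendre_abs_le_1[OF assms(3), of l]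
      by (intro mult_mono) auto
    also have "\<dots> = 2 * A * (real l + 1) powr (a + 1)" by (simp add: powr_add)
    finally show ?thesis .
  qed
  then show "\<exists>N. \<forall>l\<ge>N. norm ((2 * real l + 1) * F l * leg 0 l x) \<le> 2 * A * (real l + 1) powr (a + 1)" by simp
qed

lemma symb_tendsto_0:
  assumes "symb r a A F" "a < -1" "\<And>l. \<bar>P l\<bar> \<le> K"
  shows "(\<lambda>l. real l * F (l - 1) * P l) \<longlonglongrightarrow> 0"
proof (rule LIMSEQ_imp_Suc)
  have K: "K \<ge> 0" using assms(3)[of 0] by linarith
  have lim: "(\<lambda>l. A * K * real (Suc l) powr (a + 1)) \<longlonglongrightarrow> A * K * 0"
    using assms(2) by (intro tendsto_intros LIMSEQ_Suc[of "\<lambda>n. real n powr (a + 1)"] tendsto_neg_powr filterlim_real_sequentially) simp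
  have le: "norm (real (Suc l) * F (Suc l - 1) * P (Suc l)) \<le> A * K * real (Suc l) powr (a + 1)" for l
  proof -
    have "norm (real (Suc l) * F (Suc l - 1) * P (Suc l)) \<le> real (Suc l) * (A * (real l + 1) powr a) * K"
      unfolding real_norm_def abs_mult using symb_bound[OF assms(1), of l] assms(3)[of "Suc l"] K
      by (intro mult_mono) auto
    also have "\<dots> = A * K * real (Suc l) powr (a + 1)" by (simp add: powr_add add.commute)
    finally show ?thesis .
  qed
  show "(\<lambda>l. real (Suc l) * F (Suc l - 1) * P (Suc l)) \<longlonglongrightarrow> 0"
    by (rule Lim_null_comparison[OF always_eventually lim[unfolded mult_zero_right]]) (rule allI, rule le)
qed

text \<open>By the recurrence (2l+1)(1-x) P_l = (l+1)(P_l - P_(l+1)) - l (P_(l-1) - P_l), and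
  summation by parts moves the outer difference onto F. This is half of the action of
  \<open>lap\<close>, used alone when the number of differences is odd.\<close>

lemma legsum_parts:
  assumes "symb 1 a A F" "a < -2" "\<bar>x\<bar> \<le> 1"
  shows "(\<lambda>l. - (fdiff F l * (real l + 1) * (leg 0 l x - leg 0 (Suc l) x))) sums ((1 - x) * legsum F x)"
proof -
  define Q where "Q l = leg 0 (l - 1) x - leg 0 l x" for l
  \<comment> \<open>The boundary term of the summation by parts; it tends to 0 because F has order
    below -2.\<close>
  define T where "T l = real l * F l * Q l" for l
  have A: "A \<ge> 0" using assms(1) by (rule symb_const_nonneg)
  have Qb: "\<bar>Q l\<bar> \<le> 2" for l
    using legendre_abs_le_1[OF assms(3), of l] legendre_abs_le_1[OF assms(3), of "l - 1"] by (simp add: Q_def)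
  have "symb 1 a (2 powr (\<bar>a\<bar> + real 1) * A) (\<lambda>l. F (Suc l))" by (rule symb_shift[OF assms(1)])
  from symb_tendsto_0[OF this, of Q 2] have "(\<lambda>l. real l * F (Suc (l - 1)) * Q l) \<longlonglongrightarrow> 0"
    using assms(2) Qb by simp
  moreover have "real l * F (Suc (l - 1)) * Q l = T l" for l by (cases l) (simp_all add: T_def)
  ultimately have "T \<longlonglongrightarrow> 0" by simp
  from telescope_sums[OF this] have T: "(\<lambda>l. T (Suc l) - T l) sums 0" by (simp add: T_def)
  have "(\<lambda>l. (1 - x) * ((2 * real l + 1) * F l * leg 0 l x)) sums ((1 - x) * legsum F x)"
    unfolding legsum_def using legsum_summable[OF assms] by (intro sums_mult summable_sums)
  from sums_diff[OF this T]
  have "(\<lambda>l. (1 - x) * ((2 * real l + 1) * F l * leg 0 l x) - (T (Suc l) - T l)) sums ((1 - x) * legsum F x)" by simp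
  moreover have "(1 - x) * ((2 * real l + 1) * F l * leg 0 l x) - (T (Suc l) - T l)
     = - (fdiff F l * (real l + 1) * (leg 0 l x - leg 0 (Suc l) x))" for l
  proof -
    have r: "(2 * real l + 1) * x * leg 0 l x = (real l + 1) * leg 0 (Suc l) x + real l * leg 0 (l - 1) x"
      by (rule legendre_recurrence)
    show ?thesis unfolding T_def Q_def fdiff_def diff_Suc_1 of_nat_Suc using r by algebra
  qed
  ultimately show ?thesis by simp
qed

text \<open>A second summation by parts, applied to \<open>legsum_parts\<close>, moves the remaining
  difference of Legendre polynomials onto the coefficients.\<close>

lemma legsum_lap:
  assumes "symb 2 a A F" "a < -2" "\<bar>x\<bar> \<le> 1"
  shows "(1 - x) * legsum F x = legsum (lap F) x"
proof -
  have F1: "symb 1 a A F" using symb_mono[OF assms(1)] by simp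
  have F2: "symb (Suc (Suc 0)) a A F" using assms(1) by (simp add: numeral_2_eq_2)
  define S where "S l = real l * fdiff F (l - 1) * leg 0 l x" for l
  have "S \<longlonglongrightarrow> 0"
    unfolding S_def using symb_tendsto_0[OF symb_fdiff[OF F2], of "\<lambda>l. leg 0 l x" 1] legendre_abs_le_1[OF assms(3)] assms(2)
    by simp
  from telescope_sums[OF this] have S: "(\<lambda>l. S (Suc l) - S l) sums 0" by (simp add: S_def)
  from sums_diff[OF legsum_parts[OF F1 assms(2,3)] S]
  have "(\<lambda>l. - (fdiff F l * (real l + 1) * (leg 0 l x - leg 0 (Suc l) x)) - (S (Suc l) - S l)) sums ((1 - x) * legsum F x)"
    by simp
  moreover have "- (fdiff F l * (real l + 1) * (leg 0 l x - leg 0 (Suc l) x)) - (S (Suc l) - S l) = (2 * real l + 1) * lap F l * leg 0 l x" for l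
  proof -
    have "(2 * real l + 1) * lap F l = real l * fdiff F (l - 1) - (real l + 1) * fdiff F l"
      by (simp add: lap_def)
    then show ?thesis unfolding S_def diff_Suc_1 of_nat_Suc by algebra
  qed
  ultimately show ?thesis by (simp add: legsum_def sums_iff)
qed

lemma legsum_lap_power:
  assumes "symb (2 * n) a A F" "a < -2" "\<bar>x\<bar> \<le> 1"
  shows "(1 - x) ^ n * legsum F x = legsum ((lap ^^ n) F) x"
  using assms(1,2)
proof (induction n arbitrary: F a A)
  case (Suc n)
  obtain c where "symb (2 * n + 2) a A F \<Longrightarrow> symb (2 * n) (a - 2) (c * A) (lap F)"
    using symb_lap[of "2 * n" a] by blast
  then have "symb (2 * n) (a - 2) (c * A) (lap F)" using Suc.prems by simp
  then have "(1 - x) ^ n * legsum (lap F) x = legsum ((lap ^^ n) (lap F)) x" using Suc by auto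
  moreover have "(1 - x) * legsum F x = legsum (lap F) x"
    using Suc.prems assms(3) by (intro legsum_lap[of a A]) (auto intro: symb_mono)
  ultimately have "(1 - x) ^ n * ((1 - x) * legsum F x) = legsum ((lap ^^ n) (lap F)) x" by simp
  then show ?case by (simp add: funpow_Suc_right mult_ac del: funpow.simps)
qed simp

lemma sqrt_step_bound:
  assumes "\<bar>x\<bar> \<le> 1"
  shows "(1 - x) + sqrt (1 - x\<^sup>2) \<le> 4 * sqrt (1 - x)"
proof -
  have "sqrt (1 - x\<^sup>2) = sqrt (1 - x) * sqrt (1 + x)"
    unfolding real_sqrt_mult[symmetric] by (simp add: algebra_simps power2_eq_square)
  moreover have "1 - x = sqrt (1 - x) * sqrt (1 - x)" using assms by simp
  moreover have "sqrt (1 - x) \<le> 2" "sqrt (1 + x) \<le> 2" using assms by (auto intro!: real_le_lsqrt)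
  then have "sqrt (1 - x) * sqrt (1 - x) \<le> sqrt (1 - x) * 2" "sqrt (1 - x) * sqrt (1 + x) \<le> sqrt (1 - x) * 2"
    using assms by (auto intro: mult_left_mono simp del: real_sqrt_mult_self)
  ultimately show ?thesis by linarith
qed

text \<open>Each application of \<^const>\<open>lap\<close> trades a factor \<open>1 - x\<close> for two orders of decay of the
  coefficients; an odd number of orders is handled by one summation by parts.\<close>

theorem legsum_decay:
  fixes m k :: nat
  assumes am: "a + 2 - real m > 0" and ka: "2 * real k > a + 2" and U: "U > 0"
  shows "\<exists>C>0. \<forall>u A F x. 0 < u \<longrightarrow> u \<le> U \<longrightarrow> symb m a A F \<longrightarrow> symb m (a - 2 * real k) (A / u ^ k) F \<longrightarrow>
     \<bar>x\<bar> \<le> 1 \<longrightarrow> sqrt (1 - x) ^ m * \<bar>legsum F x\<bar> \<le> C * A * u powr (- (a + 2 - real m) / 2)"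
proof -
  define n e where "n = m div 2" and "e = m mod 2"
  have m: "m = e + 2 * n" and e: "e = 0 \<or> e = 1" by (auto simp: n_def e_def)
  define b where "b = a + 2 - real m"
  have b: "b > 0" "2 * real k > b" using am ka by (auto simp: b_def)
  obtain c1 where c1: "c1 > 0" "\<And>F A. symb m a A F \<Longrightarrow> symb e (a - 2 * real n) (c1 * A) ((lap ^^ n) F)"
    using symb_lap_power[of e n a] unfolding m by blast
  obtain c2 where c2: "c2 > 0" "\<And>F A. symb m (a - 2 * real k) A F \<Longrightarrow> symb e (a - 2 * real k - 2 * real n) (c2 * A) ((lap ^^ n) F)"
    using symb_lap_power[of e n "a - 2 * real k"] unfolding m by blast
  define c where "c = c1 + c2"
  obtain C where C: "C > 0" "\<And>u A H. 0 < u \<Longrightarrow> u \<le> U \<Longrightarrow> (\<And>l. \<bar>H l\<bar> \<le> A * (real l + 1) powr (b - 1)) \<Longrightarrow>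
     (\<And>l. \<bar>H l\<bar> \<le> A / u ^ k * (real l + 1) powr (b - 1 - 2 * real k)) \<Longrightarrow>
     summable (\<lambda>l. \<bar>H l :: real\<bar>) \<and> (\<Sum>l. \<bar>H l\<bar>) \<le> C * A * u powr (- b / 2)"
    using weighted_sum_bound[OF b U] by blast
  show ?thesis
  proof (intro exI[of _ "C * (8 * c)"] conjI allI impI)
    show "C * (8 * c) > 0" using C c1 c2 by (simp add: c_def)
    fix u A F x
    assume u: "0 < u" "u \<le> U" and F: "symb m a A F" "symb m (a - 2 * real k) (A / u ^ k) F" and x: "\<bar>x\<bar> \<le> (1::real)"
    have A: "A \<ge> 0" using F(1) by (rule symb_const_nonneg)
    define G where "G = (lap ^^ n) F"
    have G1: "symb e (a - 2 * real n) (c * A) G" unfolding G_def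
      by (rule symb_mono[OF c1(2)[OF F(1)]]) (use A c2 in \<open>auto simp: c_def intro!: mult_right_mono\<close>)
    have G2: "symb e (a - 2 * real k - 2 * real n) (c * A / u ^ k) G" unfolding G_def
      by (rule symb_mono[OF c2(2)[OF F(2)]]) (use A c1 u in \<open>auto simp: c_def intro!: mult_right_mono divide_right_mono\<close>)
    \<comment> \<open>Here a > -2, so the class of order a gives no convergence. Convergence and
      vanishing boundary terms rest on the class of order a - 2k, which is below -2 whatever the
      size of its constant.\<close>
    have F2n: "symb (2 * n) (a - 2 * real k) (A / u ^ k) F"
      by (rule symb_mono[OF F(2)]) (auto simp: m)
    have lapF: "(1 - x) ^ n * legsum F x = legsum G x"
      unfolding G_def using F2n x ka by (intro legsum_lap_power) auto
    have sq: "sqrt (1 - x) ^ (2 * n) = (1 - x) ^ n" using x by (simp add: power_mult)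
    \<comment> \<open>The sequence whose absolute sum bounds the left-hand side: weighted
      coefficients for even m, and for odd m those after one more summation by parts, with 4 taken
      from \<open>sqrt_step_bound\<close>.\<close>
    define H where "H l = (if e = 0 then (2 * real l + 1) * G l else 4 * (real l + 1) * fdiff G l)" for l
    \<comment> \<open>Stated for a general order a' so that it serves both classes, those of order a
      and a - 2k.\<close>
    have Hb: "\<bar>H l\<bar> \<le> (8 * (c * A')) * (real l + 1) powr (a' + 1 - real m)"
      if G: "symb e (a' - 2 * real n) (c * A') G" and A': "A' \<ge> 0" for l a' A'
    proof -
      have cA: "c * A' \<ge> 0" using G by (rule symb_const_nonneg)
      from e show ?thesis
      proof
        assume e0: "e = 0"
        have "\<bar>H l\<bar> \<le> (8 * (real l + 1)) * (c * A' * (real l + 1) powr (a' - 2 * real n))"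
          unfolding H_def e0 simp_thms if_True abs_mult using symb_bound[OF G, of l] by (intro mult_mono) auto
        also have "\<dots> = (8 * (c * A')) * ((real l + 1) powr 1 * (real l + 1) powr (a' - 2 * real n))" by simp
        also have "\<dots> = (8 * (c * A')) * (real l + 1) powr (a' + 1 - real m)"
          unfolding powr_add[symmetric] by (simp add: m e0 algebra_simps)
        finally show ?thesis .
      next
        assume e1: "e = 1"
        have "symb 0 (a' - 2 * real n - 1) (c * A') (fdiff G)" using symb_fdiff[of 0] G e1 by simp
        from symb_bound[OF this, of l]
        have "\<bar>H l\<bar> \<le> (8 * (real l + 1)) * (c * A' * (real l + 1) powr (a' - 2 * real n - 1))"
          using cA by (auto simp: H_def e1 abs_mult intro!: mult_mono)
        also have "\<dots> = (8 * (c * A')) * ((real l + 1) powr 1 * (real l + 1) powr (a' - 2 * real n - 1))" by simp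
        also have "\<dots> = (8 * (c * A')) * (real l + 1) powr (a' + 1 - real m)"
          unfolding powr_add[symmetric] by (simp add: m e1)
        finally show ?thesis .
      qed
    qed
    have H1: "\<bar>H l\<bar> \<le> (8 * (c * A)) * (real l + 1) powr (b - 1)" for l
      using Hb[OF G1 A, of l] by (simp add: b_def algebra_simps)
    have H2: "\<bar>H l\<bar> \<le> (8 * (c * A)) / u ^ k * (real l + 1) powr (b - 1 - 2 * real k)" for l
      using Hb[of "a - 2 * real k" "A / u ^ k" l] G2 A u by (simp add: b_def algebra_simps)
    have Hs: "summable (\<lambda>l. \<bar>H l\<bar>)" "(\<Sum>l. \<bar>H l\<bar>) \<le> C * (8 * (c * A)) * u powr (- b / 2)"
      using C(2)[OF u, of H "8 * (c * A)"] H1 H2 by auto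
    have "sqrt (1 - x) ^ m * \<bar>legsum F x\<bar> \<le> (\<Sum>l. \<bar>H l\<bar>)"
    proof -
      have *: "sqrt (1 - x) ^ m * \<bar>legsum F x\<bar> = sqrt (1 - x) ^ e * \<bar>legsum G x\<bar>"
        unfolding lapF[symmetric] m power_add sq using x by (simp add: abs_mult)
      from e show ?thesis
      proof
        assume e0: "e = 0"
        have le: "norm ((2 * real l + 1) * G l * leg 0 l x) \<le> \<bar>H l\<bar>" for l
          using mult_left_mono[OF legendre_abs_le_1[OF x, of l], of "\<bar>H l\<bar>"] by (simp add: H_def e0 abs_mult mult_ac)
        have "norm (legsum G x) \<le> (\<Sum>l. \<bar>H l\<bar>)" unfolding legsum_def
          by (rule norm_suminf_le[OF le Hs(1)])
        then show ?thesis unfolding * e0 by simp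
      next
        assume e1: "e = 1"
        show ?thesis
        proof (cases "x = 1")
          case True
          then show ?thesis unfolding * e1 using Hs by (simp add: suminf_nonneg)
        next
          case False
          then have sx: "sqrt (1 - x) > 0" using x by auto
          have sm: "(\<lambda>l. - (fdiff G l * (real l + 1) * (leg 0 l x - leg 0 (Suc l) x))) sums ((1 - x) * legsum G x)"
            using G2 ka x unfolding e1 by (intro legsum_parts) auto
          have le: "norm (- (fdiff G l * (real l + 1) * (leg 0 l x - leg 0 (Suc l) x))) \<le> sqrt (1 - x) * \<bar>H l\<bar>" for l
          proof -
            have "norm (- (fdiff G l * (real l + 1) * (leg 0 l x - leg 0 (Suc l) x)))
               = \<bar>fdiff G l\<bar> * (real l + 1) * \<bar>leg 0 l x - leg 0 (Suc l) x\<bar>" by (simp add: abs_mult)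
            also have "\<dots> \<le> \<bar>fdiff G l\<bar> * (real l + 1) * (4 * sqrt (1 - x))"
              using legendre_diff_bound[OF x, of l] sqrt_step_bound[OF x] by (intro mult_left_mono) auto
            finally show ?thesis by (simp add: H_def e1 abs_mult mult_ac)
          qed
          have "norm ((1 - x) * legsum G x) \<le> (\<Sum>l. sqrt (1 - x) * \<bar>H l\<bar>)"
            unfolding sums_unique[OF sm] by (rule norm_suminf_le[OF le summable_mult[OF Hs(1)]])
          also have "\<dots> = sqrt (1 - x) * (\<Sum>l. \<bar>H l\<bar>)" by (rule suminf_mult[OF Hs(1)])
          \<comment> \<open>One factor sqrt(1 - x) was spent on the differences of Legendre
            polynomials; the other remains as the gain.\<close>
          also have "norm ((1 - x) * legsum G x) = sqrt (1 - x) * (sqrt (1 - x) * \<bar>legsum G x\<bar>)"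
            using x by (simp add: abs_mult flip: mult.assoc)
          finally show ?thesis unfolding * e1 using sx by (simp only: mult_le_cancel_left_pos power_one_right)
        qed
      qed
    qed
    also have "\<dots> \<le> C * (8 * (c * A)) * u powr (- b / 2)" by (rule Hs)
    finally show "sqrt (1 - x) ^ m * \<bar>legsum F x\<bar> \<le> C * (8 * c) * A * u powr (- (a + 2 - real m) / 2)"
      by (simp add: b_def mult_ac)
  qed
qed

text \<open>The derivatives of \<open>E x = exp (- x (x + 1) u)\<close>, by Leibniz' rule applied to
  \<open>E' x = - u (2 x + 1) E x\<close>.\<close>

fun gauss_deriv :: "real \<Rightarrow> nat \<Rightarrow> real \<Rightarrow> real" where
  "gauss_deriv u 0 x = exp (- (x * (x + 1) * u))"
| "gauss_deriv u (Suc 0) x = - u * ((2 * x + 1) * gauss_deriv u 0 x)"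
| "gauss_deriv u (Suc (Suc i)) x = - u * ((2 * x + 1) * gauss_deriv u (Suc i) x + 2 * real (Suc i) * gauss_deriv u i x)"

lemma gauss_deriv: "(gauss_deriv u i has_real_derivative gauss_deriv u (Suc i) x) (at x)"
proof (induction i rule: less_induct)
  case (less i)
  have g0: "(gauss_deriv u 0 has_real_derivative gauss_deriv u (Suc 0) x) (at x)"
    unfolding gauss_deriv.simps(1)[abs_def] by (auto intro!: derivative_eq_intros simp: algebra_simps)
  consider "i = 0" | "i = 1" | j where "i = Suc (Suc j)" by (metis One_nat_def not0_implies_Suc)
  then show ?case
  proof cases
    case 1
    show ?thesis unfolding 1 by (rule g0)
  next
    case 2
    have "((\<lambda>x. - u * ((2 * x + 1) * gauss_deriv u 0 x)) has_real_derivative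
       - u * (2 * gauss_deriv u 0 x + (2 * x + 1) * gauss_deriv u (Suc 0) x)) (at x)"
      by (rule derivative_eq_intros g0 refl)+ (simp add: algebra_simps)
    then show ?thesis using 2
      by (simp add: gauss_deriv.simps(2)[abs_def] algebra_simps del: gauss_deriv.simps(1) gauss_deriv.simps(2))
  next
    case 3
    have "((\<lambda>x. - u * ((2 * x + 1) * gauss_deriv u (Suc j) x + 2 * real (Suc j) * gauss_deriv u j x)) has_real_derivative
       - u * (2 * gauss_deriv u (Suc j) x + (2 * x + 1) * gauss_deriv u (Suc (Suc j)) x + 2 * real (Suc j) * gauss_deriv u (Suc j) x)) (at x)"
    proof -
      have d: "(gauss_deriv u j has_real_derivative gauss_deriv u (Suc j) x) (at x)"
        "(gauss_deriv u (Suc j) has_real_derivative gauss_deriv u (Suc (Suc j)) x) (at x)"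
        using 3 by (auto intro: less simp del: gauss_deriv.simps)
      show ?thesis
        by (rule derivative_eq_intros d refl)+ (simp add: algebra_simps del: gauss_deriv.simps)
    qed
    then show ?thesis using 3 by (simp add: gauss_deriv.simps(3)[abs_def] algebra_simps del: gauss_deriv.simps)
  qed
qed


lemma exp_ge_power: "v \<ge> 0 \<Longrightarrow> v ^ k \<le> real k ^ k * exp v" for v :: real
proof (cases "k = 0")
  case False
  assume v: "v \<ge> 0"
  have "(v / real k) ^ k \<le> (1 + v / real k) ^ k" using v by (intro power_mono) auto
  also have "\<dots> \<le> exp v" using v False by (intro exp_ge_one_plus_x_over_n_power_n) auto
  finally show ?thesis using False by (simp add: power_divide field_simps)
qed auto

text \<open>The recursion multiplies the previous derivative by u (2x+1) and the one before it by u.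
  Using the induction hypothesis with k + 1 in place of k cancels this u and supplies two further
  powers of decay, so the induction runs over all k at once.\<close>

lemma gauss_deriv_bound:
  assumes "U > 0"
  shows "\<exists>C\<ge>0. \<forall>u x. 0 < u \<longrightarrow> u \<le> U \<longrightarrow> 0 \<le> x \<longrightarrow>
    \<bar>gauss_deriv u i x\<bar> \<le> C / u ^ k * (x + 1) powr (- 2 * real k - real i)"
proof (induction i arbitrary: k rule: less_induct)
  case (less i)
  consider "i = 0" | j where "i = Suc j" by (cases i) auto
  then show ?case
  proof cases
    case 1
    define C where "C = exp U * (2 ^ k * real k ^ k)"
    have "\<bar>gauss_deriv u i x\<bar> \<le> C / u ^ k * (x + 1) powr (- 2 * real k - real i)"
      if u: "0 < u" "u \<le> U" and x: "0 \<le> x" for u x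
    proof -
      \<comment> \<open>The exponent x(x+1)u is at least v - u. The loss exp u is at most exp U, and
        exp(-v) <= k^k / v^k supplies the power of decay.\<close>
      define v where "v = (x + 1)\<^sup>2 * u / 2"
      have v: "v > 0" using u x by (simp add: v_def)
      have "(x + 1)\<^sup>2 / 2 - 1 \<le> x * (x + 1)" using x by (simp add: power2_eq_square algebra_simps)
      from mult_right_mono[OF this, of u] have "v - u \<le> x * (x + 1) * u" using u by (simp add: v_def algebra_simps)
      then have "exp (- (x * (x + 1) * u)) \<le> exp (U - v)" using u by simp
      also have "\<dots> = exp U / exp v" by (simp add: exp_diff)
      also have "\<dots> \<le> exp U * (real k ^ k / v ^ k)"
        using exp_ge_power[of v k] v by (simp add: field_simps)
      also have "real k ^ k / v ^ k = 2 ^ k * real k ^ k * (1 / u ^ k * (1 / (x + 1) ^ (2 * k)))"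
        unfolding v_def power_mult by (simp add: power_divide power_mult_distrib mult_ac)
      also have "1 / (x + 1) ^ (2 * k) = (x + 1) powr (- 2 * real k)"
        using x by (simp add: powr_minus_divide flip: powr_realpow)
      finally show ?thesis using 1 by (simp add: C_def mult_ac)
    qed
    moreover have "C \<ge> 0" by (simp add: C_def)
    ultimately show ?thesis by blast
  next
    case (2 j)
    obtain C1 where C1: "C1 \<ge> 0" "\<And>u x. 0 < u \<Longrightarrow> u \<le> U \<Longrightarrow> 0 \<le> x \<Longrightarrow>
        \<bar>gauss_deriv u j x\<bar> \<le> C1 / u ^ Suc k * (x + 1) powr (- 2 * real (Suc k) - real j)"
      using less[of j "Suc k"] 2 by blast
    have C1': "\<bar>u * ((2 * x + 1) * gauss_deriv u j x)\<bar> \<le> 2 * C1 / u ^ k * (x + 1) powr (- 2 * real k - real i)"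
      if u: "0 < u" "u \<le> U" and x: "0 \<le> x" for u x
    proof -
      have "\<bar>u * ((2 * x + 1) * gauss_deriv u j x)\<bar> = u * ((2 * x + 1) * \<bar>gauss_deriv u j x\<bar>)"
        using u x by (simp add: abs_mult)
      also have "\<dots> \<le> u * ((2 * (x + 1)) * (C1 / u ^ Suc k * (x + 1) powr (- 2 * real (Suc k) - real j)))"
        using u x C1(2)[OF u x] by (intro mult_left_mono mult_mono) auto
      also have "\<dots> = 2 * C1 / u ^ k * ((x + 1) powr 1 * (x + 1) powr (- 2 * real (Suc k) - real j))"
        using u x by simp
      also have "(x + 1) powr 1 * (x + 1) powr (- 2 * real (Suc k) - real j) = (x + 1) powr (- 2 * real k - real i)"
        unfolding powr_add[symmetric] by (rule arg_cong[where f = "\<lambda>e. (x + 1) powr e"]) (simp add: 2)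
      finally show ?thesis .
    qed
    show ?thesis
    proof (cases j)
      case 0
      have "\<bar>gauss_deriv u i x\<bar> \<le> 2 * C1 / u ^ k * (x + 1) powr (- 2 * real k - real i)"
        if u: "0 < u" "u \<le> U" and x: "0 \<le> x" for u x
        using C1'[OF that] 2 0 by (simp add: abs_mult)
      with C1(1) show ?thesis by (intro exI[of _ "2 * C1"] conjI allI impI) (rule mult_nonneg_nonneg | assumption | simp)+
    next
      case (Suc n)
      then have "n < i" using 2 by simp
      obtain C2 where C2: "C2 \<ge> 0" "\<And>u x. 0 < u \<Longrightarrow> u \<le> U \<Longrightarrow> 0 \<le> x \<Longrightarrow>
          \<bar>gauss_deriv u n x\<bar> \<le> C2 / u ^ Suc k * (x + 1) powr (- 2 * real (Suc k) - real n)"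
        using less[OF \<open>n < i\<close>, of "Suc k"] by blast
      have "\<bar>gauss_deriv u i x\<bar> \<le> (2 * C1 + 2 * real (Suc n) * C2) / u ^ k * (x + 1) powr (- 2 * real k - real i)"
        if u: "0 < u" "u \<le> U" and x: "0 \<le> x" for u x
      proof -
        have "\<bar>u * (2 * real (Suc n) * gauss_deriv u n x)\<bar> = u * (2 * real (Suc n) * \<bar>gauss_deriv u n x\<bar>)"
          using u by (simp add: abs_mult)
        also have "\<dots> \<le> u * (2 * real (Suc n) * (C2 / u ^ Suc k * (x + 1) powr (- 2 * real (Suc k) - real n)))"
          using u C2(2)[OF u x] by (intro mult_left_mono) auto
        also have "\<dots> = 2 * real (Suc n) * C2 / u ^ k * (x + 1) powr (- 2 * real (Suc k) - real n)"
          using u by simp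
        also have "- 2 * real (Suc k) - real n = - 2 * real k - real i" by (simp add: 2 Suc)
        finally have "\<bar>u * (2 * real (Suc n) * gauss_deriv u n x)\<bar> \<le> 2 * real (Suc n) * C2 / u ^ k * (x + 1) powr (- 2 * real k - real i)" .
        moreover have "\<bar>gauss_deriv u i x\<bar> \<le> \<bar>u * ((2 * x + 1) * gauss_deriv u j x)\<bar> + \<bar>u * (2 * real (Suc n) * gauss_deriv u n x)\<bar>"
        proof -
          have "gauss_deriv u i x = - (u * ((2 * x + 1) * gauss_deriv u j x) + u * (2 * real (Suc n) * gauss_deriv u n x))"
            unfolding 2 Suc gauss_deriv.simps by (simp add: algebra_simps del: gauss_deriv.simps)
          then show ?thesis by (metis abs_minus_cancel abs_triangle_ineq)
        qed
        ultimately show ?thesis using C1'[OF that] by (simp add: add_divide_distrib distrib_right del: gauss_deriv.simps of_nat_Suc)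
      qed
      with C1(1) C2(1) show ?thesis
        by (intro exI[of _ "2 * C1 + 2 * real (Suc n) * C2"] conjI allI impI) (rule add_nonneg_nonneg mult_nonneg_nonneg | assumption | simp)+
    qed
  qed
qed

text \<open>Gaussian decay is recorded as membership in classes of arbitrarily negative order, with a
  constant growing like \<open>u\<^sup>-\<^sup>k\<close>; no weights other than powers of \<open>l + 1\<close> are then needed.\<close>

lemma symb_gauss:
  assumes "U > 0"
  shows "\<exists>A\<ge>0. \<forall>u. 0 < u \<longrightarrow> u \<le> U \<longrightarrow> symb r (- 2 * real k) (A / u ^ k) (\<lambda>l. exp (- (real (l * (l + 1)) * u)))"
proof -
  have "\<forall>i. \<exists>C\<ge>0. \<forall>u x. 0 < u \<longrightarrow> u \<le> U \<longrightarrow> 0 \<le> x \<longrightarrow>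
    \<bar>gauss_deriv u i x\<bar> \<le> C / u ^ k * (x + 1) powr (- 2 * real k - real i)"
    using gauss_deriv_bound[OF assms] by blast
  then obtain C where C: "\<And>i. C i \<ge> 0" "\<And>i u x. 0 < u \<Longrightarrow> u \<le> U \<Longrightarrow> 0 \<le> x \<Longrightarrow>
    \<bar>gauss_deriv u i x\<bar> \<le> C i / u ^ k * (x + 1) powr (- 2 * real k - real i)"
    by metis
  define A where "A = (\<Sum>i\<le>r. C i)"
  have "symb r (- 2 * real k) (A / u ^ k) (\<lambda>l. exp (- (real (l * (l + 1)) * u)))" if u: "0 < u" "u \<le> U" for u
    unfolding symb_def
  proof (intro allI impI)
    fix i l assume i: "i \<le> r"
    have CA: "C i \<le> A" unfolding A_def using i C(1) by (intro member_le_sum) auto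
    have "\<bar>(fdiff ^^ i) (\<lambda>l. gauss_deriv u 0 (real l)) l\<bar> \<le> A / u ^ k * (real l + 1) powr (- 2 * real k - real i)"
    proof (rule fdiff_mvt[where a = "real l" and b = "real l + real i"])
      fix x assume x: "x \<in> {real l..real l + real i}"
      then have x0: "0 \<le> x" by auto
      have "\<bar>gauss_deriv u i x\<bar> \<le> C i / u ^ k * (x + 1) powr (- 2 * real k - real i)" by (rule C(2)[OF u x0])
      also have "\<dots> \<le> A / u ^ k * (real l + 1) powr (- 2 * real k - real i)"
        using CA C(1)[of i] u x by (intro mult_mono divide_right_mono powr_mono2') auto
      finally show "\<bar>gauss_deriv u i x\<bar> \<le> A / u ^ k * (real l + 1) powr (- 2 * real k - real i)" .
    qed (auto intro: has_field_derivative_at_within[OF gauss_deriv] simp del: gauss_deriv.simps)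
    moreover have "(\<lambda>l. gauss_deriv u 0 (real l)) = (\<lambda>l. exp (- (real (l * (l + 1)) * u)))"
      by (simp add: algebra_simps)
    ultimately show "\<bar>(fdiff ^^ i) (\<lambda>l. exp (- (real (l * (l + 1)) * u))) l\<bar> \<le> A / u ^ k * (real l + 1) powr (- 2 * real k - real i)"
      by simp
  qed
  moreover have "A \<ge> 0" unfolding A_def using C(1) by (intro sum_nonneg) auto
  ultimately show ?thesis by blast
qed

lemma fdiff_funpow_cong:
  assumes "\<And>k. k \<le> i \<Longrightarrow> F (l + k) = G (l + k)"
  shows "(fdiff ^^ i) F l = (fdiff ^^ i) G l"
  using assms
proof (induction i arbitrary: l)
  case (Suc i)
  have "(fdiff ^^ i) F (Suc l) = (fdiff ^^ i) G (Suc l)" using Suc.prems[of "Suc _"] by (intro Suc.IH) simp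
  moreover have "(fdiff ^^ i) F l = (fdiff ^^ i) G l" using Suc.prems by (intro Suc.IH) simp
  ultimately show ?case by (simp add: fdiff_def[of "(fdiff ^^ i) _"])
qed simp

lemma symb_powr:
  assumes "\<alpha> > 0"
  shows "\<exists>A. symb r (- \<alpha>) A (\<lambda>l. real l powr (- \<alpha>))"
proof (rule symb_eventually)
  define d where "d i x = (\<Prod>j<i. - \<alpha> - real j) * x powr (- \<alpha> - real i)" for i and x :: real
  define A where "A = (\<Sum>i\<le>r. \<bar>\<Prod>j<i. - \<alpha> - real j\<bar> * 2 powr (\<alpha> + real i))"
  fix i l :: nat assume i: "i \<le> r" and l: "l \<ge> 1"
  have A: "\<bar>\<Prod>j<i. - \<alpha> - real j\<bar> * 2 powr (\<alpha> + real i) \<le> A" unfolding A_def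
    using i by (intro member_le_sum) auto
  have "\<bar>(fdiff ^^ i) (\<lambda>l. d 0 (real l)) l\<bar> \<le> A * (real l + 1) powr (- \<alpha> - real i)"
  proof (rule fdiff_mvt[where a = "real l" and b = "real l + real i"])
    fix n x assume x: "x \<in> {real l..real l + real i}"
    then have "x > 0" using l by auto
    then have "(d n has_real_derivative (\<Prod>j<n. - \<alpha> - real j) * ((- \<alpha> - real n) * x powr (- \<alpha> - real n - 1))) (at x)"
      unfolding d_def by (intro DERIV_cmult has_real_derivative_powr)
    then have "(d n has_real_derivative d (Suc n) x) (at x)"
      by (simp add: d_def algebra_simps)
    then show "(d n has_real_derivative d (Suc n) x) (at x within {real l..real l + real i})"
      by (rule has_field_derivative_at_within)
  next
    fix x assume x: "x \<in> {real l..real l + real i}"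
    \<comment> \<open>Follows from x >= l >= (l+1)/2, as l >= 1.\<close>
    have "x powr (- \<alpha> - real i) \<le> ((real l + 1) / 2) powr (- \<alpha> - real i)"
      using x l assms by (intro powr_mono2') auto
    also have "\<dots> = 2 powr (\<alpha> + real i) * (real l + 1) powr (- \<alpha> - real i)"
    proof -
      have "2 powr (- \<alpha> - real i) = 1 / 2 powr (\<alpha> + real i)"
        using powr_minus_divide[of 2 "\<alpha> + real i"] by simp
      then show ?thesis by (simp add: powr_divide)
    qed
    finally have "\<bar>d i x\<bar> \<le> \<bar>\<Prod>j<i. - \<alpha> - real j\<bar> * (2 powr (\<alpha> + real i) * (real l + 1) powr (- \<alpha> - real i))"
      unfolding d_def abs_mult by (intro mult_left_mono) auto
    also have "\<dots> \<le> A * (real l + 1) powr (- \<alpha> - real i)"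
      unfolding mult.assoc[symmetric] using A by (intro mult_right_mono) auto
    finally show "\<bar>d i x\<bar> \<le> A * (real l + 1) powr (- \<alpha> - real i)" .
  qed auto
  then show "\<bar>(fdiff ^^ i) (\<lambda>l. real l powr (- \<alpha>)) l\<bar> \<le> A * (real l + 1) powr (- \<alpha> - real i)"
    by (simp add: d_def)
qed

lemma dyadic_index:
  fixes b :: real and l :: nat
  assumes "b > 1" "l \<ge> 2"
  obtains j where "j \<ge> 1" "b ^ (j - 1) < real l" "real l \<le> b ^ j"
proof -
  obtain n where n: "real l < b ^ n" using real_arch_pow[OF assms(1)] by blast
  define j where "j = (LEAST j. real l \<le> b ^ j)"
  have j: "real l \<le> b ^ j" unfolding j_def by (rule LeastI[of _ n]) (use n in simp)
  have j1: "j \<ge> 1" using j assms(2) by (cases j) auto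
  have "\<not> real l \<le> b ^ (j - 1)" using not_less_Least[of "j - 1" "\<lambda>j. real l \<le> b ^ j"] j1 unfolding j_def[symmetric] by simp
  then show ?thesis using that j j1 by simp
qed

text \<open>Choosing the base \<open>M + 2\<close> in the regularity condition makes every window of \<open>M + 1\<close> consecutive
  multipoles lie in the domain of a single \<open>g\<^sub>j\<close>.\<close>

lemma regularity_condition_symb:
  assumes "regularity_condition \<alpha> M C" "\<alpha> > 0"
  shows "\<exists>A G. symb M (- \<alpha>) A G \<and> (\<forall>l\<ge>1. G l = C l)"
proof -
  define b where "b = real M + 2"
  have b: "b > 1" by (simp add: b_def)
  obtain g D c where c: "\<And>r. r \<le> M \<Longrightarrow> c r > (0::real)"
    and Cg: "\<And>j l. j \<ge> 1 \<Longrightarrow> b ^ (j - 1) < real l \<Longrightarrow> real l < b ^ (j + 1) \<Longrightarrow> C l = real l powr (-\<alpha>) * g j (real l / b ^ j) \<and> C l > 0"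
    and g0: "\<And>j u. j \<ge> 1 \<Longrightarrow> u \<in> {1/b..b} \<Longrightarrow> 1 / c 0 \<le> g j u \<and> g j u \<le> c 0"
    and D0: "\<And>j. j \<ge> 1 \<Longrightarrow> D j 0 = g j"
    and D: "\<And>j r u. j \<ge> 1 \<Longrightarrow> r < M \<Longrightarrow> u \<in> {1/b..b} \<Longrightarrow> (D j r has_real_derivative D j (Suc r) u) (at u within {1/b..b})"
    and Dc: "\<And>j r u. j \<ge> 1 \<Longrightarrow> r \<in> {1..M} \<Longrightarrow> u \<in> {1/b..b} \<Longrightarrow> \<bar>D j r u\<bar> \<le> c r"
    using assms(1) b unfolding regularity_condition_def by (elim allE[of _ b]) (elim impE exE conjE, assumption, blast)
  have Dc': "\<bar>D j r u\<bar> \<le> c r" if "j \<ge> 1" "r \<le> M" "u \<in> {1/b..b}" for j r u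
  proof (cases "r = 0")
    case True
    have "0 < 1 / c 0" using c[of 0] by simp
    moreover have "1 / c 0 \<le> g j u" "g j u \<le> c 0" using g0[OF that(1,3)] by auto
    ultimately have "\<bar>g j u\<bar> \<le> c 0" by linarith
    then show ?thesis using D0[OF that(1)] True by simp
  qed (use Dc that in auto)
  \<comment> \<open>On each window H l equals g_j(l / b^j), a function varying at scale b^j, so H
    should have order 0. The power law is multiplied back at the end.\<close>
  define H where "H l = C l * real l powr \<alpha>" for l
  have "\<exists>A. symb M 0 A H"
  proof (rule symb_eventually)
    \<comment> \<open>The multipole l = 1 lies in no window b^(j-1) < l < b^(j+1) with j >= 1;
      \<open>symb_eventually\<close> absorbs it into the constant.\<close>
    fix i l :: nat assume i: "i \<le> M" and l: "l \<ge> 2"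
    obtain j where j: "j \<ge> 1" "b ^ (j - 1) < real l" "real l \<le> b ^ j"
      using dyadic_index[OF b l] by blast
    have bj: "b ^ j > 0" using b by simp
    define f where "f r x = D j r (x / b ^ j) / (b ^ j) ^ r" for r x
    have bj1: "b ^ (j - 1) = b ^ j * (1 / b)" "b ^ (j + 1) = b ^ j * b" using j(1) b by (cases j; simp)+
    have lM: "real l + real i < b ^ (j + 1)"
    proof -
      have "real l + real i \<le> real l * (real M + 1)" using i l by (simp add: distrib_left) (metis mult_le_mono mult_1 le_trans One_nat_def Suc_leD numeral_2_eq_2 of_nat_le_iff of_nat_mult)
      also have "\<dots> < real l * b" using l by (simp add: b_def)
      also have "\<dots> \<le> b ^ j * b" using j(3) b by (intro mult_right_mono) auto
      finally show ?thesis unfolding bj1(2) .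
    qed
    have win: "x / b ^ j \<in> {1/b..b}" if "x \<in> {real l..real l + real i}" for x
    proof -
      have "b ^ j * (1 / b) \<le> x" "x \<le> b ^ j * b" using that j lM bj1 by (auto simp: mult.commute)
      then show ?thesis using bj b by (simp add: field_simps)
    qed
    have "\<bar>(fdiff ^^ i) (\<lambda>l. f 0 (real l)) l\<bar> \<le> c i / (b ^ j) ^ i"
    proof (rule fdiff_mvt[where a = "real l" and b = "real l + real i"])
      fix r x assume r: "r < i" and x: "x \<in> {real l..real l + real i}"
      have "(D j r has_real_derivative D j (Suc r) (x / b ^ j)) (at (x / b ^ j) within (\<lambda>x. x / b ^ j) ` {real l..real l + real i})"
        by (rule DERIV_subset[OF D[OF j(1)]]) (use r i win[OF x] win in auto)
      moreover have "((\<lambda>x. x / b ^ j) has_real_derivative 1 / b ^ j) (at x within {real l..real l + real i})"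
        using bj by (auto intro!: derivative_eq_intros)
      ultimately have "((\<lambda>x. D j r (x / b ^ j)) has_real_derivative D j (Suc r) (x / b ^ j) * (1 / b ^ j)) (at x within {real l..real l + real i})"
        using DERIV_image_chain[of "D j r" "D j (Suc r) (x / b ^ j)" "\<lambda>x. x / b ^ j" x "{real l..real l + real i}" "1 / b ^ j"] by (simp add: o_def)
      from DERIV_cdivide[OF this, of "(b ^ j) ^ r"]
      show "(f r has_real_derivative f (Suc r) x) (at x within {real l..real l + real i})"
        by (simp add: f_def[abs_def] mult_ac)
    next
      fix x assume x: "x \<in> {real l..real l + real i}"
      show "\<bar>f i x\<bar> \<le> c i / (b ^ j) ^ i"
        unfolding f_def abs_divide using Dc'[OF j(1) i win[OF x]] bj by (simp add: divide_right_mono)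
    qed auto
    also have "c i / (b ^ j) ^ i \<le> c i * (2 ^ i / (real l + 1) ^ i)"
    proof -
      \<comment> \<open>The factor b^(-j) gained by each derivative becomes a power of l + 1,
        because (l+1)/2 <= l <= b^j.\<close>
      have "(real l + 1) / 2 \<le> b ^ j" using j(3) l by simp
      then have "((real l + 1) / 2) ^ i \<le> (b ^ j) ^ i" by (intro power_mono) auto
      then have "1 / (b ^ j) ^ i \<le> 1 / ((real l + 1) / 2) ^ i" using bj by (intro divide_left_mono) auto
      then have "c i * (1 / (b ^ j) ^ i) \<le> c i * (1 / ((real l + 1) / 2) ^ i)" using c[OF i] by (intro mult_left_mono) auto
      then show ?thesis by (simp add: power_divide)
    qed
    also have "\<dots> = c i * 2 ^ i * (real l + 1) powr (0 - real i)"
      by (simp add: powr_minus_divide powr_realpow)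
    also have "\<dots> \<le> (\<Sum>i\<le>M. c i * 2 ^ i) * (real l + 1) powr (0 - real i)"
      using i c by (intro mult_right_mono member_le_sum) (auto intro: less_imp_le)
    also have "(fdiff ^^ i) (\<lambda>l. f 0 (real l)) l = (fdiff ^^ i) H l"
    proof (rule fdiff_funpow_cong)
      fix k assume k: "k \<le> i"
      have "real (l + k) < b ^ (j + 1)" "b ^ (j - 1) < real (l + k)" using lM j(2) k by auto
      from Cg[OF j(1) this(2,1)] have "C (l + k) = real (l + k) powr (-\<alpha>) * g j (real (l + k) / b ^ j)" by simp
      then show "f 0 (real (l + k)) = H (l + k)"
        using l by (simp add: H_def f_def D0[OF j(1)] mult.commute[of _ "g j _"] mult.assoc flip: powr_add)
    qed
    finally show "\<bar>(fdiff ^^ i) H l\<bar> \<le> (\<Sum>i\<le>M. c i * 2 ^ i) * (real l + 1) powr (0 - real i)" .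
  qed
  then obtain A1 where A1: "symb M 0 A1 H" ..
  obtain A2 where A2: "symb M (- \<alpha>) A2 (\<lambda>l. real l powr (- \<alpha>))" using symb_powr[OF assms(2)] by blast
  obtain cc where "symb M (- \<alpha> + 0) (cc * A2 * A1) (\<lambda>l. real l powr (- \<alpha>) * H l)"
    using symb_mult[of M "- \<alpha>" 0] A1 A2 by blast
  \<comment> \<open>At l = 0 the product is 0 since 0 powr is 0, while C 0 is arbitrary; agreement
    is therefore claimed from l = 1 on.\<close>
  moreover have "real l powr (- \<alpha>) * H l = C l" if "l \<ge> 1" for l
    using that by (simp add: H_def mult.left_commute[of _ "C l"] flip: powr_add)
  ultimately show ?thesis by (intro exI[of _ "cc * A2 * A1"] exI[of _ "\<lambda>l. real l powr (- \<alpha>) * H l"]) simp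
qed

section \<open>Localization of Gaussian kernels\<close>

text \<open>The coefficients of the covariance kernel, with q = 2p in the application.
  Differentiation in u raises q by one up to sign, which is how the exponent s + 2 of the derivative
  arises.\<close>

definition kern :: "(nat \<Rightarrow> real) \<Rightarrow> nat \<Rightarrow> real \<Rightarrow> nat \<Rightarrow> real" where
  "kern C q u l = real (l * (l + 1)) ^ q * exp (- (real (l * (l + 1)) * u)) * C l"

text \<open>The Gaussian lowers the order by 2k at the price u^(-k), for every k. C and its regular
  substitute G may differ at l = 0, where the factor (l(l+1))^q vanishes.\<close>

lemma symb_kern:
  assumes "symb M (- \<alpha>) A0 G" "\<And>l. l \<ge> 1 \<Longrightarrow> G l = C l" "q \<ge> 1" "U > 0"
  shows "\<exists>A\<ge>0. \<forall>u. 0 < u \<longrightarrow> u \<le> U \<longrightarrow> symb M (2 * real q - \<alpha> - 2 * real k) (A / u ^ k) (kern C q u)"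
proof -
  obtain A1 where A1: "symb M 1 A1 (\<lambda>l. real l + 0)" using symb_Suc_self by blast
  obtain A2 where A2: "symb M 1 A2 (\<lambda>l. real l + 1)" using symb_Suc_self by blast
  obtain c where "symb M (1 + 1) (c * A1 * A2) (\<lambda>l. (real l + 0) * (real l + 1))"
    using symb_mult[of M 1 1] A1 A2 by blast
  then obtain A3 where A3: "symb M 2 A3 (\<lambda>l. real (l * (l + 1)))" by (auto simp: algebra_simps)
  have "\<exists>A. symb M (2 * real q - \<alpha>) A (\<lambda>l. real (l * (l + 1)) ^ q * G l)" for q
  proof (induction q)
    case 0
    then show ?case using assms(1) by auto
  next
    case (Suc q)
    then obtain A where A: "symb M (2 * real q - \<alpha>) A (\<lambda>l. real (l * (l + 1)) ^ q * G l)" by blast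
    obtain c where "symb M (2 + (2 * real q - \<alpha>)) (c * A3 * A) (\<lambda>l. real (l * (l + 1)) * (real (l * (l + 1)) ^ q * G l))"
      using symb_mult[of M 2 "2 * real q - \<alpha>"] A3 A by blast
    then show ?case by (auto simp: mult.assoc algebra_simps del: of_nat_mult of_nat_add)
  qed
  then obtain A4 where A4: "symb M (2 * real q - \<alpha>) A4 (\<lambda>l. real (l * (l + 1)) ^ q * G l)" by blast
  have "(\<lambda>l. real (l * (l + 1)) ^ q * G l) = (\<lambda>l. real (l * (l + 1)) ^ q * C l)"
  proof
    fix l show "real (l * (l + 1)) ^ q * G l = real (l * (l + 1)) ^ q * C l"
      using assms(2)[of l] assms(3) by (cases "l = 0") auto
  qed
  with A4 have A4: "symb M (2 * real q - \<alpha>) A4 (\<lambda>l. real (l * (l + 1)) ^ q * C l)" by simp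
  have A40: "A4 \<ge> 0" using A4 by (rule symb_const_nonneg)
  obtain A5 where A5: "A5 \<ge> 0" "\<And>u. 0 < u \<Longrightarrow> u \<le> U \<Longrightarrow> symb M (- 2 * real k) (A5 / u ^ k) (\<lambda>l. exp (- (real (l * (l + 1)) * u)))"
    using symb_gauss[OF assms(4)] by blast
  obtain c where c: "c > 0" "\<And>F G A B. symb M (2 * real q - \<alpha>) A F \<Longrightarrow> symb M (- 2 * real k) B G \<Longrightarrow> symb M (2 * real q - \<alpha> + - 2 * real k) (c * A * B) (\<lambda>l. F l * G l)"
    using symb_mult[of M "2 * real q - \<alpha>" "- 2 * real k"] by blast
  have "symb M (2 * real q - \<alpha> - 2 * real k) (c * A4 * A5 / u ^ k) (kern C q u)" if u: "0 < u" "u \<le> U" for u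
    using c(2)[OF A4 A5(2)[OF u]] by (simp add: kern_def[abs_def] mult_ac del: of_nat_mult of_nat_add)
  moreover have "c * A4 * A5 \<ge> 0" using c(1) A40 A5(1) by simp
  ultimately show ?thesis by blast
qed

text \<open>An application of \<open>legsum_decay\<close> to the class with k = 0 and to one with k
  large enough for absolute convergence; the constant A is enlarged to serve both.\<close>

lemma kern_decay:
  assumes G: "symb M (- \<alpha>) A0 G" "\<And>l. l \<ge> 1 \<Longrightarrow> G l = C l" and q: "q \<ge> 1" and U: "U > 0"
    and m: "m \<le> M" "2 * real q - \<alpha> + 2 - real m > 0"
  shows "\<exists>A>0. \<forall>u x. 0 < u \<longrightarrow> u \<le> U \<longrightarrow> \<bar>x\<bar> \<le> 1 \<longrightarrow>
    sqrt (1 - x) ^ m * \<bar>legsum (kern C q u) x\<bar> \<le> A * u powr (- (2 * real q - \<alpha> + 2 - real m) / 2)"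
proof -
  define a where "a = 2 * real q - \<alpha>"
  obtain k :: nat where k: "2 * real k > a + 2"
    using reals_Archimedean2[of "(a + 2) / 2"] by (auto simp: field_simps)
  obtain A1 where A1: "A1 \<ge> 0" "\<And>u. 0 < u \<Longrightarrow> u \<le> U \<Longrightarrow> symb M a A1 (kern C q u)"
    using symb_kern[OF G q U, of 0] by (auto simp: a_def)
  obtain A2 where A2: "A2 \<ge> 0" "\<And>u. 0 < u \<Longrightarrow> u \<le> U \<Longrightarrow> symb M (a - 2 * real k) (A2 / u ^ k) (kern C q u)"
    using symb_kern[OF G q U, of k] by (auto simp: a_def)
  define A where "A = 1 + A1 + A2"
  obtain K where K: "K > 0" "\<And>u A F x. 0 < u \<Longrightarrow> u \<le> U \<Longrightarrow> symb m a A F \<Longrightarrow> symb m (a - 2 * real k) (A / u ^ k) F \<Longrightarrow>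
     \<bar>x\<bar> \<le> 1 \<Longrightarrow> sqrt (1 - x) ^ m * \<bar>legsum F x\<bar> \<le> K * A * u powr (- (a + 2 - real m) / 2)"
    using legsum_decay[of a m k U] m k U by (auto simp: a_def)
  have "sqrt (1 - x) ^ m * \<bar>legsum (kern C q u) x\<bar> \<le> K * A * u powr (- (a + 2 - real m) / 2)"
    if u: "0 < u" "u \<le> U" and x: "\<bar>x\<bar> \<le> 1" for u x
  proof (rule K(2)[OF u _ _ x])
    show "symb m a A (kern C q u)" using A1 A2(1) u m by (intro symb_mono[OF A1(2)]) (auto simp: A_def)
    show "symb m (a - 2 * real k) (A / u ^ k) (kern C q u)"
      using A1 A2(1) u m by (intro symb_mono[OF A2(2)]) (auto simp: A_def intro!: divide_right_mono)
  qed
  moreover have "K * A > 0" using K A1 A2 by (simp add: A_def)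
  ultimately show ?thesis unfolding a_def by blast
qed

lemma kern_summable:
  assumes G: "symb M (- \<alpha>) A0 G" "\<And>l. l \<ge> 1 \<Longrightarrow> G l = C l" and q: "q \<ge> 1" and u: "u > 0" and x: "\<bar>x\<bar> \<le> 1"
  shows "summable (\<lambda>l. (2 * real l + 1) * kern C q u l * leg 0 l x)"
    and "summable (\<lambda>l. \<bar>(2 * real l + 1) * kern C q u l\<bar>)"
proof -
  obtain k :: nat where k: "2 * real k > 2 * real q - \<alpha> + 2"
    using reals_Archimedean2[of "(2 * real q - \<alpha> + 2) / 2"] by (auto simp: field_simps)
  obtain A where "symb M (2 * real q - \<alpha> - 2 * real k) (A / u ^ k) (kern C q u)"
    using symb_kern[OF G q u, of k] u by blast
  note s = this
  show "summable (\<lambda>l. (2 * real l + 1) * kern C q u l * leg 0 l x)"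
    using k x by (intro legsum_summable[OF s]) auto
  have "symb 0 (2 * real q - \<alpha> - 2 * real k) (A / u ^ k) (\<lambda>l. \<bar>kern C q u l\<bar>)"
    using symb_bound[OF s] by (simp add: symb_0)
  from legsum_summable[OF this, of 1] have "summable (\<lambda>l. (2 * real l + 1) * \<bar>kern C q u l\<bar> * leg 0 l 1)"
    using k by simp
  then show "summable (\<lambda>l. \<bar>(2 * real l + 1) * kern C q u l\<bar>)" using legendre_at_1 by (simp add: abs_mult)
qed

text \<open>Termwise differentiation on [u/2, 2u], where the differentiated terms are dominated by
  their coefficients at u/2, as |P_l| <= 1.\<close>

lemma kern_deriv:
  assumes G: "symb M (- \<alpha>) A0 G" "\<And>l. l \<ge> 1 \<Longrightarrow> G l = C l" and q: "q \<ge> 1" and u: "u > 0" and x: "\<bar>x\<bar> \<le> 1"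
  shows "((\<lambda>u. legsum (kern C q u) x) has_real_derivative - legsum (kern C (Suc q) u) x) (at u)"
proof -
  define S where "S = {u/2..2*u}"
  have S: "u \<in> S" "u \<in> interior S" using u by (auto simp: S_def)
  have "((\<lambda>u. \<Sum>l. (2 * real l + 1) * kern C q u l * leg 0 l x) has_field_derivative
      (\<Sum>l. - ((2 * real l + 1) * kern C (Suc q) u l * leg 0 l x))) (at u)"
  proof (rule has_field_derivative_series'(2)[where S = S and x0 = u])
    show "convex S" by (simp add: S_def)
    fix l v
    show "((\<lambda>u. (2 * real l + 1) * kern C q u l * leg 0 l x) has_field_derivative - ((2 * real l + 1) * kern C (Suc q) v l * leg 0 l x)) (at v within S)"
      unfolding kern_def by (auto intro!: derivative_eq_intros simp del: of_nat_mult of_nat_add)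
  next
    have "uniform_limit S (\<lambda>n v. \<Sum>l<n. - ((2 * real l + 1) * kern C (Suc q) v l * leg 0 l x))
       (\<lambda>v. \<Sum>l. - ((2 * real l + 1) * kern C (Suc q) v l * leg 0 l x)) sequentially"
    proof (rule Weierstrass_m_test)
      show "summable (\<lambda>l. \<bar>(2 * real l + 1) * kern C (Suc q) (u / 2) l\<bar>)"
        using kern_summable(2)[OF G _ _ x] u by simp
      fix l v assume v: "v \<in> S"
      have "real (l * (l + 1)) * (u / 2) \<le> real (l * (l + 1)) * v"
        using v unfolding S_def by (intro mult_left_mono) auto
      then have "exp (- (real (l * (l + 1)) * v)) \<le> exp (- (real (l * (l + 1)) * (u / 2)))"
        by simp
      then have "\<bar>kern C (Suc q) v l\<bar> \<le> \<bar>kern C (Suc q) (u / 2) l\<bar>"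
        unfolding kern_def abs_mult by (intro mult_right_mono mult_left_mono) auto
      then have "\<bar>(2 * real l + 1) * kern C (Suc q) v l\<bar> * \<bar>leg 0 l x\<bar> \<le> \<bar>(2 * real l + 1) * kern C (Suc q) (u / 2) l\<bar> * 1"
        unfolding abs_mult using legendre_abs_le_1[OF x, of l] by (intro mult_mono) auto
      then show "norm (- ((2 * real l + 1) * kern C (Suc q) v l * leg 0 l x)) \<le> \<bar>(2 * real l + 1) * kern C (Suc q) (u / 2) l\<bar>"
        by (simp add: abs_mult)
    qed
    then show "uniformly_convergent_on S (\<lambda>n v. \<Sum>l<n. - ((2 * real l + 1) * kern C (Suc q) v l * leg 0 l x))"
      by (auto simp: uniformly_convergent_on_def)
    show "summable (\<lambda>l. (2 * real l + 1) * kern C q u l * leg 0 l x)" by (rule kern_summable(1)[OF G q u x])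
  qed (use S in auto)
  moreover have "(\<Sum>l. - ((2 * real l + 1) * kern C (Suc q) u l * leg 0 l x)) = - legsum (kern C (Suc q) u) x"
    unfolding legsum_def using kern_summable(1)[OF G, of "Suc q"] u x by (intro suminf_minus) simp
  ultimately show ?thesis unfolding legsum_def by simp
qed

text \<open>Both h - f and h + f are nondecreasing, so the increment of f is controlled by that of a
  majorant h without forming an integral.\<close>

lemma increment_bound:
  fixes f h :: "real \<Rightarrow> real"
  assumes "a \<le> b" and "\<And>u. a \<le> u \<Longrightarrow> u \<le> b \<Longrightarrow> (f has_real_derivative f' u) (at u)"
    and "\<And>u. a \<le> u \<Longrightarrow> u \<le> b \<Longrightarrow> (h has_real_derivative h' u) (at u)"
    and "\<And>u. a \<le> u \<Longrightarrow> u \<le> b \<Longrightarrow> \<bar>f' u\<bar> \<le> h' u"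
  shows "\<bar>f a\<bar> \<le> \<bar>f b\<bar> + (h b - h a)"
proof -
  have "h a - f a \<le> h b - f b"
  proof (rule DERIV_nonneg_imp_nondecreasing[OF assms(1)])
    fix u assume u: "a \<le> u" "u \<le> b"
    show "\<exists>y. ((\<lambda>u. h u - f u) has_real_derivative y) (at u) \<and> 0 \<le> y"
      using DERIV_diff[OF assms(3)[OF u] assms(2)[OF u]] assms(4)[OF u] by (intro exI[of _ "h' u - f' u"]) auto
  qed
  moreover have "h a + f a \<le> h b + f b"
  proof (rule DERIV_nonneg_imp_nondecreasing[OF assms(1)])
    fix u assume u: "a \<le> u" "u \<le> b"
    show "\<exists>y. ((\<lambda>u. h u + f u) has_real_derivative y) (at u) \<and> 0 \<le> y"
      using DERIV_add[OF assms(3)[OF u] assms(2)[OF u]] assms(4)[OF u] by (intro exI[of _ "h' u + f' u"]) auto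
  qed
  ultimately show ?thesis by linarith
qed

lemma sin_half_ge:
  assumes "0 \<le> \<theta>" "\<theta> \<le> pi"
  shows "\<theta> / 4 \<le> sin (\<theta> / 2)"
proof -
  define y where "y = \<theta> / 2"
  have y: "0 \<le> y" "y \<le> 1.6" using assms pi_approx by (auto simp: y_def)
  have "\<bar>sin y - (\<Sum>m<3. sin_coeff m * y ^ m)\<bar> \<le> inverse (fact 3) * \<bar>y\<bar> ^ 3"
    by (rule Maclaurin_sin_bound)
  then have "\<bar>sin y - y\<bar> \<le> y ^ 3 / 6"
    using y by (simp add: eval_nat_numeral sin_coeff_def fact_numeral)
  then have "sin y \<ge> y - y ^ 3 / 6" by linarith
  moreover have "y ^ 3 \<le> 3 * y"
  proof -
    have "y * y \<le> 1.6 * 1.6" using y by (intro mult_mono) auto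
    then have "y * (y * y) \<le> y * 3" using y by (intro mult_left_mono) auto
    then show ?thesis by (simp add: power3_eq_cube mult_ac)
  qed
  ultimately have "sin y \<ge> y / 2" by linarith
  then show ?thesis by (simp add: y_def)
qed

text \<open>The kernel at scale \<open>t\<close> is compared with the kernel at scale \<open>t + \<theta>\<^sup>2\<close>, for which the trivial
  bound suffices; their difference is controlled through the derivative in \<open>t\<close>, which gains a factor
  \<open>l (l + 1)\<close> and hence makes \<open>m = \<lceil>s\<rceil>\<close> differences affordable. The logarithm appears
  only when \<open>s\<close> is an integer.\<close>

theorem kern_localization:
  fixes C :: "nat \<Rightarrow> real"
  assumes G: "symb M (- \<alpha>) A0 G" "\<And>l. l \<ge> 1 \<Longrightarrow> G l = C l" and q: "q \<ge> 1"
    and s: "s = 2 * real q + 2 - \<alpha>" "s > 0" "real M \<ge> s"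
  shows "\<exists>A>0. \<forall>t \<theta>. 0 < t \<longrightarrow> t \<le> 2 \<longrightarrow> 0 < \<theta> \<longrightarrow> \<theta> \<le> pi \<longrightarrow> t \<le> 2 * \<theta>\<^sup>2 \<longrightarrow>
    \<bar>legsum (kern C q t) (cos \<theta>)\<bar> \<le> A * (ln (13 / t) / \<theta>) powr s"
proof -
  define m where "m = nat \<lceil>s\<rceil>"
  have m: "m \<le> M" "s \<le> real m" "real m < s + 1" "m \<ge> 1"
    using s by (auto simp: m_def le_nat_iff) linarith+
  \<comment> \<open>The derivative kernel has exponent s + 2, so m differences leave u^(-\<gamma>).
    Here \<gamma> <= 1, with equality exactly when s is an integer, and then the primitive is a
    logarithm.\<close>
  define \<gamma> where "\<gamma> = (s + 2 - real m) / 2"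
  have g: "1 / 2 < \<gamma>" "\<gamma> \<le> 1" using m by (auto simp: \<gamma>_def field_simps)
  \<comment> \<open>The range 13 for u covers t + \<theta>^2, as t <= 2 and pi^2 < 11; the same 13
    appears in the logarithm.\<close>
  obtain A1 where A1: "A1 > 0" "\<And>u x. 0 < u \<Longrightarrow> u \<le> 13 \<Longrightarrow> \<bar>x\<bar> \<le> 1 \<Longrightarrow>
      sqrt (1 - x) ^ 0 * \<bar>legsum (kern C q u) x\<bar> \<le> A1 * u powr (- (2 * real q - \<alpha> + 2 - real 0) / 2)"
    using kern_decay[OF G q, of 13 0] s by auto
  have A1': "\<bar>legsum (kern C q u) x\<bar> \<le> A1 * u powr (- s / 2)" if "0 < u" "u \<le> 13" "\<bar>x\<bar> \<le> 1" for u x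
    using A1(2)[OF that] by (simp add: s algebra_simps)
  obtain A2 where A2: "A2 > 0" "\<And>u x. 0 < u \<Longrightarrow> u \<le> 13 \<Longrightarrow> \<bar>x\<bar> \<le> 1 \<Longrightarrow>
      sqrt (1 - x) ^ m * \<bar>legsum (kern C (Suc q) u) x\<bar> \<le> A2 * u powr (- (2 * real (Suc q) - \<alpha> + 2 - real m) / 2)"
    using kern_decay[OF G _ _ m(1), of "Suc q" 13] s m by auto
  have e: "- (2 * real (Suc q) - \<alpha> + 2 - real m) / 2 = - \<gamma>" by (simp add: s \<gamma>_def field_simps)
  define K where "K = A1 + A2 * 3 ^ m * (1 + (if \<gamma> = 1 then 0 else 3 powr (1 - \<gamma>) / (1 - \<gamma>)))"
  have K: "K > 0"
    unfolding K_def using A1(1) A2(1) g by (intro add_pos_nonneg) auto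
  have "\<bar>legsum (kern C q t) (cos \<theta>)\<bar> \<le> K * (ln (13 / t) / \<theta>) powr s"
    if t: "0 < t" "t \<le> 2" and th: "0 < \<theta>" "\<theta> \<le> pi" and tt: "t \<le> 2 * \<theta>\<^sup>2" for t \<theta>
  proof -
    define x where "x = cos \<theta>"
    have x: "\<bar>x\<bar> \<le> 1" by (simp add: x_def)
    define L where "L = ln (13 / t)"
    \<comment> \<open>Ensures ln(13 / t) >= 1, so that inserting a power of it never weakens an
      upper bound's validity.\<close>
    have "t * exp 1 \<le> 2 * 3" using t exp_le by (intro mult_mono) auto
    then have "exp 1 \<le> 13 / t" using t by (simp add: field_simps)
    then have L: "L \<ge> 1" unfolding L_def using t by (subst ln_ge_iff) auto
    have "\<theta>\<^sup>2 \<le> pi\<^sup>2" using th by (intro power_mono) auto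
    also have "pi\<^sup>2 \<le> 3.2\<^sup>2" using pi_approx by (intro power_mono) auto
    finally have T: "t + \<theta>\<^sup>2 \<le> 13" using t by (simp add: power2_eq_square)
    \<comment> \<open>Here 1 - cos \<theta> = 2 sin^2(\<theta>/2) and sin(\<theta>/2) >= \<theta>/4;
      the constant 1/3 is a rational value below sqrt 2 / 4.\<close>
    have sx: "\<theta> / 3 \<le> sqrt (1 - x)"
    proof (rule real_le_rsqrt)
      have c: "x = 1 - 2 * (sin (\<theta> / 2))\<^sup>2" using cos_double_sin[of "\<theta> / 2"] by (simp add: x_def)
      have "\<theta> / 4 \<le> sin (\<theta> / 2)" by (rule sin_half_ge[OF _ th(2)]) (use th in simp)
      then have "(\<theta> / 4)\<^sup>2 \<le> (sin (\<theta> / 2))\<^sup>2" using th by (intro power_mono) auto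
      moreover have "(\<theta> / 3)\<^sup>2 \<le> 2 * (\<theta> / 4)\<^sup>2" by (simp add: power2_eq_square)
      ultimately show "(\<theta> / 3)\<^sup>2 \<le> 1 - x" unfolding c by linarith
    qed
    define N where "N = (3 / \<theta>) ^ m"
    have N: "N > 0" using th by (simp add: N_def)
    have A2': "\<bar>legsum (kern C (Suc q) u) x\<bar> \<le> A2 * N * u powr (- \<gamma>)" if u: "0 < u" "u \<le> 13" for u
    proof -
      have "(\<theta> / 3) ^ m * \<bar>legsum (kern C (Suc q) u) x\<bar> \<le> sqrt (1 - x) ^ m * \<bar>legsum (kern C (Suc q) u) x\<bar>"
        using sx th by (intro mult_right_mono power_mono) auto
      also have "\<dots> \<le> A2 * u powr (- \<gamma>)" using A2(2)[OF u x] unfolding e .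
      finally have "N * ((\<theta> / 3) ^ m * \<bar>legsum (kern C (Suc q) u) x\<bar>) \<le> N * (A2 * u powr (- \<gamma>))"
        using N by (intro mult_left_mono) auto
      moreover have "N * (\<theta> / 3) ^ m = 1" unfolding N_def power_mult_distrib[symmetric] using th by simp
      ultimately show ?thesis by (simp add: mult_ac flip: mult.assoc)
    qed
    \<comment> \<open>Any primitive h of u^(-\<gamma>) may be inserted: the logarithm for \<gamma> =
      1, a power otherwise.\<close>
    have lem: "\<bar>legsum (kern C q t) x\<bar> \<le> \<bar>legsum (kern C q (t + \<theta>\<^sup>2)) x\<bar> + (A2 * N * h (t + \<theta>\<^sup>2) - A2 * N * h t)"
      if h: "\<And>u. u > 0 \<Longrightarrow> (h has_real_derivative u powr (- \<gamma>)) (at u)" for h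
    proof (rule increment_bound[where f' = "\<lambda>u. - legsum (kern C (Suc q) u) x" and h' = "\<lambda>u. A2 * N * u powr (- \<gamma>)"])
      show "((\<lambda>u. legsum (kern C q u) x) has_real_derivative - legsum (kern C (Suc q) u) x) (at u)" if "t \<le> u" for u
        using kern_deriv[OF G q _ x] that t by auto
      show "((\<lambda>u. A2 * N * h u) has_real_derivative A2 * N * u powr (- \<gamma>)) (at u)" if "t \<le> u" for u
        using h[of u] that t by (intro DERIV_cmult) auto
      show "\<bar>- legsum (kern C (Suc q) u) x\<bar> \<le> A2 * N * u powr (- \<gamma>)" if "t \<le> u" "u \<le> t + \<theta>\<^sup>2" for u
        using A2'[of u] that t T by auto
    qed simp
    have base: "\<bar>legsum (kern C q (t + \<theta>\<^sup>2)) x\<bar> \<le> A1 * \<theta> powr (- s)"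
    proof -
      have "\<bar>legsum (kern C q (t + \<theta>\<^sup>2)) x\<bar> \<le> A1 * (t + \<theta>\<^sup>2) powr (- s / 2)" using t T x by (intro A1') (auto intro: add_pos_nonneg)
      also have "\<dots> \<le> A1 * (\<theta>\<^sup>2) powr (- s / 2)" using A1 t th s by (intro mult_left_mono powr_mono2') auto
      also have "(\<theta>\<^sup>2) powr (- s / 2) = \<theta> powr (- s)"
        using th by (simp add: powr_powr flip: powr_numeral)
      finally show ?thesis .
    qed
    have Ls: "1 \<le> L powr s" using L s by (intro ge_one_powr_ge_zero) auto
    have N': "N = 3 ^ m * \<theta> powr (- real m)" using th by (simp add: N_def power_divide powr_minus_divide powr_realpow)
    have "\<bar>legsum (kern C q t) x\<bar> \<le> K * (\<theta> powr (- s) * L powr s)"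
    proof (cases "\<gamma> = 1")
      case True
      then have sm: "s = real m" by (simp add: \<gamma>_def)
      have "(ln has_real_derivative u powr (- \<gamma>)) (at u)" if "u > 0" for u
        using DERIV_ln[OF that] that by (simp add: True powr_minus)
      from lem[OF this] have "\<bar>legsum (kern C q t) x\<bar> \<le> A1 * \<theta> powr (- s) + A2 * N * (ln (t + \<theta>\<^sup>2) - ln t)"
        using base by (simp add: right_diff_distrib)
      also have "ln (t + \<theta>\<^sup>2) - ln t \<le> L"
        using T t th by (simp add: L_def ln_div add_pos_nonneg)
      \<comment> \<open>In this case s = m >= 1, so the single logarithm fits under the power
        s.\<close>
      also have "L \<le> L powr s" using powr_mono[of 1 s L] L sm m by simp
      finally have "\<bar>legsum (kern C q t) x\<bar> \<le> A1 * \<theta> powr (- s) + A2 * N * L powr s"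
        using A2 N by (simp add: mult_left_mono)
      also have "A1 * \<theta> powr (- s) \<le> A1 * (\<theta> powr (- s) * L powr s)"
        using mult_left_mono[OF Ls, of "\<theta> powr (- s)"] A1 by (intro mult_left_mono) auto
      finally show ?thesis by (simp add: K_def True N' sm algebra_simps)
    next
      case False
      then have g1: "\<gamma> < 1" using g by simp
      define h where "h u = u powr (1 - \<gamma>) / (1 - \<gamma>)" for u
      have "(h has_real_derivative u powr (- \<gamma>)) (at u)" if "u > 0" for u
      proof -
        have "(h has_real_derivative ((1 - \<gamma>) * u powr (1 - \<gamma> - 1)) / (1 - \<gamma>)) (at u)"
          unfolding h_def using that by (intro DERIV_cdivide has_real_derivative_powr)
        then show ?thesis using g1 by simp
      qed
      from lem[OF this] have "\<bar>legsum (kern C q t) x\<bar> \<le> A1 * \<theta> powr (- s) + A2 * N * (h (t + \<theta>\<^sup>2) - h t)"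
        using base by (simp add: right_diff_distrib)
      also have "h (t + \<theta>\<^sup>2) - h t \<le> h (t + \<theta>\<^sup>2)" using g1 by (simp add: h_def)
      \<comment> \<open>By t <= 2 \<theta>^2 the upper end t + \<theta>^2 is comparable with
        \<theta>^2, and the resulting \<theta>^(m-s) reduces \<theta>^(-m) to \<theta>^(-s).\<close>
      also have "\<dots> \<le> (3 * \<theta>\<^sup>2) powr (1 - \<gamma>) / (1 - \<gamma>)"
        unfolding h_def using g1 t tt by (intro divide_right_mono powr_mono2) auto
      also have "\<dots> = 3 powr (1 - \<gamma>) / (1 - \<gamma>) * \<theta> powr (real m - s)"
      proof -
        have "(\<theta>\<^sup>2) powr (1 - \<gamma>) = \<theta> powr (2 * (1 - \<gamma>))" using th by (simp add: powr_powr flip: powr_numeral)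
        also have "2 * (1 - \<gamma>) = real m - s" by (simp add: \<gamma>_def field_simps)
        finally show ?thesis by (simp add: powr_mult)
      qed
      finally have "\<bar>legsum (kern C q t) x\<bar> \<le> A1 * \<theta> powr (- s) + A2 * N * (3 powr (1 - \<gamma>) / (1 - \<gamma>) * \<theta> powr (real m - s))"
        using A2 N by (simp add: mult_left_mono)
      also have "\<dots> = (A1 + A2 * 3 ^ m * (3 powr (1 - \<gamma>) / (1 - \<gamma>))) * \<theta> powr (- s)"
      proof -
        have "\<theta> powr (- real m) * \<theta> powr (real m - s) = \<theta> powr (- s)" by (simp flip: powr_add)
        then show ?thesis by (simp add: N' algebra_simps)
      qed
      also have "\<dots> \<le> K * \<theta> powr (- s)"
        using A2 by (intro mult_right_mono) (auto simp: K_def False algebra_simps)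
      also have "\<dots> \<le> K * (\<theta> powr (- s) * L powr s)"
        using mult_left_mono[OF Ls, of "\<theta> powr (- s)"] K by (intro mult_left_mono) auto
      finally show ?thesis .
    qed
    also have "\<theta> powr (- s) * L powr s = (L / \<theta>) powr s"
      using th L by (simp add: powr_divide powr_minus_divide)
    finally show ?thesis by (simp add: x_def L_def)
  qed
  then show ?thesis using K by blast
qed

section \<open>Correlation of needlet coefficients\<close>

text \<open>For p >= 1 the value at l = 0 is 0, so sums starting at 1 may be taken over all
  l.\<close>

definition needlet_weight :: "real \<Rightarrow> nat \<Rightarrow> nat \<Rightarrow> nat \<Rightarrow> real" where
  "needlet_weight B p j l = (real (l * (l + 1)) / B ^ (2 * j)) ^ p * exp (- (real (l * (l + 1)) / B ^ (2 * j)))"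

lemma needlet_weight_summable:
  assumes "B > 1" "p \<ge> 1"
  shows "summable (\<lambda>l. \<bar>needlet_weight B p j l\<bar> * (2 * real l + 1))"
proof -
  \<comment> \<open>Summability is borrowed from the kernel with constant spectrum 1, a symbol of
    order 0, at u = B^(-2j).\<close>
  have "symb 0 (- 0) 1 (\<lambda>l. 1)" by (simp add: symb_0)
  from kern_summable(2)[OF this refl assms(2), of "1 / B ^ (2 * j)" 1]
  have "summable (\<lambda>l. \<bar>(2 * real l + 1) * kern (\<lambda>l. 1) p (1 / B ^ (2 * j)) l\<bar> * (1 / B ^ (2 * j)) ^ p)"
    using assms by (intro summable_mult2) simp
  moreover have "\<bar>(2 * real l + 1) * kern (\<lambda>l. 1) p (1 / B ^ (2 * j)) l\<bar> * (1 / B ^ (2 * j)) ^ p = \<bar>needlet_weight B p j l\<bar> * (2 * real l + 1)" for l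
  proof -
    define u L where "u = 1 / B ^ (2 * j)" and "L = real (l * (l + 1))"
    have "L / B ^ (2 * j) = L * u" by (simp add: u_def)
    moreover have "u \<ge> 0" "L \<ge> 0" using assms by (simp_all add: u_def L_def)
    ultimately show ?thesis
      unfolding kern_def needlet_weight_def u_def[symmetric] L_def[symmetric]
      by (simp add: abs_mult power_mult_distrib mult_ac)
  qed
  ultimately show ?thesis by simp
qed

lemma mexican_needlet_eq:
  assumes "B > 1" "p \<ge> 1" "\<xi> \<in> S2" "x \<in> S2"
  shows "mexican_needlet B p j w \<xi> x = complex_of_real (sqrt w * zonal_series (needlet_weight B p j) \<xi> x)"
proof -
  note s = zonal_series_summable[OF needlet_weight_summable[OF assms(1,2)] assms(3,4), of j]
  have "((\<lambda>l. needlet_weight B p j l * zonal l \<xi> x) has_sum zonal_series (needlet_weight B p j) \<xi> x) UNIV"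
    unfolding zonal_series_def by (rule norm_summable_imp_has_sum[OF s summable_sums[OF summable_norm_cancel[OF s]]])
  then have "((\<lambda>l. complex_of_real (needlet_weight B p j l * zonal l \<xi> x)) has_sum complex_of_real (zonal_series (needlet_weight B p j) \<xi> x)) UNIV"
    by (rule has_sum_of_real)
  also have "?this \<longleftrightarrow> ((\<lambda>l. complex_of_real ((real (l * (l + 1)) / B ^ (2 * j)) ^ p * exp (- (real (l * (l + 1)) / B ^ (2 * j))))
        * (\<Sum>m=-int l..int l. sph_harm l m \<xi> * cnj (sph_harm l m x))) has_sum complex_of_real (zonal_series (needlet_weight B p j) \<xi> x)) {1..}"
  proof (rule has_sum_cong_neutral)
    fix l :: nat assume "l \<in> UNIV - {1..}"
    then have "l = 0" by auto
    then show "complex_of_real (needlet_weight B p j l * zonal l \<xi> x) = 0" using assms(2) by (simp add: needlet_weight_def)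
  qed (auto simp: needlet_weight_def zonal_sph_harm[OF assms(3,4), symmetric])
  finally show ?thesis unfolding mexican_needlet_def by (simp only: infsumI of_real_mult)
qed

lemma (in second_order_field) needlet_coeff_eq:
  assumes "B > 1" "p \<ge> 1" "\<xi> \<in> S2"
  shows "needlet_coeff T B p j w \<xi> = (\<lambda>\<omega>. sqrt w * smear (zonal_series (needlet_weight B p j) \<xi>) \<omega>)"
proof
  fix \<omega>
  have "(\<integral>x. complex_of_real (T x \<omega>) * mexican_needlet B p j w \<xi> x \<partial>surface_measure)
    = (\<integral>x. complex_of_real (sqrt w * (T x \<omega> * zonal_series (needlet_weight B p j) \<xi> x)) \<partial>surface_measure)"
    using mexican_needlet_eq[OF assms] by (intro Bochner_Integration.integral_cong refl) simp
  also have "\<dots> = complex_of_real (\<integral>x. sqrt w * (T x \<omega> * zonal_series (needlet_weight B p j) \<xi> x) \<partial>surface_measure)"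
    by (rule integral_complex_of_real)
  finally show "needlet_coeff T B p j w \<xi> \<omega> = sqrt w * smear (zonal_series (needlet_weight B p j) \<xi>) \<omega>"
    by (simp add: needlet_coeff_def smear_def)
qed

text \<open>Removes the cubature weights, so that the final constant does not depend on
  them.\<close>

lemma corr_scale:
  assumes "a > 0" "b > 0"
  shows "corr P (\<lambda>\<omega>. a * X \<omega>) (\<lambda>\<omega>. b * Y \<omega>) = corr P X Y"
proof -
  have "(\<integral>\<omega>. (a * X \<omega>) * (b * Y \<omega>) \<partial>P) = (a * b) * (\<integral>\<omega>. X \<omega> * Y \<omega> \<partial>P)"
    by (simp add: mult_ac flip: integral_mult_right_zero)
  moreover have "(\<integral>\<omega>. (a * X \<omega>)\<^sup>2 \<partial>P) * (\<integral>\<omega>. (b * Y \<omega>)\<^sup>2 \<partial>P) = (a * b)\<^sup>2 * ((\<integral>\<omega>. (X \<omega>)\<^sup>2 \<partial>P) * (\<integral>\<omega>. (Y \<omega>)\<^sup>2 \<partial>P))"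
    by (simp add: power_mult_distrib)
  ultimately show ?thesis
    using assms by (simp only: corr_def real_sqrt_mult) simp
qed

text \<open>At x = 1 all terms are nonnegative, so a block n <= l < 2n with n slightly above R
  suffices: at least R terms, each at least a multiple of R^(2q+1-\<alpha>). The argument 2 / R^2 is
  the value of t for two equal scales with R = B^j. On the block l <= 6R, which gives 84 = 6 * 7 * 2
  in the exponential.\<close>

lemma kern_lower:
  assumes C: "\<And>l. C l \<ge> 0" "\<And>l. l \<ge> 2 \<Longrightarrow> C l \<ge> c * real l powr (- \<alpha>)" and c: "c > 0" and \<alpha>: "\<alpha> > 0"
    and G: "symb M (- \<alpha>) A0 G" "\<And>l. l \<ge> 1 \<Longrightarrow> G l = C l" and q: "q \<ge> 1"
  shows "\<exists>c'>0. \<forall>R\<ge>1. legsum (kern C q (2 / R\<^sup>2)) 1 \<ge> c' * R powr (2 * real q + 2 - \<alpha>)"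
proof -
  define c' where "c' = exp (- 84) * (c * 6 powr (- \<alpha>))"
  have "legsum (kern C q (2 / R\<^sup>2)) 1 \<ge> c' * R powr (2 * real q + 2 - \<alpha>)" if R: "R \<ge> 1" for R
  proof -
    define n where "n = nat \<lceil>R\<rceil> + 1"
    have n: "R \<le> real n" "real n \<le> R + 2" "n \<ge> 2" using R by (auto simp: n_def le_nat_iff) linarith+
    define f where "f l = (2 * real l + 1) * kern C q (2 / R\<^sup>2) l" for l
    have f0: "f l \<ge> 0" for l using C(1)[of l] by (simp add: f_def kern_def)
    have fs: "summable f" unfolding f_def using kern_summable(1)[OF G q, of "2 / R\<^sup>2" 1] R legendre_at_1 by simp
    have le_f: "c' * R powr (2 * real q + 1 - \<alpha>) \<le> f l" if l: "l \<in> {n..<2 * n}" for l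
    proof -
      have lR: "R \<le> real l" "real l \<le> 6 * R" "l \<ge> 2" using l n R by auto
      have "R * R \<le> real (l * (l + 1))"
        unfolding of_nat_mult using lR R by (intro mult_mono) auto
      then have 1: "(R * R) ^ q \<le> real (l * (l + 1)) ^ q" using R by (intro power_mono) auto
      have "real (l * (l + 1)) \<le> (6 * R) * (7 * R)"
        unfolding of_nat_mult using lR R by (intro mult_mono) auto
      then have "real (l * (l + 1)) * (2 / R\<^sup>2) \<le> (6 * R) * (7 * R) * (2 / R\<^sup>2)" by (intro mult_right_mono) auto
      also have "\<dots> = 84" using R by (simp add: power2_eq_square)
      finally have 2: "exp (- 84) \<le> exp (- (real (l * (l + 1)) * (2 / R\<^sup>2)))" by simp
      have "c * (6 * R) powr (- \<alpha>) \<le> c * real l powr (- \<alpha>)" using lR R c \<alpha> by (intro mult_left_mono powr_mono2') auto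
      then have 3: "c * (6 * R) powr (- \<alpha>) \<le> C l" using C(2)[OF lR(3)] by linarith
      have "R * ((R * R) ^ q * exp (- 84) * (c * (6 * R) powr (- \<alpha>))) \<le> f l"
        unfolding f_def kern_def using lR R c 1 2 3 by (intro mult_mono mult_nonneg_nonneg) auto
      moreover have "R * ((R * R) ^ q * exp (- 84) * (c * (6 * R) powr (- \<alpha>))) = c' * (R powr 1 * R powr (2 * real q) * R powr (- \<alpha>))"
      proof -
        have "(R * R) ^ q = R powr (2 * real q)"
          using R powr_realpow[of R "2 * q"] by (simp add: power_mult power2_eq_square)
        then show ?thesis using R by (simp add: c'_def powr_mult mult_ac)
      qed
      ultimately show ?thesis unfolding powr_add[symmetric] by (simp add: algebra_simps)
    qed
    have "c' * R powr (2 * real q + 2 - \<alpha>) = R * (c' * R powr (2 * real q + 1 - \<alpha>))"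
      using R powr_add[of R 1 "2 * real q + 1 - \<alpha>"] by (simp add: algebra_simps)
    also have "\<dots> \<le> real n * (c' * R powr (2 * real q + 1 - \<alpha>))"
      using n c by (intro mult_right_mono) (auto simp: c'_def)
    also have "\<dots> = (\<Sum>l\<in>{n..<2 * n}. c' * R powr (2 * real q + 1 - \<alpha>))" by simp
    also have "\<dots> \<le> (\<Sum>l\<in>{n..<2 * n}. f l)" by (intro sum_mono le_f)
    also have "\<dots> \<le> (\<Sum>l. f l)" using fs f0 by (intro sum_le_suminf) auto
    also have "\<dots> = legsum (kern C q (2 / R\<^sup>2)) 1" using legendre_at_1 by (simp add: legsum_def f_def)
    finally show ?thesis .
  qed
  moreover have "c' > 0" using c by (simp add: c'_def)
  ultimately show ?thesis by blast
qed

text \<open>The regularity condition with base 2 and its lower bound 1 / c 0 on g_j; the windows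
  with j >= 1 reach every l >= 2.\<close>

lemma regularity_condition_lower:
  assumes "regularity_condition \<alpha> M C"
  shows "\<exists>c>0. \<forall>l\<ge>2. C l \<ge> c * real l powr (- \<alpha>)"
proof -
  define b :: real where "b = 2"
  have b: "b > 1" by (simp add: b_def)
  obtain g D c where c: "\<And>r. r \<le> M \<Longrightarrow> c r > (0::real)"
    and Cg: "\<And>j l. j \<ge> 1 \<Longrightarrow> b ^ (j - 1) < real l \<Longrightarrow> real l < b ^ (j + 1) \<Longrightarrow> C l = real l powr (-\<alpha>) * g j (real l / b ^ j) \<and> C l > 0"
    and g0: "\<And>j u. j \<ge> 1 \<Longrightarrow> u \<in> {1/b..b} \<Longrightarrow> 1 / c 0 \<le> g j u \<and> g j u \<le> c 0"
    and "\<And>j. j \<ge> 1 \<Longrightarrow> D j (0::nat) = g j"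
    using assms b unfolding regularity_condition_def by (elim allE[of _ b]) (elim impE exE conjE, assumption, blast)
  have "C l \<ge> 1 / c 0 * real l powr (- \<alpha>)" if l: "l \<ge> 2" for l
  proof -
    obtain j where j: "j \<ge> 1" "2 ^ (j - 1) < real l" "real l \<le> 2 ^ j"
      using dyadic_index[OF _ l, of 2] by auto
    have "real l < 2 ^ (j + 1)" using j(3) by (rule order.strict_trans1) simp
    then have Cl: "C l = real l powr (-\<alpha>) * g j (real l / 2 ^ j)" using Cg[OF j(1)] j(2) by (simp add: b_def)
    have "(2::real) ^ j = 2 * 2 ^ (j - 1)" using j(1) by (cases j) auto
    then have "real l / 2 ^ j \<in> {1/2..2}" using j by (auto simp: field_simps)
    then have "1 / c 0 \<le> g j (real l / 2 ^ j)" using g0[OF j(1), unfolded b_def] by blast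
    from mult_left_mono[OF this, of "real l powr (- \<alpha>)"] show ?thesis unfolding Cl by (simp add: mult.commute)
  qed
  moreover have "1 / c 0 > 0" using c[of 0] by simp
  ultimately show ?thesis by blast
qed

text \<open>The covariance function of the field is the zonal series with coefficients C, so
  integrating both test functions against it amounts to two convolutions.\<close>

lemma (in second_order_field) smear_zonal_covariance:
  assumes a: "harmonic_coefficients P C a" and rep: "spectral_representation P T a"
    and C: "\<And>l. C l \<ge> 0" "summable (\<lambda>l. \<bar>C l\<bar> * (2 * real l + 1))"
    and b: "summable (\<lambda>l. \<bar>b l\<bar> * (2 * real l + 1))" and b': "summable (\<lambda>l. \<bar>b' l\<bar> * (2 * real l + 1))"
    and \<xi>: "\<xi> \<in> S2" and \<eta>: "\<eta> \<in> S2"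
  shows "(\<integral>\<omega>. smear (zonal_series b \<xi>) \<omega> * smear (zonal_series b' \<eta>) \<omega> \<partial>P) = zonal_series (\<lambda>l. b l * (b' l * C l)) \<xi> \<eta>"
proof -
  have cov: "(\<integral>\<omega>. T y \<omega> * T x \<omega> \<partial>P) = zonal_series C x y" if "x \<in> S2" "y \<in> S2" for x y
    using covariance_expansion[OF a rep T_measurable T_square that]
    by (simp add: zonal_series_def sums_iff mult.commute)
  have b'C: "summable (\<lambda>l. \<bar>b' l * C l\<bar> * (2 * real l + 1))"
  proof (rule summable_comparison_test')
    define K where "K = (\<Sum>l. \<bar>b' l\<bar> * (2 * real l + 1))"
    show "summable (\<lambda>l. K * (\<bar>C l\<bar> * (2 * real l + 1)))" by (rule summable_mult[OF C(2)])
    fix l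
    have "\<bar>b' l\<bar> * 1 \<le> \<bar>b' l\<bar> * (2 * real l + 1)" by (intro mult_left_mono) auto
    also have "\<dots> \<le> K" unfolding K_def using sum_le_suminf[OF b', of "{l}"] by simp
    finally have "\<bar>b' l\<bar> * (\<bar>C l\<bar> * (2 * real l + 1)) \<le> K * (\<bar>C l\<bar> * (2 * real l + 1))" by (intro mult_right_mono) auto
    then show "norm (\<bar>b' l * C l\<bar> * (2 * real l + 1)) \<le> K * (\<bar>C l\<bar> * (2 * real l + 1))" by (simp add: abs_mult mult.assoc)
  qed
  have "(\<integral>\<omega>. smear (zonal_series b \<xi>) \<omega> * smear (zonal_series b' \<eta>) \<omega> \<partial>P)
    = (\<integral>x. zonal_series b \<xi> x * (\<integral>y. zonal_series b' \<eta> y * (\<integral>\<omega>. T y \<omega> * T x \<omega> \<partial>P) \<partial>surface_measure) \<partial>surface_measure)"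
    by (rule smear_covariance[OF zonal_series_measurable_surface zonal_series_bound[OF b \<xi>] zonal_series_measurable_surface zonal_series_bound[OF b' \<eta>]])
  also have "\<dots> = (\<integral>x. zonal_series b \<xi> x * zonal_series (\<lambda>l. b' l * C l) \<eta> x \<partial>surface_measure)"
  proof (rule Bochner_Integration.integral_cong[OF refl])
    fix x assume "x \<in> space surface_measure"
    then have x: "x \<in> S2" by simp
    have "(\<integral>y. zonal_series b' \<eta> y * (\<integral>\<omega>. T y \<omega> * T x \<omega> \<partial>P) \<partial>surface_measure) = (\<integral>y. zonal_series b' \<eta> y * zonal_series C x y \<partial>surface_measure)"
      by (rule Bochner_Integration.integral_cong[OF refl]) (simp add: cov[OF x])
    then show "zonal_series b \<xi> x * (\<integral>y. zonal_series b' \<eta> y * (\<integral>\<omega>. T y \<omega> * T x \<omega> \<partial>P) \<partial>surface_measure)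
        = zonal_series b \<xi> x * zonal_series (\<lambda>l. b' l * C l) \<eta> x"
      using zonal_series_convolution[OF b' C(2) \<eta> x] by simp
  qed
  also have "\<dots> = zonal_series (\<lambda>l. b l * (b' l * C l)) \<xi> \<eta>" by (rule zonal_series_convolution[OF b b'C \<xi> \<eta>])
  finally show ?thesis .
qed

text \<open>The two Gaussians multiply to one with parameter B^(-2i) + B^(-2j), and the powers leave
  the prefactor B^(-2p(i+j)), which later cancels against the variances.\<close>

lemma zonal_series_needlet_weights:
  assumes G: "symb M (- \<alpha>) A0 G" "\<And>l. l \<ge> 1 \<Longrightarrow> G l = C l" and "B > 1" "p \<ge> 1" "\<xi> \<in> S2" "\<eta> \<in> S2"
  shows "zonal_series (\<lambda>l. needlet_weight B p i l * (needlet_weight B p j l * C l)) \<xi> \<eta>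
    = 1 / (4 * pi * B ^ (2 * p * (i + j))) * legsum (kern C (2 * p) (1 / B ^ (2 * i) + 1 / B ^ (2 * j))) (\<xi> \<bullet> \<eta>)"
proof -
  define t where "t = 1 / B ^ (2 * i) + 1 / B ^ (2 * j)"
  have t: "t > 0" using assms by (simp add: t_def add_pos_pos)
  have x: "\<bar>\<xi> \<bullet> \<eta>\<bar> \<le> 1" using Cauchy_Schwarz_ineq2[of \<xi> \<eta>] assms by simp
  have eq: "needlet_weight B p i l * (needlet_weight B p j l * C l) * zonal l \<xi> \<eta>
      = 1 / (4 * pi * B ^ (2 * p * (i + j))) * ((2 * real l + 1) * kern C (2 * p) t l * leg 0 l (\<xi> \<bullet> \<eta>))" for l
  proof -
    define L where "L = real (l * (l + 1))"
    have e: "exp (- (L * t)) = exp (- (L / B ^ (2 * i))) * exp (- (L / B ^ (2 * j)))"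
      by (simp add: t_def exp_add[symmetric] algebra_simps)
    have pw: "(L / B ^ (2 * i)) ^ p * (L / B ^ (2 * j)) ^ p = L ^ (2 * p) / B ^ (2 * p * (i + j))"
    proof -
      have "(B ^ (2 * i)) ^ p * (B ^ (2 * j)) ^ p = B ^ (2 * p * (i + j))"
        unfolding power_mult[symmetric] power_add[symmetric] by (rule arg_cong[where f = "power B"]) (simp add: algebra_simps)
      moreover have "L ^ p * L ^ p = L ^ (2 * p)" by (simp add: power_add[symmetric] mult_2)
      ultimately show ?thesis by (simp add: power_divide)
    qed
    have "needlet_weight B p i l * needlet_weight B p j l = ((L / B ^ (2 * i)) ^ p * (L / B ^ (2 * j)) ^ p)
        * (exp (- (L / B ^ (2 * i))) * exp (- (L / B ^ (2 * j))))"
      unfolding needlet_weight_def L_def[symmetric] by (simp only: mult_ac)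
    then have "needlet_weight B p i l * needlet_weight B p j l = L ^ (2 * p) * exp (- (L * t)) / B ^ (2 * p * (i + j))"
      unfolding pw e[symmetric] by simp
    then have "(needlet_weight B p i l * needlet_weight B p j l) * C l = kern C (2 * p) t l / B ^ (2 * p * (i + j))"
      unfolding kern_def L_def[symmetric] by simp
    then have "needlet_weight B p i l * (needlet_weight B p j l * C l) = kern C (2 * p) t l / B ^ (2 * p * (i + j))"
      by (simp only: mult.assoc)
    then show ?thesis by (simp add: zonal_def mult_ac)
  qed
  have "summable (\<lambda>l. (2 * real l + 1) * kern C (2 * p) t l * leg 0 l (\<xi> \<bullet> \<eta>))"
    using assms t x by (intro kern_summable(1)[OF G]) auto
  then show ?thesis unfolding zonal_series_def legsum_def t_def[symmetric] eq by (rule suminf_mult)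
qed


text \<open>Combines localization for angles beyond J / N with the trivial bound for smaller ones.
  Here N = B^(min i j) is the coarser scale, which governs t, and J = (i + j) / 2 dominates the
  logarithm up to a constant.\<close>

lemma kern_localization_scales:
  fixes B :: real
  assumes G: "symb M (- \<alpha>) A0 G" "\<And>l. l \<ge> 1 \<Longrightarrow> G l = C l" and q: "q \<ge> 1"
    and s: "s = 2 * real q + 2 - \<alpha>" "s > 0" "real M \<ge> s" and B: "B > 1"
  shows "\<exists>D>0. \<forall>i\<ge>1. \<forall>j\<ge>1. \<forall>x. \<bar>x\<bar> \<le> 1 \<longrightarrow>
    \<bar>legsum (kern C q (1 / B ^ (2 * i) + 1 / B ^ (2 * j))) x\<bar>
    \<le> D * (B ^ min i j / (1 + B ^ min i j * arccos x / (real (i + j) / 2))) powr s"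
proof -
  obtain A where A: "A > 0" "\<And>t \<theta>. 0 < t \<Longrightarrow> t \<le> 2 \<Longrightarrow> 0 < \<theta> \<Longrightarrow> \<theta> \<le> pi \<Longrightarrow> t \<le> 2 * \<theta>\<^sup>2 \<Longrightarrow>
    \<bar>legsum (kern C q t) (cos \<theta>)\<bar> \<le> A * (ln (13 / t) / \<theta>) powr s"
    using kern_localization[OF G q s] by blast
  obtain A1 where A1: "A1 > 0" "\<And>u x. 0 < u \<Longrightarrow> u \<le> 2 \<Longrightarrow> \<bar>x\<bar> \<le> 1 \<Longrightarrow>
      sqrt (1 - x) ^ 0 * \<bar>legsum (kern C q u) x\<bar> \<le> A1 * u powr (- (2 * real q - \<alpha> + 2 - real 0) / 2)"
    using kern_decay[OF G q, of 2 0] s by auto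
  define c0 where "c0 = ln 13 + 2 * ln B"
  have c0: "c0 > 0" using B by (simp add: c0_def add_pos_pos)
  define D where "D = A * (2 * c0) powr s + A1 * 2 powr s"
  show ?thesis
  proof (intro exI[of _ D] conjI allI impI)
    show "D > 0" using A A1 c0 by (simp add: D_def add_pos_pos)
    fix i j :: nat and x :: real
    assume i: "i \<ge> 1" and j: "j \<ge> 1" and x: "\<bar>x\<bar> \<le> 1"
    define n where "n = min i j"
    define N where "N = B ^ n"
    define J where "J = real (i + j) / 2"
    define t where "t = 1 / B ^ (2 * i) + 1 / B ^ (2 * j)"
    define \<theta> where "\<theta> = arccos x"
    have th: "0 \<le> \<theta>" "\<theta> \<le> pi" "cos \<theta> = x" using x by (auto simp: \<theta>_def arccos_lbound arccos_ubound)
    have N: "N \<ge> 1" using B by (simp add: N_def)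
    have J: "J \<ge> 1" "real n \<le> J" using i j by (auto simp: J_def n_def)
    have N2: "B ^ (2 * n) = N\<^sup>2" by (simp add: N_def power_mult[symmetric] mult.commute)
    have t1: "1 / N\<^sup>2 \<le> t"
    proof (cases "i \<le> j")
      case True
      then show ?thesis using B by (simp add: t_def N2[symmetric] n_def)
    next
      case False
      then show ?thesis using B by (simp add: t_def N2[symmetric] n_def)
    qed
    have "1 / B ^ (2 * k) \<le> 1 / N\<^sup>2" if "k \<ge> n" for k
      unfolding N2[symmetric] using B that by (intro divide_left_mono power_increasing) auto
    from this[of i] this[of j] have t2: "t \<le> 2 / N\<^sup>2" by (simp add: t_def n_def)
    have N2': "N\<^sup>2 \<ge> 1" using N by simp
    have t0: "t > 0" using t1 N by (intro order.strict_trans2[OF _ t1]) simp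
    have "2 / N\<^sup>2 \<le> 2 / 1" using N2' by (intro divide_left_mono) auto
    then have t3: "t \<le> 2" using t2 by linarith
    define Z where "Z = N / (1 + N * \<theta> / J)"
    have dpos: "1 + N * \<theta> / J > 0" using N th J by (intro add_pos_nonneg) auto
    have Z: "Z > 0" using N dpos by (simp add: Z_def)
    have "\<bar>legsum (kern C q t) x\<bar> \<le> D * Z powr s"
    \<comment> \<open>The threshold is J and not 1: for N \<theta> >= J the quantities J / \<theta>
      and Z agree up to a factor 2, and for N \<theta> < J so do N and Z.\<close>
    proof (cases "N * \<theta> \<ge> J")
      case True
      then have "N * \<theta> \<ge> 1" using J by linarith
      then have th0: "\<theta> > 0" using th N by (cases "\<theta> = 0") auto
      have "1 \<le> (N * \<theta>)\<^sup>2" using \<open>N * \<theta> \<ge> 1\<close> by simp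
      then have "2 / N\<^sup>2 \<le> 2 * \<theta>\<^sup>2" using N by (simp add: power_mult_distrib field_simps)
      then have "t \<le> 2 * \<theta>\<^sup>2" using t2 by linarith
      from A(2)[OF t0 t3 th0 th(2) this]
      have "\<bar>legsum (kern C q t) x\<bar> \<le> A * (ln (13 / t) / \<theta>) powr s" by (simp add: th)
      also have "\<dots> \<le> A * (2 * c0 * Z) powr s"
      proof (intro mult_left_mono powr_mono2)
        \<comment> \<open>From t >= N^(-2) the logarithm is at most ln 13 + 2 n ln B, hence linear
          in the scales; n <= J and 1 <= J then give c0 J.\<close>
        have "13 / t \<le> 13 * N\<^sup>2" using t1 t0 N by (simp add: field_simps)
        then have "ln (13 / t) \<le> ln (13 * N\<^sup>2)" using t0 by (intro ln_mono) auto
        also have "\<dots> = ln 13 + 2 * (real n * ln B)"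
          using N B by (simp add: ln_mult ln_realpow N_def power_mult[symmetric])
        also have "\<dots> \<le> ln 13 * J + 2 * (J * ln B)"
          using J B by (intro add_mono mult_left_mono mult_right_mono) auto
        also have "\<dots> = c0 * J" by (simp add: c0_def algebra_simps)
        finally have "ln (13 / t) / \<theta> \<le> c0 * J / \<theta>" using th0 by (intro divide_right_mono) auto
        also have "\<dots> = c0 * (J / \<theta>)" by simp
        also have "J / \<theta> \<le> 2 * Z"
        proof -
          have "J * (1 + N * \<theta> / J) \<le> 2 * N * \<theta>" using True J by (simp add: field_simps)
          then show ?thesis unfolding Z_def using th0 dpos by (simp add: field_simps)
        qed
        finally show "ln (13 / t) / \<theta> \<le> 2 * c0 * Z" using c0 by simp
        show "0 \<le> ln (13 / t) / \<theta>" using t0 t3 th0 by simp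
      qed (use A s in auto)
      also have "\<dots> = A * (2 * c0) powr s * Z powr s" using c0 Z by (simp add: powr_mult)
      also have "\<dots> \<le> D * Z powr s" using A1 by (intro mult_right_mono) (auto simp: D_def)
      finally show ?thesis .
    next
      case False
      have "\<bar>legsum (kern C q t) x\<bar> \<le> A1 * t powr (- s / 2)"
        using A1(2)[OF t0 t3 x] by (simp add: s algebra_simps)
      also have "\<dots> \<le> A1 * (1 / N\<^sup>2) powr (- s / 2)"
        using A1 t1 N s by (intro mult_left_mono powr_mono2') auto
      also have "(1 / N\<^sup>2) powr (- s / 2) = N powr s"
      proof -
        have "1 / N\<^sup>2 = N powr (- 2)" using N by (simp add: powr_minus_divide)
        then show ?thesis by (simp add: powr_powr)
      qed
      also have "A1 * N powr s \<le> A1 * (2 * Z) powr s"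
      proof (intro mult_left_mono powr_mono2)
        have "N * \<theta> / J \<le> 1" using False J by simp
        then have "N * (1 + N * \<theta> / J) \<le> N * 2" using N by (intro mult_left_mono) auto
        then show "N \<le> 2 * Z" unfolding Z_def using dpos by (simp add: field_simps)
      qed (use A1 s N in auto)
      also have "\<dots> = A1 * 2 powr s * Z powr s" using Z by (simp add: powr_mult)
      also have "\<dots> \<le> D * Z powr s" using A c0 by (intro mult_right_mono) (auto simp: D_def)
      finally show ?thesis .
    qed
    then show "\<bar>legsum (kern C q (1 / B ^ (2 * i) + 1 / B ^ (2 * j))) x\<bar>
      \<le> D * (B ^ min i j / (1 + B ^ min i j * arccos x / (real (i + j) / 2))) powr s"
      by (simp only: Z_def N_def n_def t_def \<theta>_def J_def)
  qed
qed


theorem theorem3: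
  fixes P :: "'w measure"
    and T :: "real^3 \<Rightarrow> 'w \<Rightarrow> real"
    and a :: "nat \<Rightarrow> int \<Rightarrow> 'w \<Rightarrow> complex"
    and C :: "nat \<Rightarrow> real"
    and B \<alpha> :: real
    and p M :: nat
    and K :: "nat \<Rightarrow> 'k set"
    and \<xi> :: "nat \<Rightarrow> 'k \<Rightarrow> real^3"
    and w :: "nat \<Rightarrow> 'k \<Rightarrow> real"
  assumes "B > 1"
    and "p \<ge> 1"
    and "isotropic_random_field P T"
    and "harmonic_coefficients P C a"
    and "spectral_representation P T a"
    and "\<alpha> > 2"
    and "regularity_condition \<alpha> M C"
    and "\<alpha> < 4 * real p + 2"
    and "real M \<ge> 4 * real p + 2 - \<alpha>"
    and "\<And>j. j \<ge> 1 \<Longrightarrow> finite (K j)"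
    and "\<And>j k. j \<ge> 1 \<Longrightarrow> k \<in> K j \<Longrightarrow> \<xi> j k \<in> S2"
    and "\<And>j k. j \<ge> 1 \<Longrightarrow> k \<in> K j \<Longrightarrow> w j k > 0"
  shows "\<exists>C\<^sub>M>0. \<forall>j1\<ge>1. \<forall>j2\<ge>1. \<forall>k1\<in>K j1. \<forall>k2\<in>K j2.
    \<bar>corr P (needlet_coeff T B p j1 (w j1 k1) (\<xi> j1 k1))
            (needlet_coeff T B p j2 (w j2 k2) (\<xi> j2 k2))\<bar>
    \<le> C\<^sub>M / (1 + B powr (real (j1 + j2) / 2 - log B (real (j1 + j2) / 2))
                  * sphere_dist (\<xi> j1 k1) (\<xi> j2 k2)) powr (4 * real p + 2 - \<alpha>)"
proof -
  define s where "s = 4 * real p + 2 - \<alpha>"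
  have s: "s > 0" "s = 2 * real (2 * p) + 2 - \<alpha>" "real M \<ge> s" and \<alpha>: "\<alpha> > 0"
    using assms by (simp_all add: s_def)
  have q: "2 * p \<ge> 1" using \<open>p \<ge> 1\<close> by simp
  note B = \<open>B > 1\<close>
  obtain A0 G where "symb M (- \<alpha>) A0 G" and "\<forall>l\<ge>1. G l = C l"
    using regularity_condition_symb[OF assms(7) \<alpha>] by blast
  then have G: "symb M (- \<alpha>) A0 G" "\<And>l. l \<ge> 1 \<Longrightarrow> G l = C l" by auto
  have C0: "C l \<ge> 0" for l
  proof -
    have "(\<integral>\<omega>. (cmod (a l 0 \<omega>))\<^sup>2 \<partial>P) = C l" using assms(4) by (simp add: harmonic_coefficients_def)
    moreover have "(\<integral>\<omega>. (cmod (a l 0 \<omega>))\<^sup>2 \<partial>P) \<ge> 0" by (rule integral_nonneg_AE) simp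
    ultimately show ?thesis by simp
  qed
  have joint: "(\<lambda>(x, \<omega>). T x \<omega>) \<in> borel_measurable (restrict_space borel S2 \<Otimes>\<^sub>M P)"
    and T2: "\<And>x. x \<in> S2 \<Longrightarrow> integrable P (\<lambda>\<omega>. (T x \<omega>)\<^sup>2)" and P: "prob_space P"
    using assms(3) by (auto simp: isotropic_random_field_def)
  have Tm: "T x \<in> borel_measurable P" if "x \<in> S2" for x
    using measurable_Pair2[OF joint, of x] that by (simp add: space_restrict_space)
  have var: "(\<lambda>l. C l * ((2 * real l + 1) / (4 * pi))) sums (\<integral>\<omega>. (T x \<omega>)\<^sup>2 \<partial>P)" if x: "x \<in> S2" for x
  proof -
    have "x \<bullet> x = 1" using x by (simp add: dot_square_norm)
    then show ?thesis
      using covariance_expansion[OF assms(4,5) Tm T2 x x] legendre_at_1 by (simp add: zonal_def power2_eq_square)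
  qed
  \<comment> \<open>The variance is the same at every point because P_l(1) = 1. Convergence of this
    series, with C >= 0, also gives the absolute summability of the spectrum.\<close>
  define v where "v = (\<Sum>l. C l * ((2 * real l + 1) / (4 * pi)))"
  interpret F: second_order_field P T v
  proof (rule second_order_field.intro[OF P], unfold_locales)
    show "(\<lambda>(x, \<omega>). T x \<omega>) \<in> borel_measurable (surface_measure \<Otimes>\<^sub>M P)"
      using joint by (simp cong: measurable_cong_sets sets_pair_measure_cong)
    show "(\<integral>\<omega>. (T x \<omega>)\<^sup>2 \<partial>P) \<le> v" if "x \<in> S2" for x
      using var[OF that] by (simp add: v_def sums_iff)
  qed (rule T2)
  have "summable (\<lambda>l. C l * ((2 * real l + 1) / (4 * pi)))"
    using var[of "axis 1 1"] by (auto simp: sums_iff)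
  from summable_mult[OF this, of "4 * pi"] have Cs: "summable (\<lambda>l. \<bar>C l\<bar> * (2 * real l + 1))"
    using C0 by simp
  obtain D where D: "D > 0" "\<And>i j x. i \<ge> 1 \<Longrightarrow> j \<ge> 1 \<Longrightarrow> \<bar>x\<bar> \<le> 1 \<Longrightarrow>
    \<bar>legsum (kern C (2 * p) (1 / B ^ (2 * i) + 1 / B ^ (2 * j))) x\<bar>
    \<le> D * (B ^ min i j / (1 + B ^ min i j * arccos x / (real (i + j) / 2))) powr s"
    using kern_localization_scales[OF G q s(2,1,3) B] by blast
  obtain c where c: "c > 0" "\<And>l. l \<ge> 2 \<Longrightarrow> C l \<ge> c * real l powr (- \<alpha>)"
    using regularity_condition_lower[OF assms(7)] by blast
  obtain c' where c': "c' > 0" "\<And>R. R \<ge> 1 \<Longrightarrow> legsum (kern C (2 * p) (2 / R\<^sup>2)) 1 \<ge> c' * R powr s"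
    using kern_lower[OF C0 c(2) c(1) \<alpha> G q] unfolding s(2) by blast
  note ws = needlet_weight_summable[OF B \<open>p \<ge> 1\<close>]
  show ?thesis
  proof (intro exI[of _ "D / c'"] conjI allI impI ballI)
    show "D / c' > 0" using D c' by simp
    fix j1 j2 :: nat and k1 k2
    assume j: "j1 \<ge> 1" "j2 \<ge> 1" and k: "k1 \<in> K j1" "k2 \<in> K j2"
    define x y where "x = \<xi> j1 k1" and "y = \<xi> j2 k2"
    have xy: "x \<in> S2" "y \<in> S2" using assms(11) j k by (auto simp: x_def y_def)
    have w: "w j1 k1 > 0" "w j2 k2 > 0" using assms(12) j k by auto
    have dot: "\<bar>x \<bullet> y\<bar> \<le> 1" using Cauchy_Schwarz_ineq2[of x y] xy by simp
    have self: "z \<bullet> z = 1" if "z \<in> S2" for z :: "real^3" using that by (simp add: dot_square_norm)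
    \<comment> \<open>The needlet coefficient at scale i and centre z without its cubature
      weight.\<close>
    define \<beta> where "\<beta> i z = F.smear (zonal_series (needlet_weight B p i) z)" for i z
    define t where "t i j = 1 / B ^ (2 * i) + 1 / B ^ (2 * j)" for i j
    have E: "(\<integral>\<omega>. \<beta> i z \<omega> * \<beta> i' z' \<omega> \<partial>P)
        = 1 / (4 * pi * B ^ (2 * p * (i + i'))) * legsum (kern C (2 * p) (t i i')) (z \<bullet> z')"
      if "z \<in> S2" "z' \<in> S2" for i i' z z'
      unfolding \<beta>_def t_def F.smear_zonal_covariance[OF assms(4,5) C0 Cs ws ws that]
      by (rule zonal_series_needlet_weights[OF G B \<open>p \<ge> 1\<close> that])
    have V: "(\<integral>\<omega>. (\<beta> i z \<omega>)\<^sup>2 \<partial>P) \<ge> 1 / (4 * pi * B ^ (2 * p * (i + i))) * (c' * (B ^ i) powr s)"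
      if "z \<in> S2" for i z
    proof -
      have "t i i = 2 / (B ^ i)\<^sup>2" by (simp add: t_def power_mult[symmetric] mult.commute)
      moreover have "(1::real) \<le> B ^ i" using B by simp
      ultimately have "c' * (B ^ i) powr s \<le> legsum (kern C (2 * p) (t i i)) 1" using c'(2) by simp
      then show ?thesis
        unfolding power2_eq_square E[OF that that] self[OF that] using B by (intro mult_left_mono) auto
    qed
    define N X J \<theta> where "N = B ^ min j1 j2" and "X = B powr (real (j1 + j2) / 2)" and "J = real (j1 + j2) / 2"
      and "\<theta> = sphere_dist x y"
    define b where "b = 4 * pi * B ^ (2 * p * (j1 + j2))"
    have b: "b > 0" using B by (simp add: b_def)
    have X: "X > 0" using B by (simp add: X_def)
    have "B powr real (min j1 j2) \<le> X" unfolding X_def using B by (intro powr_mono) auto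
    then have NX: "N \<le> X" using B by (simp add: N_def powr_realpow)
    have N: "N > 0" using B by (simp add: N_def)
    have J: "J \<ge> 1" using j by (simp add: J_def)
    have th: "\<theta> \<ge> 0" using dot by (simp add: \<theta>_def sphere_dist_def arccos_lbound)
    have num: "\<bar>\<integral>\<omega>. \<beta> j1 x \<omega> * \<beta> j2 y \<omega> \<partial>P\<bar> \<le> 1 / b * (D * (N / (1 + N * \<theta> / J)) powr s)"
      using D(2)[OF j dot] b unfolding E[OF xy] b_def[symmetric] abs_mult t_def N_def J_def \<theta>_def sphere_dist_def
      by (intro mult_mono) auto
    \<comment> \<open>The normalisations at the two scales multiply to the square of the one at the
      mean scale, since B^j1 B^j2 = X^2; the prefactor 1 / b is the same as in the numerator and
      cancels.\<close>
    have den: "1 / b * (c' * X powr s) \<le> sqrt ((\<integral>\<omega>. (\<beta> j1 x \<omega>)\<^sup>2 \<partial>P) * (\<integral>\<omega>. (\<beta> j2 y \<omega>)\<^sup>2 \<partial>P))"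
    proof (rule real_le_rsqrt)
      have "B ^ (2 * p * (j1 + j1)) * B ^ (2 * p * (j2 + j2)) = (B ^ (2 * p * (j1 + j2)))\<^sup>2"
        by (simp add: power_add[symmetric] power_mult[symmetric] algebra_simps)
      moreover have "(B ^ j1) powr s * (B ^ j2) powr s = (X powr s)\<^sup>2"
      proof -
        have "B ^ j1 * B ^ j2 = X * X"
          using B by (simp add: X_def powr_add[symmetric] powr_realpow[symmetric])
        then show ?thesis using B X by (simp add: power2_eq_square powr_mult[symmetric])
      qed
      moreover have "(1 / (d * q) * (c' * z))\<^sup>2 = (1 / (d * q1) * (c' * z1)) * (1 / (d * q2) * (c' * z2))"
        if "q1 * q2 = q\<^sup>2" "z1 * z2 = z\<^sup>2" for d q q1 q2 z z1 z2 :: real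
      proof -
        have "(1 / (d * q1) * (c' * z1)) * (1 / (d * q2) * (c' * z2)) = (c' * c') * (z1 * z2) / ((d * d) * (q1 * q2))"
          by (simp add: mult_ac)
        then show ?thesis unfolding that by (simp add: power2_eq_square mult_ac)
      qed
      ultimately have "(1 / b * (c' * X powr s))\<^sup>2 = (1 / (4 * pi * B ^ (2 * p * (j1 + j1))) * (c' * (B ^ j1) powr s))
          * (1 / (4 * pi * B ^ (2 * p * (j2 + j2))) * (c' * (B ^ j2) powr s))"
        unfolding b_def by blast
      also have "\<dots> \<le> (\<integral>\<omega>. (\<beta> j1 x \<omega>)\<^sup>2 \<partial>P) * (\<integral>\<omega>. (\<beta> j2 y \<omega>)\<^sup>2 \<partial>P)"
        using V[OF xy(1)] V[OF xy(2)] B c' by (intro mult_mono) (auto intro: order_trans[OF _ V[OF xy(1)]])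
      finally show "(1 / b * (c' * X powr s))\<^sup>2 \<le> (\<integral>\<omega>. (\<beta> j1 x \<omega>)\<^sup>2 \<partial>P) * (\<integral>\<omega>. (\<beta> j2 y \<omega>)\<^sup>2 \<partial>P)" .
    qed
    have "corr P (needlet_coeff T B p j1 (w j1 k1) (\<xi> j1 k1)) (needlet_coeff T B p j2 (w j2 k2) (\<xi> j2 k2))
        = corr P (\<beta> j1 x) (\<beta> j2 y)"
      unfolding x_def[symmetric] y_def[symmetric] F.needlet_coeff_eq[OF B \<open>p \<ge> 1\<close> xy(1)]
        F.needlet_coeff_eq[OF B \<open>p \<ge> 1\<close> xy(2)] \<beta>_def
      using w by (intro corr_scale) auto
    also have "\<bar>\<dots>\<bar> = \<bar>\<integral>\<omega>. \<beta> j1 x \<omega> * \<beta> j2 y \<omega> \<partial>P\<bar> / sqrt ((\<integral>\<omega>. (\<beta> j1 x \<omega>)\<^sup>2 \<partial>P) * (\<integral>\<omega>. (\<beta> j2 y \<omega>)\<^sup>2 \<partial>P))"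
      using order_trans[OF _ den] b c' X by (simp add: corr_def abs_divide)
    also have "\<dots> \<le> (1 / b * (D * (N / (1 + N * \<theta> / J)) powr s)) / (1 / b * (c' * X powr s))"
      using num den b c' X D by (intro frac_le) auto
    also have "\<dots> = D / c' * ((N / (1 + N * \<theta> / J)) powr s / X powr s)" using b by simp
    also have "(N / (1 + N * \<theta> / J)) powr s / X powr s = (N / (1 + N * \<theta> / J) / X) powr s"
      using N X th J by (simp add: powr_divide powr_mult)
    also have "D / c' * \<dots> \<le> D / c' * (1 / (1 + X / J * \<theta>)) powr s"
    proof (intro mult_left_mono powr_mono2)
      have p1: "1 + N * \<theta> / J > 0" "1 + X / J * \<theta> > 0" using N X th J by (auto intro!: add_pos_nonneg)
      \<comment> \<open>For fixed X the quotient N / (1 + N \<theta> / J) / X increases with N and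
        equals the right-hand side at N = X, so N <= X turns localization at the coarser scale into
        localization at the mean scale.\<close>
      have "N * (1 + X / J * \<theta>) \<le> X * (1 + N * \<theta> / J)" using NX by (simp add: algebra_simps)
      then show "N / (1 + N * \<theta> / J) / X \<le> 1 / (1 + X / J * \<theta>)"
        unfolding divide_divide_eq_left using p1 X
        by (subst pos_divide_le_eq) (auto simp: pos_le_divide_eq mult.commute intro: mult_pos_pos)
    qed (use D c' s N X th J in auto)
    also have "(1 / (1 + X / J * \<theta>)) powr s = 1 / (1 + X / J * \<theta>) powr s"
      using X th J by (simp add: powr_divide)
    \<comment> \<open>Division by J is the shift of the exponent by log_B J.\<close>
    also have "X / J = B powr (real (j1 + j2) / 2 - log B (real (j1 + j2) / 2))"
      using B J by (simp add: X_def J_def powr_diff)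
    finally show "\<bar>corr P (needlet_coeff T B p j1 (w j1 k1) (\<xi> j1 k1)) (needlet_coeff T B p j2 (w j2 k2) (\<xi> j2 k2))\<bar>
      \<le> D / c' / (1 + B powr (real (j1 + j2) / 2 - log B (real (j1 + j2) / 2))
                  * sphere_dist (\<xi> j1 k1) (\<xi> j2 k2)) powr (4 * real p + 2 - \<alpha>)"
      by (simp add: s_def \<theta>_def x_def y_def)
  qed
qed

end
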